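(* For every $\varepsilon>0$ there exist $\delta>0$ and a function $h:\mathbb{N}\to\mathbb{R}$ with $h(n)=o(n^2)$ as $n\to\infty$ such that every co-triangle-free graph $G$ of order $n$, whose complement is $\varepsilon$-far from being bipartite, has a triangle packing of size at least $\left(\frac14+\delta\right)n^2+h(n)$.
   Context: All graphs are finite and simple. A graph is co-triangle-free if its complement contains no triangle. An $n$-vertex graph is $\varepsilon$-far from being bipartite if at least $\varepsilon n^2$ edge deletions are required in order to make it bipartite. A triangle packing of a graph $G$ is a collection of pairwise edge-disjoint triangles in $G$; its size is the total number of edges it contains, i.e. three times the number of triangles in it. *)

theory Defs
  imports Complex_Main "HOL-Library.Landau_Symbols"
begin

definition pairs_of :: "'a set \<Rightarrow> 'a set set" where
  "pairs_of V = {e. e \<subseteq> V \<and> card e = 2}"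

definition simple_graph :: "'a set \<Rightarrow> 'a set set \<Rightarrow> bool" where
  "simple_graph V E \<longleftrightarrow> finite V \<and> E \<subseteq> pairs_of V"

definition compl_edges :: "'a set \<Rightarrow> 'a set set \<Rightarrow> 'a set set" where
  "compl_edges V E = pairs_of V - E"

text \<open>In a simple graph a triangle is determined by its vertex set \<open>T\<close>;
  its three edges are the elements of \<open>pairs_of T\<close>.\<close>
definition triangle :: "'a set \<Rightarrow> 'a set set \<Rightarrow> 'a set \<Rightarrow> bool" where
  "triangle V E T \<longleftrightarrow> T \<subseteq> V \<and> card T = 3 \<and> pairs_of T \<subseteq> E"

definition triangle_free :: "'a set \<Rightarrow> 'a set set \<Rightarrow> bool" where
  "triangle_free V E \<longleftrightarrow> \<not> (\<exists>T. triangle V E T)"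

definition co_triangle_free :: "'a set \<Rightarrow> 'a set set \<Rightarrow> bool" where
  "co_triangle_free V E \<longleftrightarrow> triangle_free V (compl_edges V E)"

definition bipartite :: "'a set \<Rightarrow> 'a set set \<Rightarrow> bool" where
  "bipartite V E \<longleftrightarrow>
     (\<exists>A B. A \<union> B = V \<and> A \<inter> B = {} \<and> (\<forall>e\<in>E. \<exists>a\<in>A. \<exists>b\<in>B. e = {a, b}))"

definition far_from_bipartite :: "real \<Rightarrow> 'a set \<Rightarrow> 'a set set \<Rightarrow> bool" where
  "far_from_bipartite \<epsilon> V E \<longleftrightarrow>
     (\<forall>F\<subseteq>E. bipartite V (E - F) \<longrightarrow> real (card F) \<ge> \<epsilon> * (real (card V))\<^sup>2)"

definition triangle_packing :: "'a set \<Rightarrow> 'a set set \<Rightarrow> 'a set set \<Rightarrow> bool" where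
  "triangle_packing V E P \<longleftrightarrow>
     (\<forall>T\<in>P. triangle V E T) \<and> pairwise (\<lambda>S T. pairs_of S \<inter> pairs_of T = {}) P"

definition packing_size :: "'a set set \<Rightarrow> nat" where
  "packing_size P = card (\<Union>T\<in>P. pairs_of T)"

lemma packing_size_eq:
  assumes "simple_graph V E" "triangle_packing V E P"
  shows "packing_size P = 3 * card P"
proof -
  have tri: "T \<subseteq> V \<and> card T = 3" if "T \<in> P" for T
    using assms(2) that by (auto simp: triangle_packing_def triangle_def)
  have finV: "finite V" using assms(1) by (simp add: simple_graph_def)
  have finP: "finite P"
    by (rule finite_subset[of _ "Pow V"]) (use tri finV in auto)
  have fin: "finite T" if "T \<in> P" for T
    using tri[OF that] finV by (auto intro: finite_subset)
  have c3: "card (pairs_of T) = 3" if "T \<in> P" for T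
    using n_subsets[OF fin[OF that], of 2] tri[OF that]
    by (simp add: pairs_of_def choose_two)
  have "card (\<Union>T\<in>P. pairs_of T) = (\<Sum>T\<in>P. card (pairs_of T))"
  proof (rule card_UN_disjoint[OF finP])
    show "\<forall>T\<in>P. finite (pairs_of T)"
      using fin by (auto simp: pairs_of_def)
    show "\<forall>S\<in>P. \<forall>T\<in>P. S \<noteq> T \<longrightarrow> pairs_of S \<inter> pairs_of T = {}"
      using assms(2) by (auto simp: triangle_packing_def pairwise_def)
  qed
  also have "\<dots> = 3 * card P"
    using c3 by simp
  finally show ?thesis by (simp add: packing_size_def)
qed

end

theory Submission
  imports Defs
begin

text \<open>
Write \<open>H\<close> for the complement of the graph \<open>G\<close>, a triangle-free graph on \<open>n\<close> vertices. The proof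
bounds fractional triangle covers of \<open>G\<close> from below, turns the bound into a fractional triangle
packing by linear programming duality, and rounds that packing. Regularity is avoided: the
fractional packing is built by averaging over samples of bounded size, so that every triangle gets
weight \<open>O(1/n)\<close>, and such spread packings can be rounded by a nibble.

Covers. Let \<open>g\<close> be nonnegative on the pairs of \<open>G\<close>, including the pairs \<open>{x, x}\<close>, with sum at least
\<open>1\<close> over every triangle of \<open>G\<close>, possibly with repeated vertices. The central fact
(\<open>two_colourable_if_degrees_small\<close>) is that if every vertex has weighted degree
\<open>\<Sum>y. g x y\<close> at most \<open>n/6 + n/1000\<close>, then \<open>H\<close> is bipartite; since the two colour classes are then
cliques of \<open>G\<close>, it follows that some vertex always has degree at least \<open>n/6\<close>. Deleting vertices of
such a degree one by one, as in the inductive proof of Mantel's theorem, shows that \<open>g\<close> has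
total weight about \<open>n\<^sup>2/12\<close>, and quadratically more if \<open>H\<close> contains linearly many disjoint
non-bipartite pieces (\<open>cover_weight_lower_bound\<close>).

The central fact is an extremal argument. Neighbourhoods in \<open>H\<close> are cliques of \<open>G\<close>, and averaging the
cover condition over a clique bounds its size by three times the largest degree. If \<open>x y\<close> is the
lightest pair of \<open>G\<close>, then a light pair makes the edges from \<open>x\<close> and \<open>y\<close> to their common
\<open>G\<close>-neighbours heavy, while light edges from \<open>y\<close> into the clique of \<open>H\<close>-neighbours of \<open>x\<close> make
that clique heavy; adding the two effects, all the unknown quantities cancel and the \<open>H\<close>-degrees of
\<open>x\<close> and \<open>y\<close> must add up to almost \<open>n\<close> (\<open>exists_vertex_of_large_degree\<close>). So \<open>H\<close> has an independent set
\<open>A\<close> of almost \<open>n/2\<close> vertices, which carries the weight of its vertices almost alone; hence almost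
every other vertex is \<open>H\<close>-adjacent to nearly all of \<open>A\<close>, these vertices form a second such set, and
every vertex has to be \<open>H\<close>-adjacent to nearly all of one of the two sets and to nothing in the other.

Samples. If \<open>H\<close> is far from bipartite, a random list of bounded length spans a non-bipartite graph
with probability at least one half (\<open>bipartiteness_tester\<close>). A sample that consists of many such lists
therefore contains many disjoint non-bipartite pieces, and its fractional packing exceeds the
density \<open>1/4\<close> by a constant. Averaging over all samples gives a spread packing of \<open>G\<close> of the same
density (\<open>spread_fractional_packing\<close>).

Rounding. The triangles of a graph, seen as triples of edges, form a linear hypergraph. For these the
nibble loses only \<open>o(n\<^sup>2)\<close> edges if all weights are small (\<open>spread_fractional_matching_rounding\<close>).
\<close>

section \<open>Two-colourable relations\<close>

definition two_colourable :: "'a set \<Rightarrow> ('a \<Rightarrow> 'a \<Rightarrow> bool) \<Rightarrow> bool" where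
  "two_colourable V H \<longleftrightarrow> (\<exists>P. \<forall>x\<in>V. \<forall>y\<in>V. H x y \<longrightarrow> (x \<in> P) \<noteq> (y \<in> P))"

lemma two_colourable_subset: "two_colourable V H \<Longrightarrow> U \<subseteq> V \<Longrightarrow> two_colourable U H"
  unfolding two_colourable_def by (meson subsetD)

lemma card_disjoint_filters:
  assumes "finite C" "\<And>y. y \<in> C \<Longrightarrow> P y \<Longrightarrow> \<not> Q y"
  shows "real (card {y\<in>C. P y}) + real (card {y\<in>C. Q y}) \<le> real (card C)"
proof -
  have "card {y\<in>C. P y} + card {y\<in>C. Q y} = card ({y\<in>C. P y} \<union> {y\<in>C. Q y})"
    using assms by (intro card_Un_disjoint[symmetric]) auto
  also have "\<dots> \<le> card C" using assms(1) by (intro card_mono) auto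
  finally show ?thesis by linarith
qed

lemma card_filter_compl:
  assumes "finite C"
  shows "real (card {y\<in>C. P y}) + real (card {y\<in>C. \<not> P y}) = real (card C)"
proof -
  have "card ({y\<in>C. P y} \<union> {y\<in>C. \<not> P y}) = card {y\<in>C. P y} + card {y\<in>C. \<not> P y}"
    using assms by (intro card_Un_disjoint) auto
  moreover have "{y\<in>C. P y} \<union> {y\<in>C. \<not> P y} = C" by auto
  ultimately show ?thesis by simp
qed

section \<open>Vertices of large degree in a fractional triangle cover\<close>

locale triangle_free_relation =
  fixes H :: "'a \<Rightarrow> 'a \<Rightarrow> bool"
  assumes H_sym: "H x y \<Longrightarrow> H y x"
    and H_irrefl: "\<not> H x x"
    and H_triangle_free: "H x y \<Longrightarrow> H y z \<Longrightarrow> \<not> H x z"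

text \<open>The relation \<open>H\<close> is the complement; \<open>g\<close> is a fractional triangle cover of the graph \<open>G\<close> whose
pairs are the pairs outside \<open>H\<close>. Here \<open>x y\<close>, \<open>y z\<close> and \<open>x z\<close> may coincide, so the condition also speaks
about degenerate triangles and forces \<open>1/3 \<le> g x x\<close>. This is what makes sums over all ordered triples of
a clique exact, without lower order terms. Setting \<open>g\<close> to zero on \<open>H\<close> lets a weighted degree be a
sum over all of \<open>V\<close>.\<close>

locale triangle_cover = triangle_free_relation H for H :: "'a \<Rightarrow> 'a \<Rightarrow> bool" +
  fixes V :: "'a set" and g :: "'a \<Rightarrow> 'a \<Rightarrow> real"
  assumes finite_V: "finite V"
    and g_sym: "g x y = g y x"
    and g_nonneg: "0 \<le> g x y"
    and g_H: "H x y \<Longrightarrow> g x y = 0"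
    and g_cover: "x \<in> V \<Longrightarrow> y \<in> V \<Longrightarrow> z \<in> V \<Longrightarrow> \<not> H x y \<Longrightarrow> \<not> H y z \<Longrightarrow> \<not> H x z
                   \<Longrightarrow> 1 \<le> g x y + g y z + g x z"
begin

definition wt :: "'a set \<Rightarrow> 'a set \<Rightarrow> real" where
  "wt A B = (\<Sum>x\<in>A. \<Sum>y\<in>B. g x y)"

abbreviation nb :: "'a \<Rightarrow> 'a set" where "nb x \<equiv> {y\<in>V. H x y}"

lemma finite_sub: "A \<subseteq> V \<Longrightarrow> finite A"
  using finite_V finite_subset by blast

lemma wt_sym: "wt A B = wt B A"
  unfolding wt_def by (subst sum.swap) (simp add: g_sym)

lemma wt_nonneg: "0 \<le> wt A B"
  unfolding wt_def by (intro sum_nonneg g_nonneg)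

lemma wt_single: "wt {x} B = (\<Sum>y\<in>B. g x y)"
  unfolding wt_def by simp

lemma wt_Un_right: "finite B \<Longrightarrow> finite C \<Longrightarrow> B \<inter> C = {} \<Longrightarrow> wt A (B \<union> C) = wt A B + wt A C"
  unfolding wt_def by (simp add: sum.union_disjoint sum.distrib)

lemma wt_mono_right: "finite C \<Longrightarrow> B \<subseteq> C \<Longrightarrow> wt A B \<le> wt A C"
  unfolding wt_def by (intro sum_mono sum_mono2) (auto simp: g_nonneg)

lemma wt_eq_sum_single: "wt A B = (\<Sum>x\<in>A. wt {x} B)"
  unfolding wt_def by simp

text \<open>This is used with \<open>A = B = C\<close>, with a singleton and a clique, and with two parts of one clique, where it
trades light pairs of one kind against heavy pairs of another.\<close>

lemma triple_count:
  assumes sub: "A \<subseteq> V" "B \<subseteq> V" "C \<subseteq> V"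
    and non: "\<And>x y. x \<in> A \<Longrightarrow> y \<in> B \<Longrightarrow> \<not> H x y"
      "\<And>y z. y \<in> B \<Longrightarrow> z \<in> C \<Longrightarrow> \<not> H y z"
      "\<And>x z. x \<in> A \<Longrightarrow> z \<in> C \<Longrightarrow> \<not> H x z"
  shows "real (card A) * real (card B) * real (card C)
           \<le> real (card C) * wt A B + real (card A) * wt B C + real (card B) * wt A C"
proof -
  have "real (card A) * real (card B) * real (card C) = (\<Sum>x\<in>A. \<Sum>y\<in>B. \<Sum>z\<in>C. 1)"
    by simp
  also have "\<dots> \<le> (\<Sum>x\<in>A. \<Sum>y\<in>B. \<Sum>z\<in>C. g x y + g y z + g x z)"
    using sub non by (intro sum_mono g_cover) auto
  also have "\<dots> = real (card C) * wt A B + real (card A) * wt B C + real (card B) * wt A C"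
    by (simp add: wt_def sum.distrib sum_distrib_left)
  finally show ?thesis .
qed

definition clique :: "'a set \<Rightarrow> bool" where
  "clique A \<longleftrightarrow> A \<subseteq> V \<and> (\<forall>x\<in>A. \<forall>y\<in>A. \<not> H x y)"

lemma cliqueD: "clique A \<Longrightarrow> x \<in> A \<Longrightarrow> y \<in> A \<Longrightarrow> \<not> H x y"
  by (auto simp: clique_def)

lemma clique_subset: "clique A \<Longrightarrow> B \<subseteq> A \<Longrightarrow> clique B"
  by (auto simp: clique_def)

lemma clique_nb: "clique (nb x)"
  unfolding clique_def using H_triangle_free H_sym by blast

lemma clique_weight:
  assumes "clique A"
  shows "(real (card A))\<^sup>2 / 3 \<le> wt A A"
proof (cases "card A = 0")
  case False
  have "real (card A) * real (card A) * real (card A) \<le> 3 * (real (card A) * wt A A)"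
    using triple_count[of A A A] assms by (auto simp: clique_def)
  then have "real (card A) * (real (card A) * real (card A)) \<le> real (card A) * (3 * wt A A)"
    by (simp add: algebra_simps)
  then show ?thesis using False by (simp add: power2_eq_square)
qed (simp add: wt_nonneg)

lemma wt_le_of_degree_bound:
  assumes "A \<subseteq> V" "\<And>x. x \<in> V \<Longrightarrow> wt {x} V \<le> L"
  shows "wt A V \<le> real (card A) * L"
proof -
  have "wt A V \<le> (\<Sum>x\<in>A. L)"
    unfolding wt_eq_sum_single[of A] using assms by (intro sum_mono) auto
  then show ?thesis by simp
qed

text \<open>The pairs inside a clique have average weight at least \<open>1/3\<close>, so its vertices have average degree at
least a third of its size. Applied to the neighbourhoods of \<open>H\<close>, this bounds the degrees of \<open>H\<close>.\<close>

lemma clique_card_le: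
  assumes "clique A" and L: "\<And>x. x \<in> V \<Longrightarrow> wt {x} V \<le> L" and "0 \<le> L"
  shows "real (card A) \<le> 3 * L"
proof (cases "card A = 0")
  case False
  have "A \<subseteq> V" using assms(1) by (simp add: clique_def)
  have "(real (card A))\<^sup>2 / 3 \<le> wt A A" by (rule clique_weight) fact
  also have "\<dots> \<le> wt A V" using finite_V \<open>A \<subseteq> V\<close> by (intro wt_mono_right) auto
  also have "\<dots> \<le> real (card A) * L" by (rule wt_le_of_degree_bound) (fact, fact)
  finally have "real (card A) * real (card A) \<le> real (card A) * (3 * L)"
    by (simp add: power2_eq_square)
  then show ?thesis using False by simp
qed (use assms in simp)

text \<open>Light edges from \<open>y\<close> into the part of \<open>nb x\<close> outside \<open>nb y\<close> force heavy pairs inside that part, because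
the part is a clique; but the vertices of the part have bounded degree, of which the pairs towards
\<open>nb x \<inter> nb y\<close> take at least \<open>m\<close> each.\<close>

lemma private_neighbourhood_bound:
  assumes L: "\<And>x. x \<in> V \<Longrightarrow> wt {x} V \<le> L" and "0 \<le> L" and y: "y \<in> V"
    and low: "\<And>u v. u \<in> V \<Longrightarrow> v \<in> V \<Longrightarrow> \<not> H u v \<Longrightarrow> m \<le> g u v" and m: "0 \<le> m" "m \<le> 1/3"
  shows "real (card (nb x - nb y)) - 2 * wt {y} (nb x - nb y) + real (card (nb x \<inter> nb y)) * m \<le> L"
proof (cases "card (nb x - nb y) = 0")
  case True
  then have "nb x - nb y = {}" using finite_V by auto
  then have [simp]: "wt {y} (nb x - nb y) = 0" by (simp only: wt_def) simp
  have "real (card (nb x \<inter> nb y)) \<le> 3 * L"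
    by (rule clique_card_le[OF clique_subset[OF clique_nb[of x]] L]) (use \<open>0 \<le> L\<close> in auto)
  then have "real (card (nb x \<inter> nb y)) * m \<le> 3 * L * (1/3)"
    using m \<open>0 \<le> L\<close> by (intro mult_mono) auto
  then show ?thesis using True by simp
next
  case False
  define X where "X = nb x - nb y"
  define K where "K = nb x \<inter> nb y"
  have XV: "X \<subseteq> V" "K \<subseteq> V" "finite X" "finite K" "X \<inter> K = {}"
    using finite_V by (auto simp: X_def K_def)
  have non: "\<not> H u v" if "u \<in> X" "v \<in> X \<union> K" for u v
    using that by (intro cliqueD[OF clique_nb[of x]]) (auto simp: X_def K_def)
  have yX: "\<not> H y v" if "v \<in> X" for v using that XV by (auto simp: X_def)
  have "real (card {y}) * real (card X) * real (card X)
          \<le> real (card X) * wt {y} X + real (card {y}) * wt X X + real (card X) * wt {y} X"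
    by (rule triple_count) (use XV y yX non in blast)+
  then have 1: "(real (card X))\<^sup>2 \<le> 2 * real (card X) * wt {y} X + wt X X"
    by (simp add: power2_eq_square)
  have "real (card X) * (real (card K) * m) = (\<Sum>u\<in>X. \<Sum>v\<in>K. m)" by simp
  also have "\<dots> \<le> wt X K"
    unfolding wt_def using XV non by (intro sum_mono low) auto
  finally have 2: "real (card X) * (real (card K) * m) \<le> wt X K" .
  have "wt X X + wt X K = wt X (X \<union> K)" using XV by (simp add: wt_Un_right)
  also have "\<dots> \<le> wt X V" using XV finite_V by (intro wt_mono_right) auto
  also have "\<dots> \<le> real (card X) * L" by (rule wt_le_of_degree_bound) (fact XV, fact L)
  finally have "real (card X) * (real (card X) - 2 * wt {y} X + real (card K) * m) \<le> real (card X) * L"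
    using 1 2 by (simp add: algebra_simps power2_eq_square)
  moreover have "real (card X) > 0" using False by (simp add: X_def)
  ultimately show ?thesis by (simp add: X_def K_def)
qed

text \<open>If all pairs weigh at least \<open>1/3\<close>, the degree bound directly bounds the number of \<open>G\<close>-neighbours.
Otherwise the lightest pair \<open>x y\<close> is examined. Up to the term with \<open>N - s\<close>, which helps as long as
\<open>s \<le> N\<close>, the inequality obtained is \<open>4 N / 3 - s / 3 \<le> N + 6 D\<close> with \<open>s\<close> the sum of the
\<open>H\<close>-degrees of \<open>x\<close> and \<open>y\<close>: neither the size of the common neighbourhood nor the weights towards the
private ones survive.\<close>

lemma exists_vertex_of_large_degree:
  assumes L: "\<And>x. x \<in> V \<Longrightarrow> wt {x} V \<le> real (card V) / 6 + D" and "0 \<le> D" and "V \<noteq> {}"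
  shows "\<exists>x\<in>V. real (card V) - 18 * D \<le> 2 * real (card (nb x))"
proof (cases "\<forall>x\<in>V. \<forall>y\<in>V. \<not> H x y \<longrightarrow> 1/3 \<le> g x y")
  case True
  from \<open>V \<noteq> {}\<close> obtain x where x: "x \<in> V" by auto
  have "(\<Sum>y\<in>{y\<in>V. \<not> H x y}. 1/3) \<le> wt {x} {y\<in>V. \<not> H x y}"
    unfolding wt_single using True x by (intro sum_mono) auto
  also have "\<dots> \<le> wt {x} V" using finite_V by (intro wt_mono_right) auto
  also have "\<dots> \<le> real (card V) / 6 + D" using L x by simp
  finally have "real (card {y\<in>V. \<not> H x y}) / 3 \<le> real (card V) / 6 + D" by simp
  then have "real (card V) - 18 * D \<le> 2 * real (card (nb x))"
    using card_filter_compl[OF finite_V, of "H x"] \<open>0 \<le> D\<close> by (simp add: field_simps)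
  then show ?thesis using x by blast
next
  case False
  define N where "N = real (card V)"
  define Q where "Q = {p \<in> V \<times> V. \<not> H (fst p) (snd p)}"
  have finQ: "finite Q" "Q \<noteq> {}" using False finite_V by (auto simp: Q_def)
  define p where "p = arg_min_on (case_prod g) Q"
  have p: "p \<in> Q" and pmin: "\<And>q. q \<in> Q \<Longrightarrow> case_prod g p \<le> case_prod g q"
    unfolding p_def using finQ by (rule arg_min_if_finite, intro arg_min_least)
  obtain x y where xy: "p = (x, y)" by (cases p)
  define m where "m = g x y"
  have x: "x \<in> V" and y: "y \<in> V" and nxy: "\<not> H x y" using p by (auto simp: Q_def xy)
  have low: "m \<le> g u v" if "u \<in> V" "v \<in> V" "\<not> H u v" for u v
    using pmin[of "(u, v)"] that by (simp add: Q_def xy m_def)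
  obtain u v where "u \<in> V" "v \<in> V" "\<not> H u v" "g u v < 1/3" using False by (auto simp: not_le)
  then have m: "0 \<le> m" "m \<le> 1/3"
    using low[of u v] g_nonneg[of x y] by (auto simp: m_def)
  have L0: "0 \<le> N / 6 + D" using \<open>0 \<le> D\<close> by (simp add: N_def)
  define X where "X = nb x - nb y"
  define Y where "Y = nb y - nb x"
  define K where "K = nb x \<inter> nb y"
  define M where "M = V - nb x - nb y"
  have fin: "finite X" "finite Y" "finite K" "finite M"
    using finite_V by (auto simp: X_def Y_def K_def M_def)
  have KI: "K = nb y \<inter> nb x" by (auto simp: K_def)
  (* The weights from y into X occur with coefficient -2 here and with coefficient 1 in the
     degree bound for y, so they cancel when bX and bY are added to twice the degree bounds. *)
  have bX: "real (card X) - 2 * wt {y} X + real (card K) * m \<le> N / 6 + D"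
    unfolding X_def K_def N_def
    by (rule private_neighbourhood_bound) (use L L0 y low m in \<open>auto simp: N_def\<close>)
  have bY: "real (card Y) - 2 * wt {x} Y + real (card K) * m \<le> N / 6 + D"
    unfolding Y_def KI N_def
    by (rule private_neighbourhood_bound) (use L L0 x low m in \<open>auto simp: N_def\<close>)
  have "wt {x} M + wt {x} Y = wt {x} (M \<union> Y)"
    using fin by (subst wt_Un_right) (auto simp: M_def Y_def)
  also have "\<dots> \<le> wt {x} V" using finite_V by (intro wt_mono_right) (auto simp: M_def Y_def)
  finally have dx: "wt {x} M + wt {x} Y \<le> N / 6 + D" using L[OF x] by (simp add: N_def)
  have "wt {y} M + wt {y} X = wt {y} (M \<union> X)"
    using fin by (subst wt_Un_right) (auto simp: M_def X_def)
  also have "\<dots> \<le> wt {y} V" using finite_V by (intro wt_mono_right) (auto simp: M_def X_def)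
  finally have dy: "wt {y} M + wt {y} X \<le> N / 6 + D" using L[OF y] by (simp add: N_def)
  have "real (card M) * (1 - m) = (\<Sum>z\<in>M. 1 - m)" by simp
  also have "\<dots> \<le> (\<Sum>z\<in>M. g x z + g y z)"
  proof (rule sum_mono)
    fix z assume "z \<in> M"
    then have "1 \<le> g x y + g y z + g x z"
      using x y nxy by (intro g_cover) (auto simp: M_def)
    then show "1 - m \<le> g x z + g y z" by (simp add: m_def)
  qed
  also have "\<dots> = wt {x} M + wt {y} M" by (simp add: wt_single sum.distrib)
  finally have bM: "real (card M) * (1 - m) \<le> wt {x} M + wt {y} M" .
  have "card V = card (M \<union> X \<union> Y \<union> K)"
    by (rule arg_cong[of _ _ card]) (auto simp: X_def Y_def K_def M_def)
  also have "card (M \<union> X \<union> Y \<union> K) = card (M \<union> X \<union> Y) + card K"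
    using fin by (intro card_Un_disjoint) (auto simp: X_def Y_def K_def M_def)
  also have "card (M \<union> X \<union> Y) = card (M \<union> X) + card Y"
    using fin by (intro card_Un_disjoint) (auto simp: X_def Y_def K_def M_def)
  also have "card (M \<union> X) = card M + card X"
    using fin by (intro card_Un_disjoint) (auto simp: X_def Y_def K_def M_def)
  finally have "card V = card M + card X + card Y + card K" .
  then have cV: "real (card M) = N - real (card X) - real (card Y) - real (card K)"
    by (simp add: N_def)
  have "nb x = X \<union> K" "nb y = Y \<union> K" "X \<inter> K = {}" "Y \<inter> K = {}"
    by (auto simp: X_def Y_def K_def)
  then have cn: "card (nb x) = card X + card K" "card (nb y) = card Y + card K"
    using fin by (metis card_Un_disjoint)+
  define s where "s = real (card (nb x)) + real (card (nb y))"
  have s: "s = real (card X) + real (card Y) + 2 * real (card K)" by (simp add: s_def cn)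
  have "2 * (real (card M) * (1 - m)) + real (card X) + real (card Y) + 2 * (real (card K) * m)
          \<le> N + 6 * D"
    using bX bY dx dy bM by linarith
  moreover have "2 * (real (card M) * (1 - m)) + real (card X) + real (card Y) + 2 * (real (card K) * m)
          = 4 * N / 3 - s / 3 + 2 * ((1/3 - m) * (N - s))"
    unfolding cV s by (simp add: algebra_simps)
  ultimately have key: "4 * N / 3 - s / 3 + 2 * ((1/3 - m) * (N - s)) \<le> N + 6 * D" by simp
  have "N - 18 * D \<le> s"
  proof (cases "N \<le> s")
    case False
    then have "0 \<le> (1/3 - m) * (N - s)" using m by (intro mult_nonneg_nonneg) auto
    then show ?thesis using key by linarith
  qed (use \<open>0 \<le> D\<close> in linarith)
  then have "N - 18 * D \<le> 2 * real (card (nb x)) \<or> N - 18 * D \<le> 2 * real (card (nb y))"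
    unfolding s_def by linarith
  then show ?thesis using x y by (auto simp: N_def)
qed

text \<open>In a clique whose vertices all have degree close to the least possible average, no subset \<open>P\<close> can be
noticeably heavier than a third of its pairs: the excess inside \<open>P\<close> would have to be compensated by
light pairs between \<open>P\<close> and its complement \<open>Q\<close>, and these make \<open>Q\<close> or again \<open>P\<close> too heavy. A vertex \<open>z\<close>
joined in \<open>G\<close> to all of \<open>P\<close> therefore sends average weight about \<open>1/3\<close> to \<open>P\<close>.\<close>

lemma weight_into_clique:
  assumes A: "clique A" and psi: "0 \<le> \<psi>"
    and bal: "\<And>y. y \<in> A \<Longrightarrow> wt {y} A \<le> real (card A) / 3 + \<psi>" and z: "z \<in> V"
  shows "real (card {y\<in>A. \<not> H z y}) / 3 - \<psi> \<le> wt {z} {y\<in>A. \<not> H z y}"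
proof (cases "card {y\<in>A. \<not> H z y} = 0")
  case True
  then show ?thesis using psi wt_nonneg[of "{z}" "{y\<in>A. \<not> H z y}"] by simp
next
  case False
  define P where "P = {y\<in>A. \<not> H z y}"
  define Q where "Q = {y\<in>A. H z y}"
  have AV: "A \<subseteq> V" and AA: "\<And>u v. u \<in> A \<Longrightarrow> v \<in> A \<Longrightarrow> \<not> H u v" using A by (auto simp: clique_def)
  have fin: "finite P" "finite Q" and PQ: "P \<inter> Q = {}" "P \<union> Q = A" "P \<subseteq> A" "Q \<subseteq> A"
    using finite_sub[OF AV] by (auto simp: P_def Q_def)
  define p where "p = real (card P)"
  define q where "q = real (card Q)"
  have a: "real (card A) = p + q"
    using card_Un_disjoint[OF fin PQ(1)] PQ(2) by (simp add: p_def q_def)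
  have p: "0 < p" using False by (simp add: p_def P_def)
  have q: "0 \<le> q" by (simp add: q_def)
  have deg: "wt B P + wt B Q \<le> real (card B) * ((p + q) / 3 + \<psi>)" if "B \<subseteq> A" for B
  proof -
    have "wt B P + wt B Q = wt B A" using fin PQ by (metis wt_Un_right)
    also have "\<dots> \<le> (\<Sum>y\<in>B. (p + q) / 3 + \<psi>)"
      unfolding wt_eq_sum_single[of B] using that bal a by (intro sum_mono) auto
    finally show ?thesis by simp
  qed
  have d1: "wt P P + wt P Q \<le> p * ((p + q) / 3 + \<psi>)" using deg[OF PQ(3)] by (simp add: p_def)
  have d2: "wt P Q + wt Q Q \<le> q * ((p + q) / 3 + \<psi>)"
    using deg[OF PQ(4)] wt_sym[of P Q] by (simp add: q_def)
  have t1: "p * q * q \<le> 2 * (q * wt P Q) + p * wt Q Q"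
  proof -
    have "real (card P) * real (card Q) * real (card Q)
            \<le> real (card Q) * wt P Q + real (card P) * wt Q Q + real (card Q) * wt P Q"
      by (rule triple_count) (use PQ AV AA in blast)+
    then show ?thesis by (simp add: p_def q_def)
  qed
  have t2: "p * p * q \<le> q * wt P P + 2 * (p * wt P Q)"
  proof -
    have "real (card P) * real (card P) * real (card Q)
            \<le> real (card Q) * wt P P + real (card P) * wt P Q + real (card P) * wt P Q"
      by (rule triple_count) (use PQ AV AA in blast)+
    then show ?thesis by (simp add: p_def q_def)
  qed
  (* The deficit of the pairs between P and Q; it is bounded using triangles with two vertices in
     the larger of the two parts. *)
  define X where "X = p * q / 3 - wt P Q"
  have S11: "wt P P \<le> p * p / 3 + p * \<psi> + X"
    using d1 by (simp add: X_def field_simps)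
  have S22: "wt Q Q \<le> q * q / 3 + q * \<psi> + X"
    using d2 by (simp add: X_def field_simps)
  have SPQ: "wt P Q = p * q / 3 - X" by (simp add: X_def)
  have X: "X \<le> p * \<psi>"
  proof (cases "X \<le> 0")
    case True
    then show ?thesis using p psi by (meson mult_nonneg_nonneg less_imp_le order_trans)
  next
    case X0: False
    show ?thesis
    proof (cases "q \<le> p")
      case True
      have "q * wt P P \<le> q * (p * p / 3 + p * \<psi> + X)" using S11 q by (rule mult_left_mono)
      with t2 have "X * (2 * p - q) \<le> p * (q * \<psi>)" unfolding SPQ by (simp add: field_simps)
      moreover have "X * p \<le> X * (2 * p - q)" using True X0 by (intro mult_left_mono) auto
      ultimately have "p * X \<le> p * (q * \<psi>)" by (simp add: mult.commute)
      then have "X \<le> q * \<psi>" using p by simp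
      also have "\<dots> \<le> p * \<psi>" using True psi by (rule mult_right_mono)
      finally show ?thesis .
    next
      case False
      have "p * wt Q Q \<le> p * (q * q / 3 + q * \<psi> + X)" using S22 p by (intro mult_left_mono) auto
      with t1 have "X * (2 * q - p) \<le> q * (p * \<psi>)" unfolding SPQ by (simp add: field_simps)
      moreover have "X * q \<le> X * (2 * q - p)" using False X0 by (intro mult_left_mono) auto
      ultimately have "q * X \<le> q * (p * \<psi>)" by (simp add: mult.commute)
      then show ?thesis using False p by simp
    qed
  qed
  have "real (card {z}) * p * p \<le> p * wt {z} P + real (card {z}) * wt P P + p * wt {z} P"
    unfolding p_def
    by (rule triple_count) (use PQ AV AA z in \<open>auto simp: P_def\<close>)
  then have "p * p \<le> 2 * (p * wt {z} P) + wt P P" by simp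
  with S11 X have "p * (p / 3) \<le> p * (wt {z} P + \<psi>)" by (simp add: algebra_simps)
  then have "p / 3 \<le> wt {z} P + \<psi>" using p by simp
  then show ?thesis by (simp add: p_def P_def)
qed

text \<open>The constants in the proof are multiples of \<open>D\<close> that only have to stay far below \<open>N\<close>. The classes of the
colouring are the vertices without \<open>H\<close>-neighbours in \<open>A\<close> and the remaining vertices, which turn out to
have no \<open>H\<close>-neighbours in \<open>B\<close>.\<close>

theorem two_colourable_if_degrees_small:
  assumes L: "\<And>x. x \<in> V \<Longrightarrow> wt {x} V \<le> real (card V) / 6 + D" and "0 \<le> D"
    and D: "1000 * D \<le> real (card V)"
  shows "two_colourable V H"
proof (cases "V = {}")
  case True
  then show ?thesis by (simp add: two_colourable_def)
next
  case nonempty: False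
  define N where "N = real (card V)"
  have N: "0 < N" "1000 * D \<le> N"
    using nonempty finite_V D by (auto simp: N_def card_gt_0_iff)
  have L': "wt {x} V \<le> N / 6 + D" if "x \<in> V" for x using L[OF that] by (simp add: N_def)
  have L0: "0 \<le> N / 6 + D" using N \<open>0 \<le> D\<close> by simp
  obtain x where x: "x \<in> V" and dx: "N - 18 * D \<le> 2 * real (card (nb x))"
    using exists_vertex_of_large_degree[OF L \<open>0 \<le> D\<close> nonempty] by (auto simp: N_def)
  define A where "A = nb x"
  define a where "a = real (card A)"
  have A: "clique A" "A \<subseteq> V" "finite A" using clique_nb finite_V by (auto simp: A_def)
  have a1: "N / 2 - 9 * D \<le> a" using dx by (simp add: a_def A_def)
  have a2: "a \<le> N / 2 + 3 * D"
    using clique_card_le[OF A(1) L' L0] by (simp add: a_def)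
  define R where "R = V - A"
  have R: "finite R" "R \<subseteq> V" using finite_V by (auto simp: R_def)
  define p where "p z = real (card {y\<in>A. \<not> H z y})" for z
  have balA: "wt {y} A \<le> real (card A) / 3 + 4 * D" if "y \<in> A" for y
  proof -
    have "wt {y} A \<le> wt {y} V" using finite_V A by (intro wt_mono_right) auto
    then show ?thesis using L'[of y] that A a1 by (auto simp: a_def)
  qed
  have intoA: "p z / 3 - 4 * D \<le> wt {z} A" if "z \<in> V" for z
  proof -
    have "p z / 3 - 4 * D \<le> wt {z} {y\<in>A. \<not> H z y}"
      unfolding p_def using weight_into_clique[OF A(1) _ balA that] \<open>0 \<le> D\<close> by simp
    also have "\<dots> \<le> wt {z} A" using A by (intro wt_mono_right) auto
    finally show ?thesis .
  qed
  have "wt A A + wt A R = wt A V"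
    using A R by (subst wt_Un_right[symmetric]) (auto simp: R_def Un_absorb1)
  also have "\<dots> \<le> a * (N / 6 + D)"
    unfolding a_def by (rule wt_le_of_degree_bound) (fact A, fact L')
  finally have "wt A R \<le> a * (N / 6 + D) - a * a / 3"
    using clique_weight[OF A(1)] by (simp add: a_def power2_eq_square)
  also have "\<dots> = a * (N / 6 + D - a / 3)" by (simp add: algebra_simps)
  also have "\<dots> \<le> a * (4 * D)" using a1 by (intro mult_left_mono) (auto simp: a_def)
  finally have SAR: "wt A R \<le> a * (4 * D)" .
  have "(\<Sum>z\<in>R. p z / 3 - 4 * D) \<le> wt R A"
    unfolding wt_eq_sum_single[of R] using R intoA by (intro sum_mono) auto
  then have "(\<Sum>z\<in>R. p z) / 3 - real (card R) * (4 * D) \<le> a * (4 * D)"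
    using SAR wt_sym[of A R] by (simp add: sum_subtractf sum_divide_distrib)
  moreover have "a + real (card R) = N"
    using card_Diff_subset[OF A(3) A(2)] card_mono[OF finite_V A(2)]
    by (simp add: a_def R_def N_def of_nat_diff)
  then have "real (card R) * (4 * D) + a * (4 * D) = N * (4 * D)"
    by (metis add.commute distrib_right)
  ultimately have sump: "(\<Sum>z\<in>R. p z) \<le> 12 * (N * D)" by linarith
  (* Two vertices of B have a common H-neighbour in A, as each is H-adjacent to more than half
     of A. Hence B is a clique of G. *)
  define B where "B = {z\<in>R. 2 * p z < a}"
  define b where "b = real (card B)"
  have B: "finite B" "B \<subseteq> V" "A \<inter> B = {}"
    using finite_subset[of B R] R by (auto simp: B_def R_def)
  have "real (card (R - B)) * (a / 2) = (\<Sum>z\<in>R - B. a / 2)" by simp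
  also have "\<dots> \<le> (\<Sum>z\<in>R - B. p z)" by (intro sum_mono) (auto simp: B_def)
  also have "\<dots> \<le> (\<Sum>z\<in>R. p z)" using R by (intro sum_mono2) (auto simp: p_def)
  finally have RB1: "real (card (R - B)) * (a / 2) \<le> 12 * (N * D)" using sump by simp
  have "12 * N \<le> 25 * a" using a1 N \<open>0 \<le> D\<close> by linarith
  then have "12 * N * D \<le> 25 * a * D" using \<open>0 \<le> D\<close> by (rule mult_right_mono)
  with RB1 have "a * real (card (R - B)) \<le> a * (50 * D)" by (simp add: algebra_simps)
  moreover have "0 < a" using a1 N \<open>0 \<le> D\<close> by linarith
  ultimately have RB: "real (card (R - B)) \<le> 50 * D" by simp
  have "real (card R) = b + real (card (R - B))"
    using card_Diff_subset[OF B(1), of R] card_mono[OF R(1), of B]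
    by (simp add: b_def B_def of_nat_diff)
  with RB \<open>a + real (card R) = N\<close> have ab: "N - 50 * D \<le> a + b" by linarith
  then have b1: "N / 2 - 53 * D \<le> b" using a2 by linarith
  have cB: "clique B"
    unfolding clique_def
  proof (intro conjI ballI notI)
    fix u v assume uv: "u \<in> B" "v \<in> B" "H u v"
    have "real (card {y\<in>A. H u y}) + real (card {y\<in>A. H v y}) \<le> real (card A)"
      by (rule card_disjoint_filters[OF A(3)]) (use uv H_triangle_free in blast)
    then show False
      using card_filter_compl[OF A(3), of "H u"] card_filter_compl[OF A(3), of "H v"] uv
      by (simp add: B_def p_def a_def)
  qed (fact B)
  have b2: "b \<le> N / 2 + 3 * D"
    using clique_card_le[OF cB L' L0] by (simp add: b_def)
  have balB: "wt {y} B \<le> real (card B) / 3 + 19 * D" if "y \<in> B" for y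
  proof -
    have "wt {y} B \<le> wt {y} V" using finite_V B by (intro wt_mono_right) auto
    then show ?thesis using L'[of y] that B b1 \<open>0 \<le> D\<close> by (auto simp: b_def)
  qed
  define \<alpha> where "\<alpha> z = real (card {y\<in>A. H z y})" for z
  define \<beta> where "\<beta> z = real (card {y\<in>B. H z y})" for z
  (* Into A and into B a vertex sends average weight about 1/3 per G-edge, so its degree leaves
     room for at most about N / 2 edges of G into A and B together. *)
  have ab_deg: "N / 2 - 122 * D \<le> \<alpha> z + \<beta> z" if z: "z \<in> V" for z
  proof -
    define q where "q = real (card {y\<in>B. \<not> H z y})"
    have "q / 3 - 19 * D \<le> wt {z} {y\<in>B. \<not> H z y}"
      unfolding q_def using weight_into_clique[OF cB _ balB z] \<open>0 \<le> D\<close> by simp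
    also have "\<dots> \<le> wt {z} B" using B by (intro wt_mono_right) auto
    finally have "q / 3 - 19 * D \<le> wt {z} B" .
    moreover have "wt {z} A + wt {z} B = wt {z} (A \<union> B)" using A B by (simp add: wt_Un_right)
    moreover have "wt {z} (A \<union> B) \<le> wt {z} V" using A B finite_V by (intro wt_mono_right) auto
    ultimately have "p z + q \<le> N / 2 + 72 * D" using L'[OF z] intoA[OF z] by linarith
    moreover have "\<alpha> z + p z = a" "\<beta> z + q = b"
      using card_filter_compl[OF A(3), of "H z"] card_filter_compl[OF B(1), of "H z"]
      by (auto simp: \<alpha>_def \<beta>_def p_def q_def a_def b_def)
    ultimately show ?thesis using ab by linarith
  qed
  have \<beta>B: "\<beta> u = 0" if "u \<in> B" for u
  proof -
    have "{y\<in>B. H u y} = {}" using cliqueD[OF cB that] by blast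
    then show ?thesis by (simp only: \<beta>_def card.empty of_nat_0)
  qed
  have \<alpha>A: "\<alpha> u = 0" if "u \<in> A" for u
  proof -
    have "{y\<in>A. H u y} = {}" using cliqueD[OF A(1) that] by blast
    then show ?thesis by (simp only: \<alpha>_def card.empty of_nat_0)
  qed
  have \<alpha>_le: "\<alpha> u + \<alpha> v \<le> a" if "H u v" for u v
    unfolding \<alpha>_def a_def
    by (rule card_disjoint_filters[OF A(3)]) (use that H_triangle_free in blast)
  have \<beta>_le: "\<beta> u + \<beta> v \<le> b" if "H u v" for u v
    unfolding \<beta>_def b_def
    by (rule card_disjoint_filters[OF B(1)]) (use that H_triangle_free in blast)
  (* With H-neighbours u in A and v in B, the vertex z would have few neighbours on both sides:
     v is H-adjacent to almost all of A and shares no H-neighbour with z, and likewise for u. *)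
  have one_side: "\<alpha> z = 0 \<or> \<beta> z = 0" if z: "z \<in> V" for z
  proof (rule ccontr)
    assume "\<not> ?thesis"
    then have "{y\<in>A. H z y} \<noteq> {}" "{y\<in>B. H z y} \<noteq> {}" unfolding \<alpha>_def \<beta>_def
      by (metis card.empty of_nat_0)+
    then obtain u v where u: "u \<in> A" "H z u" and v: "v \<in> B" "H z v" by blast
    have "u \<in> V" "v \<in> V" using u v A B by auto
    then show False
      using ab_deg[OF z] ab_deg[of u] ab_deg[of v] \<alpha>_le[OF v(2)] \<beta>_le[OF u(2)]
        \<alpha>A[OF u(1)] \<beta>B[OF v(1)] a2 b2 N \<open>0 \<le> D\<close> by linarith
  qed
  have "(u \<in> {z. \<alpha> z = 0}) \<noteq> (v \<in> {z. \<alpha> z = 0})" if uv: "u \<in> V" "v \<in> V" "H u v" for u v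
  proof -
    have "\<alpha> u + \<beta> u > N / 4 + 2 * D" "\<alpha> v + \<beta> v > N / 4 + 2 * D"
      using ab_deg[OF uv(1)] ab_deg[OF uv(2)] N \<open>0 \<le> D\<close> by linarith+
    then have "\<not> (\<alpha> u = 0 \<and> \<alpha> v = 0)" "\<not> (\<beta> u = 0 \<and> \<beta> v = 0)"
      using \<alpha>_le[OF uv(3)] \<beta>_le[OF uv(3)] a2 b2 \<open>0 \<le> D\<close> by linarith+
    then show ?thesis using one_side[OF uv(1)] one_side[OF uv(2)] by auto
  qed
  then show ?thesis unfolding two_colourable_def by blast
qed

end

context triangle_cover
begin

text \<open>If all degrees were smaller, the two colour classes would be cliques of fewer than \<open>card V / 2\<close>
vertices each.\<close>

lemma exists_degree_ge_sixth:
  assumes "V \<noteq> {}"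
  shows "\<exists>x\<in>V. real (card V) / 6 \<le> wt {x} V"
proof (rule ccontr)
  assume neg: "\<not> ?thesis"
  define L where "L = Max ((\<lambda>x. wt {x} V) ` V)"
  have L: "wt {x} V \<le> L" if "x \<in> V" for x
    unfolding L_def using that finite_V by (intro Max_ge) auto
  have "L \<in> (\<lambda>x. wt {x} V) ` V"
    unfolding L_def using assms finite_V by (intro Max_in) auto
  then have L6: "6 * L < real (card V)" and L0: "0 \<le> L" using neg wt_nonneg by (auto simp: not_le)
  have "wt {x} V \<le> real (card V) / 6 + 0" if "x \<in> V" for x
    using L[OF that] L6 by linarith
  then have "two_colourable V H"
    by (rule two_colourable_if_degrees_small) simp_all
  then obtain P where P: "\<forall>x\<in>V. \<forall>y\<in>V. H x y \<longrightarrow> (x \<in> P) \<noteq> (y \<in> P)"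
    unfolding two_colourable_def ..
  have "clique {x\<in>V. x \<in> P}" "clique {x\<in>V. x \<notin> P}"
    using P by (auto simp: clique_def)
  then have "real (card {x\<in>V. x \<in> P}) \<le> 3 * L" "real (card {x\<in>V. x \<notin> P}) \<le> 3 * L"
    using clique_card_le L L0 by blast+
  then show False using card_filter_compl[OF finite_V, of "\<lambda>x. x \<in> P"] L6 by linarith
qed

lemma wt_remove_left:
  assumes "finite A" "x \<in> A"
  shows "wt A B = wt {x} B + wt (A - {x}) B"
  using sum.remove[OF assms, of "\<lambda>u. \<Sum>y\<in>B. g u y"] by (simp add: wt_def)

lemma weight_remove_vertex:
  assumes "x \<in> V"
  shows "wt V V = wt (V - {x}) (V - {x}) + 2 * wt {x} V - g x x"
proof -
  have "wt V V = wt {x} V + wt (V - {x}) V" using finite_V assms by (rule wt_remove_left)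
  also have "wt (V - {x}) V = wt V (V - {x})" by (rule wt_sym)
  also have "\<dots> = wt {x} (V - {x}) + wt (V - {x}) (V - {x})"
    using finite_V assms by (rule wt_remove_left)
  also have "wt {x} (V - {x}) = wt {x} V - g x x"
    using finite_V assms by (simp add: wt_def sum.remove[of V x])
  finally show ?thesis by simp
qed

end

text \<open>A vertex of large degree is deleted in each step. Each deletion destroys at most one of the disjoint
pieces in \<open>\<B>\<close>, so \<open>H\<close> stays non-bipartite for \<open>r\<close> steps, and each of these steps gains an extra
\<open>2 * card V / 1000\<close>, which is at least \<open>(r\<^sup>2 - (r - 1)\<^sup>2) / 1000\<close>. The loss \<open>card V\<close> comes from the
diagonal.\<close>

theorem cover_weight_lower_bound:
  assumes "triangle_cover H V g" and "\<And>x. x \<in> V \<Longrightarrow> g x x \<le> 1"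
    and "finite \<B>" "\<Union>\<B> \<subseteq> V" "pairwise (\<lambda>A B. A \<inter> B = {}) \<B>"
    and "\<And>B. B \<in> \<B> \<Longrightarrow> \<not> two_colourable B H"
    and "r \<le> card \<B>" "r \<le> card V"
  shows "(real (card V))\<^sup>2 / 6 - real (card V) + (real r)\<^sup>2 / 1000 \<le> (\<Sum>x\<in>V. \<Sum>y\<in>V. g x y)"
  using assms
proof (induction "card V" arbitrary: V \<B> r)
  case 0
  interpret triangle_cover H V g by fact
  have "V = {}" using 0 finite_V by simp
  then show ?case using 0 by simp
next
  case (Suc n)
  interpret triangle_cover H V g by fact
  define N where "N = real (card V)"
  have Vne: "V \<noteq> {}" using Suc.hyps(2) by auto
  have "\<exists>x\<in>V. N / 6 + (if r = 0 then 0 else N / 1000) \<le> wt {x} V"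
  proof (cases "r = 0")
    case True
    then show ?thesis using exists_degree_ge_sixth[OF Vne] by (simp add: N_def)
  next
    case False
    then obtain B where "B \<in> \<B>" using Suc.prems(7) by fastforce
    then have "\<not> two_colourable V H"
      using Suc.prems(4,6) two_colourable_subset[of V H B] by blast
    then have "\<exists>x\<in>V. \<not> wt {x} V \<le> N / 6 + N / 1000"
      using two_colourable_if_degrees_small[of "N / 1000"] by (fastforce simp: N_def)
    then show ?thesis using False by force
  qed
  then obtain x where x: "x \<in> V" and dx: "N / 6 + (if r = 0 then 0 else N / 1000) \<le> wt {x} V"
    by blast
  define \<B>' where "\<B>' = {B\<in>\<B>. x \<notin> B}"
  have cardV: "card (V - {x}) = n" using Suc.hyps(2) x finite_V by simp
  have Nn: "N = real n + 1" using Suc.hyps(2) by (simp add: N_def)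
  have "\<B> - \<B>' \<subseteq> {B\<in>\<B>. x \<in> B}" by (auto simp: \<B>'_def)
  moreover have "card {B\<in>\<B>. x \<in> B} \<le> 1"
    unfolding card_le_Suc0_iff_eq[OF finite_subset[OF _ Suc.prems(3)], of "{B\<in>\<B>. x \<in> B}", simplified]
      One_nat_def
    using Suc.prems(5) by (auto simp: pairwise_def)
  ultimately have "card (\<B> - \<B>') \<le> 1"
    using card_mono[of "{B\<in>\<B>. x \<in> B}" "\<B> - \<B>'"] Suc.prems(3) by fastforce
  moreover have "card \<B> = card \<B>' + card (\<B> - \<B>')"
    using Suc.prems(3) by (subst card_Diff_subset) (auto simp: \<B>'_def card_mono)
  ultimately have r': "r - 1 \<le> card \<B>'" using Suc.prems(7) by linarith
  have "(real (card (V - {x})))\<^sup>2 / 6 - real (card (V - {x})) + (real (r - 1))\<^sup>2 / 1000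
          \<le> (\<Sum>u\<in>V - {x}. \<Sum>y\<in>V - {x}. g u y)"
  proof (rule Suc.hyps(1)[of "V - {x}" \<B>' "r - 1"])
    show "triangle_cover H (V - {x}) g"
      by unfold_locales (use finite_V g_sym g_nonneg g_H g_cover in auto)
    show "pairwise (\<lambda>A B. A \<inter> B = {}) \<B>'"
      using Suc.prems(5) by (rule pairwise_subset) (auto simp: \<B>'_def)
  qed (use Suc.prems r' cardV Suc.hyps(2) in \<open>auto simp: \<B>'_def\<close>)
  then have IH: "(N - 1)\<^sup>2 / 6 - (N - 1) + (real (r - 1))\<^sup>2 / 1000 \<le> wt (V - {x}) (V - {x})"
    by (simp add: wt_def cardV Nn)
  have SV: "wt (V - {x}) (V - {x}) + 2 * wt {x} V - 1 \<le> wt V V"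
    using weight_remove_vertex[OF x] Suc.prems(2)[OF x] by simp
  have sq: "(N - 1)\<^sup>2 = N\<^sup>2 - 2 * N + 1" by (simp add: power2_eq_square algebra_simps)
  have "N\<^sup>2 / 6 - N + (real r)\<^sup>2 / 1000 \<le> wt V V"
  proof (cases "r = 0")
    case True
    then show ?thesis using IH SV dx unfolding sq by (simp add: field_simps)
  next
    case False
    then have rr: "real (r - 1) = real r - 1" by (simp add: of_nat_diff)
    have "(real r - 1)\<^sup>2 = (real r)\<^sup>2 - 2 * real r + 1"
      by (simp add: power2_eq_square algebra_simps)
    moreover have "real r \<le> N" using Suc.prems(8) by (simp add: N_def)
    ultimately show ?thesis using IH SV dx False unfolding sq rr by (simp add: field_simps)
  qed
  then show ?case by (simp add: wt_def N_def)
qed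

section \<open>Approximate duality of fractional packings and covers\<close>

text \<open>The multiplicative weights method. Start with no set chosen, and repeatedly add one more copy of the
set that is lightest for the weights \<open>(1 + \<eta>) ^ load\<close>. As the normalised weights form a cover, the
lightest set carries at most the fraction \<open>1 / \<tau>\<close> of the total weight, so that the total weight, and with it every
load, grows slowly. Dividing the multiplicities by the bound \<open>\<Lambda>\<close> for the loads gives the packing. The
loss \<open>\<tau> - \<sigma>\<close> is harmless later, and accepting it avoids any compactness or elimination argument.\<close>

lemma approximate_packing_cover_duality:
  fixes \<T> :: "'b set set"
  assumes X: "finite X" and \<T>: "finite \<T>" "\<And>T. T \<in> \<T> \<Longrightarrow> T \<subseteq> X" "{} \<notin> \<T>"
    and cover: "\<And>g. (\<And>x. 0 \<le> g x) \<Longrightarrow> (\<And>T. T \<in> \<T> \<Longrightarrow> 1 \<le> (\<Sum>x\<in>T. g x)) \<Longrightarrow> \<tau> \<le> (\<Sum>x\<in>X. g x)"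
    and \<sigma>: "\<sigma> < (\<tau>::real)"
  shows "\<exists>w. (\<forall>T. 0 \<le> w T) \<and> (\<forall>x\<in>X. (\<Sum>T\<in>{T\<in>\<T>. x \<in> T}. w T) \<le> 1) \<and> \<sigma> \<le> (\<Sum>T\<in>\<T>. w T)"
proof (cases "\<sigma> \<le> 0")
  case True
  then show ?thesis by (intro exI[of _ "\<lambda>_. 0"]) auto
next
  case False
  then have \<tau>0: "0 < \<tau>" using \<sigma> by simp
  have "\<T> \<noteq> {}" using cover[of "\<lambda>_. 0"] \<tau>0 by auto
  then have "X \<noteq> {}" using \<T>(2,3) by fastforce
  then have cX: "1 \<le> real (card X)" using X by (simp add: Suc_leI card_gt_0_iff)
  (* Small enough for ln (1 + \<eta>) to exceed \<eta> * \<sigma> / \<tau>. *)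
  define \<eta> where "\<eta> = (1 - \<sigma> / \<tau>) / 2"
  have "0 < \<sigma> / \<tau>" "\<sigma> / \<tau> < 1" using False \<tau>0 \<sigma> by auto
  then have \<eta>: "0 < \<eta>" "\<eta> \<le> 1" "\<sigma> / \<tau> = 1 - 2 * \<eta>" by (auto simp: \<eta>_def diff_divide_distrib)
  define load where "load c x = (\<Sum>T\<in>{T\<in>\<T>. x \<in> T}. c T)" for c :: "'b set \<Rightarrow> nat" and x
  have "\<exists>c. (\<Sum>T\<in>\<T>. c T) = k \<and> (\<Sum>x\<in>X. (1 + \<eta>) ^ load c x) \<le> real (card X) * (1 + \<eta> / \<tau>) ^ k" for k
  proof (induction k)
    case 0
    show ?case by (intro exI[of _ "\<lambda>_. 0"]) (simp add: load_def)
  next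
    case (Suc k)
    then obtain c where c: "(\<Sum>T\<in>\<T>. c T) = k"
      and D: "(\<Sum>x\<in>X. (1 + \<eta>) ^ load c x) \<le> real (card X) * (1 + \<eta> / \<tau>) ^ k" by blast
    define g where "g x = (1 + \<eta>) ^ load c x" for x
    define m where "m = Min ((\<lambda>T. \<Sum>x\<in>T. g x) ` \<T>)"
    have gpos: "0 < g x" for x using \<eta> by (simp add: g_def)
    have "m \<in> (\<lambda>T. \<Sum>x\<in>T. g x) ` \<T>"
      unfolding m_def using \<T> \<open>\<T> \<noteq> {}\<close> by (intro Min_in) auto
    then obtain T where T: "T \<in> \<T>" "m = (\<Sum>x\<in>T. g x)" by auto
    have finT: "finite T" "T \<subseteq> X" "T \<noteq> {}" using T \<T> X finite_subset by blast+
    have mpos: "0 < m" unfolding T(2) using finT gpos by (intro sum_pos) auto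
    have "\<tau> \<le> (\<Sum>x\<in>X. g x / m)"
    proof (rule cover)
      fix U assume "U \<in> \<T>"
      then have "m \<le> (\<Sum>x\<in>U. g x)" unfolding m_def using \<T> by (intro Min_le) auto
      then show "1 \<le> (\<Sum>x\<in>U. g x / m)" using mpos by (simp add: sum_divide_distrib[symmetric])
    qed (use gpos mpos in \<open>auto intro: less_imp_le\<close>)
    then have m: "m \<le> (\<Sum>x\<in>X. g x) / \<tau>"
      using mpos \<tau>0 by (simp add: sum_divide_distrib[symmetric] field_simps)
    define c' where "c' = c(T := Suc (c T))"
    have l: "load c' x = (if x \<in> T then Suc (load c x) else load c x)" for x
    proof (cases "x \<in> T")
      case True
      then have "load c' x = Suc (c T) + (\<Sum>U\<in>{U\<in>\<T>. x \<in> U} - {T}. c' U)"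
        unfolding load_def using T \<T> by (subst sum.remove[of _ T]) (auto simp: c'_def)
      also have "(\<Sum>U\<in>{U\<in>\<T>. x \<in> U} - {T}. c' U) = (\<Sum>U\<in>{U\<in>\<T>. x \<in> U} - {T}. c U)"
        by (rule sum.cong) (auto simp: c'_def)
      also have "Suc (c T) + \<dots> = Suc (load c x)"
        unfolding load_def using T \<T> True by (subst (2) sum.remove[of _ T]) auto
      finally show ?thesis using True by simp
    next
      case False
      then show ?thesis unfolding load_def by (auto simp: c'_def intro!: sum.cong)
    qed
    have "(\<Sum>x\<in>X. (1 + \<eta>) ^ load c' x) = (\<Sum>x\<in>X. g x + (if x \<in> T then \<eta> * g x else 0))"
      by (intro sum.cong) (auto simp: l g_def algebra_simps)
    also have "\<dots> = (\<Sum>x\<in>X. g x) + \<eta> * m"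
      using finT X unfolding T(2)
      by (simp add: sum.distrib sum.inter_restrict[symmetric] Int_absorb1 sum_distrib_left)
    also have "\<dots> \<le> (\<Sum>x\<in>X. g x) + \<eta> * ((\<Sum>x\<in>X. g x) / \<tau>)"
      using m \<eta> by (intro add_left_mono mult_left_mono) auto
    also have "\<dots> = (\<Sum>x\<in>X. g x) * (1 + \<eta> / \<tau>)" by (simp add: algebra_simps)
    also have "\<dots> \<le> real (card X) * (1 + \<eta> / \<tau>) ^ k * (1 + \<eta> / \<tau>)"
      using D \<eta> \<tau>0 unfolding g_def by (intro mult_right_mono) auto
    finally have "(\<Sum>x\<in>X. (1 + \<eta>) ^ load c' x) \<le> real (card X) * (1 + \<eta> / \<tau>) ^ Suc k"
      by (simp add: mult_ac)
    moreover have "(\<Sum>T\<in>\<T>. c' T) = Suc k"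
    proof -
      have "(\<Sum>U\<in>\<T>. c' U) = Suc (c T) + (\<Sum>U\<in>\<T> - {T}. c U)"
        using T \<T> by (subst sum.remove[of _ T]) (auto simp: c'_def intro!: sum.cong)
      also have "\<dots> = Suc (\<Sum>U\<in>\<T>. c U)" using T \<T> by (subst (2) sum.remove[of _ T]) auto
      finally show ?thesis using c by simp
    qed
    ultimately show ?case by blast
  qed
  note run = this
  have gap: "0 < ln (1 + \<eta>) - \<sigma> * \<eta> / \<tau>"
  proof -
    have "\<eta> - \<eta>\<^sup>2 \<le> ln (1 + \<eta>)" using \<eta> by (intro ln_one_plus_pos_lower_bound) auto
    moreover have "\<sigma> * \<eta> / \<tau> = (1 - 2 * \<eta>) * \<eta>" using \<eta>(3) by (metis mult.commute times_divide_eq_right)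
    moreover have "0 < \<eta> * \<eta>" using \<eta> by simp
    ultimately show ?thesis by (simp add: power2_eq_square algebra_simps)
  qed
  obtain k0 where k0: "\<sigma> * ln (real (card X)) < real k0 * (ln (1 + \<eta>) - \<sigma> * \<eta> / \<tau>)"
    using reals_Archimedean3[OF gap] by blast
  define k where "k = Suc k0"
  have k: "\<sigma> * ln (real (card X)) \<le> real k * (ln (1 + \<eta>) - \<sigma> * \<eta> / \<tau>)"
  proof -
    have "real k0 * (ln (1 + \<eta>) - \<sigma> * \<eta> / \<tau>) \<le> real k * (ln (1 + \<eta>) - \<sigma> * \<eta> / \<tau>)"
      using gap by (intro mult_right_mono) (auto simp: k_def)
    then show ?thesis using k0 by linarith
  qed
  obtain c where c: "(\<Sum>T\<in>\<T>. c T) = k"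
    and D: "(\<Sum>x\<in>X. (1 + \<eta>) ^ load c x) \<le> real (card X) * (1 + \<eta> / \<tau>) ^ k"
    using run by blast
  define \<Lambda> where "\<Lambda> = (ln (real (card X)) + real k * (\<eta> / \<tau>)) / ln (1 + \<eta>)"
  have lnpos: "0 < ln (1 + \<eta>)" using \<eta> by simp
  have kpos: "0 < real k * (\<eta> / \<tau>)" using \<eta> \<tau>0 by (simp add: k_def)
  have \<Lambda>: "0 < \<Lambda>" unfolding \<Lambda>_def using lnpos kpos cX by (intro divide_pos_pos add_nonneg_pos) auto
  have load_le: "real (load c x) \<le> \<Lambda>" if "x \<in> X" for x
  proof -
    have "(1 + \<eta>) ^ load c x \<le> (\<Sum>x\<in>X. (1 + \<eta>) ^ load c x)"
      using that X \<eta> by (intro member_le_sum) auto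
    also note D
    also have "real (card X) * (1 + \<eta> / \<tau>) ^ k \<le> real (card X) * exp (\<eta> / \<tau>) ^ k"
      using exp_ge_add_one_self[of "\<eta> / \<tau>"] \<eta> \<tau>0
      by (intro mult_left_mono power_mono) auto
    finally have "ln ((1 + \<eta>) ^ load c x) \<le> ln (real (card X) * exp (\<eta> / \<tau>) ^ k)"
      using \<eta> cX by (subst ln_le_cancel_iff) auto
    also have "\<dots> = ln (real (card X)) + real k * (\<eta> / \<tau>)"
      using cX by (simp add: ln_mult ln_realpow)
    finally have "real (load c x) * ln (1 + \<eta>) \<le> ln (real (card X)) + real k * (\<eta> / \<tau>)"
      using \<eta> by (simp add: ln_realpow)
    then show ?thesis unfolding \<Lambda>_def using lnpos by (simp add: field_simps)
  qed
  show ?thesis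
  proof (intro exI[of _ "\<lambda>T. real (c T) / \<Lambda>"] conjI allI ballI)
    fix x assume "x \<in> X"
    then show "(\<Sum>T\<in>{T\<in>\<T>. x \<in> T}. real (c T) / \<Lambda>) \<le> 1"
      using load_le[of x] \<Lambda> by (simp add: load_def sum_divide_distrib[symmetric])
  next
    have "\<sigma> * \<Lambda> \<le> real k"
      unfolding \<Lambda>_def using k lnpos by (simp add: field_simps)
    then have "\<sigma> \<le> real k / \<Lambda>" using \<Lambda> by (simp add: field_simps)
    also have "real k = (\<Sum>T\<in>\<T>. real (c T))" using c by (metis of_nat_sum)
    finally show "\<sigma> \<le> (\<Sum>T\<in>\<T>. real (c T) / \<Lambda>)" by (simp add: sum_divide_distrib)
  qed (use \<Lambda> in auto)
qed

section \<open>Random lists of vertices and a test for bipartiteness\<close>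

text \<open>The sum of \<open>F\<close> over all lists of length \<open>m\<close> with entries in \<open>V\<close>, that is, \<open>card V ^ m\<close> times the mean of
\<open>F\<close> for independent uniform entries. With the recursion over the list, independence of an initial part from
the rest is the equation \<open>sample_sum_append\<close>.\<close>

primrec sample_sum :: "'a set \<Rightarrow> nat \<Rightarrow> ('a list \<Rightarrow> real) \<Rightarrow> real" where
  "sample_sum V 0 F = F []"
| "sample_sum V (Suc m) F = (\<Sum>x\<in>V. sample_sum V m (\<lambda>xs. F (x # xs)))"

lemma sample_sum_mono:
  assumes "\<And>xs. set xs \<subseteq> V \<Longrightarrow> length xs = m \<Longrightarrow> F xs \<le> G xs"
  shows "sample_sum V m F \<le> sample_sum V m G"
  using assms
proof (induction m arbitrary: F G)
  case (Suc m)
  show ?case unfolding sample_sum.simps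
    by (intro sum_mono Suc.IH Suc.prems) auto
qed simp

lemma sample_sum_cong:
  assumes "\<And>xs. set xs \<subseteq> V \<Longrightarrow> length xs = m \<Longrightarrow> F xs = G xs"
  shows "sample_sum V m F = sample_sum V m G"
  using assms by (intro antisym sample_sum_mono) auto

lemma sample_sum_const: "sample_sum V m (\<lambda>_. c) = c * real (card V) ^ m"
  by (induction m) (auto simp: mult_ac)

lemma sample_sum_add: "sample_sum V m (\<lambda>xs. F xs + G xs) = sample_sum V m F + sample_sum V m G"
  by (induction m arbitrary: F G) (auto simp: sum.distrib)

lemma sample_sum_mult: "sample_sum V m (\<lambda>xs. c * F xs) = c * sample_sum V m F"
  by (induction m arbitrary: F) (auto simp: sum_distrib_left)

lemma sample_sum_sum: "sample_sum V m (\<lambda>xs. \<Sum>i\<in>I. F i xs) = (\<Sum>i\<in>I. sample_sum V m (F i))"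
proof (induction m arbitrary: F)
  case (Suc m)
  show ?case unfolding sample_sum.simps Suc.IH by (rule sum.swap)
qed simp

lemma sample_sum_nonneg: "(\<And>xs. 0 \<le> F xs) \<Longrightarrow> 0 \<le> sample_sum V m F"
  using sample_sum_mono[of V m "\<lambda>_. 0" F] by (simp add: sample_sum_const)

lemma sample_sum_append:
  "sample_sum V (a + b) F = sample_sum V a (\<lambda>xs. sample_sum V b (\<lambda>ys. F (xs @ ys)))"
  by (induction a arbitrary: F) auto

text \<open>In this and the following lemmas both sides carry a power of \<open>card V\<close>, so that exponents such as \<open>m - 2\<close> do not occur.
The bounds are union bounds over the positions in the list, obtained by induction on its length.\<close>

lemma sample_hits_one:
  assumes V: "finite V"
  shows "real (card V) * sample_sum V m (\<lambda>xs. of_bool (x \<in> set xs)) \<le> real m * real (card V) ^ m"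
proof (induction m)
  case (Suc m)
  define n where "n = real (card V)"
  define A where "A = sample_sum V m (\<lambda>xs. of_bool (x \<in> set xs))"
  have "sample_sum V (Suc m) (\<lambda>xs. of_bool (x \<in> set xs))
      \<le> (\<Sum>v\<in>V. sample_sum V m (\<lambda>xs. of_bool (v = x) + of_bool (x \<in> set xs)))"
    unfolding sample_sum.simps by (intro sum_mono sample_sum_mono) auto
  also have "\<dots> = (\<Sum>v\<in>V. of_bool (v = x)) * n ^ m + n * A"
    by (simp add: sample_sum_add sample_sum_const sum.distrib A_def n_def sum_distrib_right)
  also have "(\<Sum>v\<in>V. of_bool (v = x)) \<le> (1::real)"
    using V by (simp add: of_bool_def)
  finally have "sample_sum V (Suc m) (\<lambda>xs. of_bool (x \<in> set xs)) \<le> 1 * n ^ m + n * A"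
    by (simp add: n_def mult_right_mono)
  then have "n * sample_sum V (Suc m) (\<lambda>xs. of_bool (x \<in> set xs)) \<le> n * (n ^ m + n * A)"
    by (intro mult_left_mono) (auto simp: n_def)
  also have "\<dots> \<le> n * n ^ m + n * (real m * n ^ m)"
    using Suc.IH by (simp add: n_def A_def distrib_left mult_left_mono)
  finally show ?case by (simp add: n_def algebra_simps)
qed simp

lemma sample_hits_two:
  assumes V: "finite V" and "x \<noteq> y"
  shows "real (card V) ^ 2 * sample_sum V m (\<lambda>xs. of_bool (x \<in> set xs \<and> y \<in> set xs))
          \<le> real m ^ 2 * real (card V) ^ m"
proof (induction m)
  case (Suc m)
  define n where "n = real (card V)"
  define A where "A u = sample_sum V m (\<lambda>xs. of_bool (u \<in> set xs))" for u
  define B where "B = sample_sum V m (\<lambda>xs. of_bool (x \<in> set xs \<and> y \<in> set xs))"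
  have A: "0 \<le> A u" "n * A u \<le> real m * n ^ m" for u
    using sample_hits_one[OF V, of m u] by (auto simp: A_def n_def intro: sample_sum_nonneg)
  have B0: "0 \<le> B" by (auto simp: B_def intro: sample_sum_nonneg)
  have ind: "(\<Sum>v\<in>V. of_bool (v = u)) \<le> (1::real)" for u
    using V by (simp add: of_bool_def)
  have "sample_sum V (Suc m) (\<lambda>xs. of_bool (x \<in> set xs \<and> y \<in> set xs))
      \<le> (\<Sum>v\<in>V. sample_sum V m (\<lambda>xs. of_bool (v = x) * of_bool (y \<in> set xs)
            + (of_bool (v = y) * of_bool (x \<in> set xs) + of_bool (x \<in> set xs \<and> y \<in> set xs))))"
    unfolding sample_sum.simps using \<open>x \<noteq> y\<close> by (intro sum_mono sample_sum_mono) auto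
  also have "\<dots> = (\<Sum>v\<in>V. of_bool (v = x)) * A y + ((\<Sum>v\<in>V. of_bool (v = y)) * A x + n * B)"
    by (simp only: sample_sum_add sample_sum_mult sum.distrib A_def[symmetric] B_def[symmetric]
        sum_distrib_right) (simp add: n_def)
  also have "\<dots> \<le> 1 * A y + (1 * A x + n * B)"
    using A B0 ind by (intro add_mono mult_right_mono) auto
  finally have "n ^ 2 * sample_sum V (Suc m) (\<lambda>xs. of_bool (x \<in> set xs \<and> y \<in> set xs))
      \<le> n ^ 2 * (A y + (A x + n * B))"
    by (intro mult_left_mono) auto
  also have "\<dots> = n * (n * A y) + (n * (n * A x) + n * (n ^ 2 * B))"
    by (simp add: algebra_simps power2_eq_square)
  also have "\<dots> \<le> n * (real m * n ^ m) + (n * (real m * n ^ m) + n * (real m ^ 2 * n ^ m))"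
    using A Suc.IH by (intro add_mono mult_left_mono) (auto simp: B_def n_def)
  also have "\<dots> = (real m ^ 2 + 2 * real m) * n ^ Suc m" by (simp add: algebra_simps)
  also have "\<dots> \<le> real (Suc m) ^ 2 * n ^ Suc m"
    by (intro mult_right_mono) (auto simp: n_def power2_eq_square algebra_simps)
  finally show ?case by (simp add: n_def)
qed simp

lemma sample_hits_three:
  assumes V: "finite V" and ne: "x \<noteq> y" "y \<noteq> z" "x \<noteq> z"
  shows "real (card V) ^ 3 * sample_sum V m (\<lambda>xs. of_bool (x \<in> set xs \<and> y \<in> set xs \<and> z \<in> set xs))
          \<le> real m ^ 3 * real (card V) ^ m"
proof (induction m)
  case (Suc m)
  define n where "n = real (card V)"
  define A where "A u v = sample_sum V m (\<lambda>xs. of_bool (u \<in> set xs \<and> v \<in> set xs))" for u v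
  define B where "B = sample_sum V m (\<lambda>xs. of_bool (x \<in> set xs \<and> y \<in> set xs \<and> z \<in> set xs))"
  have A0: "0 \<le> A u v" for u v by (auto simp: A_def intro: sample_sum_nonneg)
  have A: "n ^ 2 * A u v \<le> real m ^ 2 * n ^ m" if "u \<noteq> v" for u v
    using sample_hits_two[OF V that, of m] by (auto simp: A_def n_def)
  have B0: "0 \<le> B" by (auto simp: B_def intro: sample_sum_nonneg)
  have ind: "(\<Sum>v\<in>V. of_bool (v = u)) \<le> (1::real)" for u
    using V by (simp add: of_bool_def)
  have "sample_sum V (Suc m) (\<lambda>xs. of_bool (x \<in> set xs \<and> y \<in> set xs \<and> z \<in> set xs))
      \<le> (\<Sum>v\<in>V. sample_sum V m (\<lambda>xs. of_bool (v = x) * of_bool (y \<in> set xs \<and> z \<in> set xs)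
            + (of_bool (v = y) * of_bool (x \<in> set xs \<and> z \<in> set xs)
            + (of_bool (v = z) * of_bool (x \<in> set xs \<and> y \<in> set xs)
            + of_bool (x \<in> set xs \<and> y \<in> set xs \<and> z \<in> set xs)))))"
    unfolding sample_sum.simps using ne by (intro sum_mono sample_sum_mono) auto
  also have "\<dots> = (\<Sum>v\<in>V. of_bool (v = x)) * A y z + ((\<Sum>v\<in>V. of_bool (v = y)) * A x z
        + ((\<Sum>v\<in>V. of_bool (v = z)) * A x y + n * B))"
    by (simp only: sample_sum_add sample_sum_mult sum.distrib A_def[symmetric] B_def[symmetric]
        sum_distrib_right) (simp add: n_def)
  also have "\<dots> \<le> 1 * A y z + (1 * A x z + (1 * A x y + n * B))"
    using A0 B0 ind by (intro add_mono mult_right_mono) auto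
  finally have "n ^ 3 * sample_sum V (Suc m) (\<lambda>xs. of_bool (x \<in> set xs \<and> y \<in> set xs \<and> z \<in> set xs))
      \<le> n ^ 3 * (A y z + (A x z + (A x y + n * B)))"
    by (intro mult_left_mono) (auto simp: n_def)
  also have "\<dots> = n * (n ^ 2 * A y z) + (n * (n ^ 2 * A x z) + (n * (n ^ 2 * A x y) + n * (n ^ 3 * B)))"
    by (simp add: algebra_simps power2_eq_square power3_eq_cube)
  also have "\<dots> \<le> n * (real m ^ 2 * n ^ m) + (n * (real m ^ 2 * n ^ m)
      + (n * (real m ^ 2 * n ^ m) + n * (real m ^ 3 * n ^ m)))"
    using A ne Suc.IH by (intro add_mono mult_left_mono) (auto simp: B_def n_def)
  also have "\<dots> = (real m ^ 3 + 3 * real m ^ 2) * n ^ Suc m" by (simp add: algebra_simps)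
  also have "\<dots> \<le> real (Suc m) ^ 3 * n ^ Suc m"
    by (intro mult_right_mono) (auto simp: n_def power2_eq_square power3_eq_cube algebra_simps)
  finally show ?case by (simp add: n_def)
qed simp

lemma sample_not_distinct:
  assumes V: "finite V"
  shows "real (card V) * sample_sum V m (\<lambda>xs. of_bool (\<not> distinct xs)) \<le> real m ^ 2 * real (card V) ^ m"
proof (induction m)
  case (Suc m)
  define n where "n = real (card V)"
  define B where "B = sample_sum V m (\<lambda>xs. of_bool (\<not> distinct xs))"
  have "sample_sum V (Suc m) (\<lambda>xs. of_bool (\<not> distinct xs))
      \<le> (\<Sum>v\<in>V. sample_sum V m (\<lambda>xs. of_bool (v \<in> set xs) + of_bool (\<not> distinct xs)))"
    unfolding sample_sum.simps by (intro sum_mono sample_sum_mono) auto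
  also have "\<dots> = sample_sum V m (\<lambda>xs. \<Sum>v\<in>V. of_bool (v \<in> set xs)) + n * B"
    by (simp add: sample_sum_add sample_sum_sum sum.distrib n_def B_def)
  also have "sample_sum V m (\<lambda>xs. \<Sum>v\<in>V. of_bool (v \<in> set xs)) \<le> sample_sum V m (\<lambda>xs. real m)"
  proof (rule sample_sum_mono)
    fix xs assume xs: "set xs \<subseteq> V" "length xs = m"
    have "(\<Sum>v\<in>V. of_bool (v \<in> set xs)) = real (card (set xs))"
      using V xs by (simp add: of_bool_def sum.inter_filter[symmetric] Int_absorb1 flip: Int_def)
    then show "(\<Sum>v\<in>V. of_bool (v \<in> set xs)) \<le> real m" using xs card_length[of xs] by simp
  qed
  finally have "n * sample_sum V (Suc m) (\<lambda>xs. of_bool (\<not> distinct xs)) \<le> n * (real m * n ^ m + n * B)"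
    by (intro mult_left_mono) (auto simp: n_def sample_sum_const)
  also have "\<dots> = n * (real m * n ^ m) + n * (n * B)" by (simp add: algebra_simps)
  also have "\<dots> \<le> n * (real m * n ^ m) + n * (real m ^ 2 * n ^ m)"
    using Suc.IH by (intro add_left_mono mult_left_mono) (auto simp: n_def B_def)
  also have "\<dots> = (real m ^ 2 + real m) * n ^ Suc m" by (simp add: algebra_simps)
  also have "\<dots> \<le> real (Suc m) ^ 2 * n ^ Suc m"
    by (intro mult_right_mono) (auto simp: n_def power2_eq_square algebra_simps)
  finally show ?case by (simp add: n_def)
qed simp

lemma sample_all_in:
  assumes "finite V"
  shows "sample_sum V m (\<lambda>xs. of_bool (\<forall>u\<in>set xs. P u)) = real (card {u\<in>V. P u}) ^ m"
proof (induction m)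
  case (Suc m)
  have "sample_sum V (Suc m) (\<lambda>xs. of_bool (\<forall>u\<in>set xs. P u))
      = (\<Sum>v\<in>V. sample_sum V m (\<lambda>xs. of_bool (P v) * of_bool (\<forall>u\<in>set xs. P u)))"
    unfolding sample_sum.simps by (intro sum.cong refl sample_sum_cong) auto
  also have "\<dots> = (\<Sum>v\<in>V. of_bool (P v)) * real (card {u\<in>V. P u}) ^ m"
    by (simp only: sample_sum_mult Suc.IH sum_distrib_right)
  also have "(\<Sum>v\<in>V. of_bool (P v)) = real (card {u\<in>V. P u})"
    using assms by (simp add: of_bool_def sum.inter_filter[symmetric])
  finally show ?case by simp
qed simp

text \<open>Entries are read in consecutive pairs, so that a list of length \<open>2 * k\<close> stands for \<open>k\<close> independent pairs.\<close>

fun avoids :: "('a \<times> 'a) set \<Rightarrow> 'a list \<Rightarrow> bool" where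
  "avoids B (x # y # xs) \<longleftrightarrow> (x, y) \<notin> B \<and> avoids B xs"
| "avoids B xs \<longleftrightarrow> True"

lemma avoidsI: "(\<And>x y. x \<in> set xs \<Longrightarrow> y \<in> set xs \<Longrightarrow> (x, y) \<notin> B) \<Longrightarrow> avoids B xs"
  by (induction B xs rule: avoids.induct) auto

lemma sample_avoids:
  assumes V: "finite V" and B: "B \<subseteq> V \<times> V"
  shows "sample_sum V (2 * k) (\<lambda>xs. of_bool (avoids B xs)) = ((real (card V))\<^sup>2 - real (card B)) ^ k"
proof (induction k)
  case (Suc k)
  have "sample_sum V (2 * Suc k) (\<lambda>xs. of_bool (avoids B xs))
      = (\<Sum>x\<in>V. \<Sum>y\<in>V. sample_sum V (2 * k) (\<lambda>xs. of_bool ((x, y) \<notin> B) * of_bool (avoids B xs)))"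
    by (simp add: of_bool_conj)
  also have "\<dots> = (\<Sum>x\<in>V. \<Sum>y\<in>V. of_bool ((x, y) \<notin> B)) * ((real (card V))\<^sup>2 - real (card B)) ^ k"
    by (simp only: sample_sum_mult Suc.IH sum_distrib_right)
  also have "(\<Sum>x\<in>V. \<Sum>y\<in>V. of_bool ((x, y) \<notin> B)) = (\<Sum>q\<in>V \<times> V. of_bool (q \<notin> B) :: real)"
    by (simp add: sum.cartesian_product case_prod_beta)
  also have "\<dots> = real (card {q\<in>V \<times> V. q \<notin> B})"
    using V by (simp add: of_bool_def sum.inter_filter[symmetric])
  also have "{q\<in>V \<times> V. q \<notin> B} = V \<times> V - B" by auto
  also have "real (card (V \<times> V - B)) = (real (card V))\<^sup>2 - real (card B)"
    using V B finite_subset[OF B] card_mono[OF _ B]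
    by (simp add: card_Diff_subset of_nat_diff card_cartesian_product power2_eq_square)
  finally show ?case by simp
qed simp

definition mono_pairs :: "'a set \<Rightarrow> ('a \<Rightarrow> 'a \<Rightarrow> bool) \<Rightarrow> 'a set \<Rightarrow> ('a \<times> 'a) set" where
  "mono_pairs V H P = {q\<in>V \<times> V. H (fst q) (snd q) \<and> (fst q \<in> P \<longleftrightarrow> snd q \<in> P)}"

definition unseen :: "('a \<Rightarrow> 'a \<Rightarrow> bool) \<Rightarrow> 'a list \<Rightarrow> 'a \<Rightarrow> bool" where
  "unseen H us x \<longleftrightarrow> (\<forall>u\<in>set us. \<not> H x u)"

text \<open>If \<open>C\<close> is one colour class within \<open>us\<close>, the first \<open>H\<close>-neighbour of \<open>x\<close> in \<open>us\<close> dictates the colour of \<open>x\<close>;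
\<open>forced_side H us C\<close> is the set of vertices that are forced out of that class. For vertices without
a neighbour in \<open>us\<close> the value is meaningless, and \<open>forced_bad\<close> leaves them out.\<close>

definition forced_side :: "('a \<Rightarrow> 'a \<Rightarrow> bool) \<Rightarrow> 'a list \<Rightarrow> 'a set \<Rightarrow> 'a set" where
  "forced_side H us C = {x. hd (filter (H x) us) \<in> C}"

definition forced_bad :: "'a set \<Rightarrow> ('a \<Rightarrow> 'a \<Rightarrow> bool) \<Rightarrow> 'a list \<Rightarrow> 'a set \<Rightarrow> ('a \<times> 'a) set" where
  "forced_bad V H us C = {q\<in>mono_pairs V H (forced_side H us C). \<not> unseen H us (fst q) \<and> \<not> unseen H us (snd q)}"

lemma colouring_avoids_forced_bad:
  assumes "two_colourable (set (us @ hs)) H"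
  shows "\<exists>C\<subseteq>set us. avoids (forced_bad V H us C) hs"
proof -
  obtain Q where Q: "\<forall>x\<in>set (us @ hs). \<forall>y\<in>set (us @ hs). H x y \<longrightarrow> (x \<in> Q) \<noteq> (y \<in> Q)"
    using assms unfolding two_colourable_def ..
  define C where "C = set us - Q"
  have side: "x \<in> forced_side H us C \<longleftrightarrow> x \<in> Q" if "x \<in> set hs" "\<not> unseen H us x" for x
  proof -
    define u where "u = hd (filter (H x) us)"
    have "filter (H x) us \<noteq> []" using that(2) by (auto simp: unseen_def filter_empty_conv)
    then have "u \<in> set (filter (H x) us)" unfolding u_def by (rule hd_in_set)
    then have u: "u \<in> set us" "H x u" by auto
    then have "(x \<in> Q) \<noteq> (u \<in> Q)" using Q that by simp
    then show ?thesis using u by (auto simp: forced_side_def C_def u_def[symmetric])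
  qed
  have "avoids (forced_bad V H us C) hs"
  proof (rule avoidsI)
    fix x y assume xy: "x \<in> set hs" "y \<in> set hs"
    show "(x, y) \<notin> forced_bad V H us C"
      using side[OF xy(1)] side[OF xy(2)] Q xy by (auto simp: forced_bad_def mono_pairs_def)
  qed
  then show ?thesis by (intro exI[of _ C]) (auto simp: C_def)
qed

text \<open>The sample consists of \<open>t\<close> vertices \<open>us\<close> followed by \<open>k\<close> pairs. With high probability almost all vertices of
linear degree have a neighbour in \<open>us\<close>. Then each of the at most \<open>2 ^ t\<close> colourings of \<open>us\<close> forces a
partition of the vertices with a neighbour in \<open>us\<close>, and since \<open>H\<close> is far from bipartite, a positive fraction of all pairs
are edges inside a class. The pairs of the sample miss such an edge with a probability so small that a
union bound over the colourings applies. A colouring of the whole sample would avoid all of them.\<close>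

lemma bipartiteness_tester:
  fixes \<epsilon> :: real
  assumes \<epsilon>: "0 < \<epsilon>" "\<epsilon> \<le> 1"
  shows "\<exists>m>0. \<forall>(V :: 'a set) H. finite V \<longrightarrow> V \<noteq> {} \<longrightarrow> (\<forall>x y. H x y \<longrightarrow> H y x) \<longrightarrow>
           (\<forall>P. 2 * \<epsilon> * (real (card V))\<^sup>2 \<le> real (card (mono_pairs V H P))) \<longrightarrow>
           real (card V) ^ m / 2 \<le> sample_sum V m (\<lambda>xs. of_bool (\<not> two_colourable (set xs) H))"
proof -
  obtain t where t: "(1 - \<epsilon> / 4) ^ t < \<epsilon> / 16"
    using real_arch_pow_inv[of "\<epsilon> / 16" "1 - \<epsilon> / 4"] \<epsilon> by auto
  obtain k where k: "(1 - \<epsilon>) ^ k < 1 / (4 * 2 ^ t)"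
    using real_arch_pow_inv[of "1 / (4 * 2 ^ t)" "1 - \<epsilon>"] \<epsilon> by auto
  have "t \<noteq> 0" using t \<epsilon> by (intro notI) simp
  have "real (card V) ^ (t + 2 * k) / 2 \<le> sample_sum V (t + 2 * k) (\<lambda>xs. of_bool (\<not> two_colourable (set xs) H))"
    if V: "finite V" "V \<noteq> {}" and sym: "\<And>x y. H x y \<Longrightarrow> H y x"
      and far: "\<And>P. 2 * \<epsilon> * (real (card V))\<^sup>2 \<le> real (card (mono_pairs V H P))"
    for V :: "'a set" and H
  proof -
    define n where "n = real (card V)"
    have n: "0 < n" using V by (simp add: n_def card_gt_0_iff)
    define deg where "deg x = real (card {y\<in>V. H x y})" for x
    have deg_le: "deg x \<le> n" for x
      unfolding deg_def n_def using V by (simp add: card_mono)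
    define Unc where "Unc us = {x\<in>V. \<epsilon> / 4 * n \<le> deg x \<and> unseen H us x}" for us
    define good where "good us \<longleftrightarrow> real (card (Unc us)) \<le> \<epsilon> / 4 * n" for us
    have bad_le: "of_bool (\<not> good us) \<le> 4 / (\<epsilon> * n) * (\<Sum>x\<in>{x\<in>V. \<epsilon> / 4 * n \<le> deg x}. of_bool (unseen H us x))" for us
    proof -
      have "(\<Sum>x\<in>{x\<in>V. \<epsilon> / 4 * n \<le> deg x}. of_bool (unseen H us x)) = real (card (Unc us))"
        unfolding Unc_def using V by (simp add: of_bool_def sum.inter_filter[symmetric] conj_assoc)
      moreover have "1 \<le> 4 / (\<epsilon> * n) * real (card (Unc us))" if "\<not> good us"
        using that \<epsilon> n by (simp add: good_def field_simps)
      moreover have "0 \<le> 4 / (\<epsilon> * n) * real (card (Unc us))" using \<epsilon> n by simp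
      ultimately show ?thesis by (cases "good us") auto
    qed
    have unseen_le: "sample_sum V t (\<lambda>us. of_bool (unseen H us x)) \<le> (1 - \<epsilon> / 4) ^ t * n ^ t"
      if "x \<in> V" "\<epsilon> / 4 * n \<le> deg x" for x
    proof -
      have "sample_sum V t (\<lambda>us. of_bool (unseen H us x)) = real (card {u\<in>V. \<not> H x u}) ^ t"
        unfolding unseen_def by (rule sample_all_in[OF V(1)])
      also have "\<dots> \<le> ((1 - \<epsilon> / 4) * n) ^ t"
        using card_filter_compl[OF V(1), of "H x"] that
        by (intro power_mono) (auto simp: deg_def n_def algebra_simps)
      finally show ?thesis by (simp add: power_mult_distrib)
    qed
    have "sample_sum V t (\<lambda>us. of_bool (\<not> good us))
        \<le> sample_sum V t (\<lambda>us. 4 / (\<epsilon> * n) * (\<Sum>x\<in>{x\<in>V. \<epsilon> / 4 * n \<le> deg x}. of_bool (unseen H us x)))"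
      by (intro sample_sum_mono bad_le)
    also have "\<dots> = 4 / (\<epsilon> * n) * (\<Sum>x\<in>{x\<in>V. \<epsilon> / 4 * n \<le> deg x}. sample_sum V t (\<lambda>us. of_bool (unseen H us x)))"
      by (simp only: sample_sum_mult sample_sum_sum)
    also have "\<dots> \<le> 4 / (\<epsilon> * n) * (\<Sum>x\<in>{x\<in>V. \<epsilon> / 4 * n \<le> deg x}. (1 - \<epsilon> / 4) ^ t * n ^ t)"
      using \<epsilon> n by (intro mult_left_mono sum_mono unseen_le) auto
    also have "\<dots> \<le> 4 / (\<epsilon> * n) * (n * ((\<epsilon> / 16) * n ^ t))"
    proof (intro mult_left_mono)
      have "(\<Sum>x\<in>{x\<in>V. \<epsilon> / 4 * n \<le> deg x}. (1 - \<epsilon> / 4) ^ t * n ^ t)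
          = real (card {x\<in>V. \<epsilon> / 4 * n \<le> deg x}) * ((1 - \<epsilon> / 4) ^ t * n ^ t)" by simp
      also have "\<dots> \<le> n * ((\<epsilon> / 16) * n ^ t)"
        using V t \<epsilon> n by (intro mult_mono) (auto simp: n_def card_mono)
      finally show "(\<Sum>x\<in>{x\<in>V. \<epsilon> / 4 * n \<le> deg x}. (1 - \<epsilon> / 4) ^ t * n ^ t) \<le> n * ((\<epsilon> / 16) * n ^ t)" .
    qed (use \<epsilon> n in auto)
    also have "\<dots> = n ^ t / 4" using \<epsilon> n by (simp add: field_simps)
    finally have bad_total: "sample_sum V t (\<lambda>us. of_bool (\<not> good us)) \<le> n ^ t / 4" .
    (* Of the monochromatic pairs, at least 2 * \<epsilon> * n\<^sup>2 in number, those with an unseen end are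
       discarded: at most \<epsilon> / 2 * n\<^sup>2 for each of the two ends. *)
    have many: "\<epsilon> * n\<^sup>2 \<le> real (card (forced_bad V H us C))" if "good us" for us C
    proof -
      define U where "U = {q\<in>V \<times> V. H (fst q) (snd q) \<and> unseen H us (fst q)}"
      have fin: "finite U" "finite (forced_bad V H us C)"
        using V by (auto simp: U_def forced_bad_def mono_pairs_def)
      have "real (card U) = (\<Sum>x\<in>{x\<in>V. unseen H us x}. deg x)"
      proof -
        have "U = Sigma {x\<in>V. unseen H us x} (\<lambda>x. {y\<in>V. H x y})" by (auto simp: U_def)
        then show ?thesis using V by (simp add: deg_def card_SigmaI)
      qed
      also have "\<dots> \<le> (\<Sum>x\<in>{x\<in>V. unseen H us x}. \<epsilon> / 4 * n + (if x \<in> Unc us then n else 0))"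
        using deg_le \<epsilon> n by (intro sum_mono) (auto simp: Unc_def not_le intro: add_increasing)
      also have "\<dots> = real (card {x\<in>V. unseen H us x}) * (\<epsilon> / 4 * n) + n * real (card (Unc us))"
      proof -
        have "{x\<in>V. unseen H us x} \<inter> Unc us = Unc us" by (auto simp: Unc_def)
        then show ?thesis using V by (simp add: sum.distrib sum.inter_restrict[symmetric])
      qed
      also have "\<dots> \<le> n * (\<epsilon> / 4 * n) + n * (\<epsilon> / 4 * n)"
        using that V \<epsilon> n by (intro add_mono mult_mono) (auto simp: good_def n_def card_mono)
      finally have cU: "real (card U) \<le> \<epsilon> / 2 * n\<^sup>2" by (simp add: power2_eq_square field_simps)
      have "mono_pairs V H (forced_side H us C) \<subseteq> forced_bad V H us C \<union> U \<union> prod.swap ` U"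
      proof
        fix q assume q: "q \<in> mono_pairs V H (forced_side H us C)"
        show "q \<in> forced_bad V H us C \<union> U \<union> prod.swap ` U"
        proof (cases "unseen H us (snd q)")
          case True
          then have "prod.swap q \<in> U" using q sym by (auto simp: U_def mono_pairs_def)
          then have "prod.swap (prod.swap q) \<in> prod.swap ` U" by (rule imageI)
          then show ?thesis by simp
        qed (use q in \<open>auto simp: U_def forced_bad_def mono_pairs_def\<close>)
      qed
      then have "card (mono_pairs V H (forced_side H us C)) \<le> card (forced_bad V H us C \<union> U \<union> prod.swap ` U)"
        using fin by (intro card_mono) auto
      also have "\<dots> \<le> card (forced_bad V H us C) + card U + card U"
        using fin card_image_le[of U prod.swap]
        by (intro order_trans[OF card_Un_le] add_mono card_Un_le) auto
      finally have "2 * \<epsilon> * n\<^sup>2 \<le> real (card (forced_bad V H us C)) + 2 * real (card U)"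
        using far[of "forced_side H us C"] unfolding n_def by linarith
      then show ?thesis using cU by linarith
    qed
    have inner: "sample_sum V (2 * k) (\<lambda>hs. of_bool (two_colourable (set (us @ hs)) H)) \<le> n ^ (2 * k) / 4"
      if us: "good us" "length us = t" for us
    proof -
      have "sample_sum V (2 * k) (\<lambda>hs. of_bool (two_colourable (set (us @ hs)) H))
          \<le> sample_sum V (2 * k) (\<lambda>hs. \<Sum>C\<in>Pow (set us). of_bool (avoids (forced_bad V H us C) hs))"
      proof (rule sample_sum_mono)
        fix hs
        show "of_bool (two_colourable (set (us @ hs)) H)
            \<le> (\<Sum>C\<in>Pow (set us). of_bool (avoids (forced_bad V H us C) hs) :: real)"
        proof (cases "two_colourable (set (us @ hs)) H")
          case True
          from colouring_avoids_forced_bad[OF this, of V]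
          obtain C where C: "C \<subseteq> set us" "avoids (forced_bad V H us C) hs" by blast
          then have "of_bool (avoids (forced_bad V H us C) hs)
              \<le> (\<Sum>C\<in>Pow (set us). of_bool (avoids (forced_bad V H us C) hs) :: real)"
            by (intro member_le_sum) auto
          then show ?thesis using C by simp
        qed (auto intro: sum_nonneg)
      qed
      also have "\<dots> = (\<Sum>C\<in>Pow (set us). (n\<^sup>2 - real (card (forced_bad V H us C))) ^ k)"
        unfolding sample_sum_sum n_def
        by (intro sum.cong refl sample_avoids[OF V(1)]) (auto simp: forced_bad_def mono_pairs_def)
      also have "\<dots> \<le> (\<Sum>C\<in>Pow (set us). ((1 - \<epsilon>) * n\<^sup>2) ^ k)"
      proof (intro sum_mono power_mono)
        fix C
        show "n\<^sup>2 - real (card (forced_bad V H us C)) \<le> (1 - \<epsilon>) * n\<^sup>2"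
          using many[OF us(1), of C] by (simp add: algebra_simps)
        have "card (forced_bad V H us C) \<le> card (V \<times> V)"
          using V by (intro card_mono) (auto simp: forced_bad_def mono_pairs_def)
        then have "real (card (forced_bad V H us C)) \<le> real (card V * card V)"
          by (simp only: card_cartesian_product of_nat_le_iff)
        then show "0 \<le> n\<^sup>2 - real (card (forced_bad V H us C))"
          by (simp add: n_def power2_eq_square)
      qed
      also have "\<dots> = 2 ^ card (set us) * ((1 - \<epsilon>) ^ k * n ^ (2 * k))"
        by (simp add: card_Pow power_mult_distrib power_mult[symmetric])
      also have "\<dots> \<le> 2 ^ t * (1 / (4 * 2 ^ t) * n ^ (2 * k))"
      proof (rule mult_mono)
        show "(2::real) ^ card (set us) \<le> 2 ^ t"
          using us(2) card_length[of us] by (intro power_increasing) auto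
        show "(1 - \<epsilon>) ^ k * n ^ (2 * k) \<le> 1 / (4 * 2 ^ t) * n ^ (2 * k)"
          using k n by (intro mult_right_mono) auto
      qed (use n \<epsilon> in auto)
      finally show ?thesis by simp
    qed
    have "sample_sum V (t + 2 * k) (\<lambda>xs. of_bool (two_colourable (set xs) H))
        = sample_sum V t (\<lambda>us. sample_sum V (2 * k) (\<lambda>hs. of_bool (two_colourable (set (us @ hs)) H)))"
      by (rule sample_sum_append)
    also have "\<dots> \<le> sample_sum V t (\<lambda>us. n ^ (2 * k) * of_bool (\<not> good us) + n ^ (2 * k) / 4)"
    proof (rule sample_sum_mono)
      fix us :: "'a list" assume us: "length us = t"
      have "sample_sum V (2 * k) (\<lambda>hs. of_bool (two_colourable (set (us @ hs)) H)) \<le> sample_sum V (2 * k) (\<lambda>_. 1)"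
        by (intro sample_sum_mono) auto
      also have "\<dots> = n ^ (2 * k)" by (simp only: sample_sum_const n_def mult_1)
      finally have all: "sample_sum V (2 * k) (\<lambda>hs. of_bool (two_colourable (set (us @ hs)) H)) \<le> n ^ (2 * k)" .
      show "sample_sum V (2 * k) (\<lambda>hs. of_bool (two_colourable (set (us @ hs)) H))
          \<le> n ^ (2 * k) * of_bool (\<not> good us) + n ^ (2 * k) / 4"
      proof (cases "good us")
        case True
        then show ?thesis using inner[OF True us] by simp
      next
        case False
        have "0 \<le> n ^ (2 * k)" using n by simp
        moreover have "n ^ (2 * k) * of_bool (\<not> good us) = n ^ (2 * k)" using False by simp
        ultimately show ?thesis using all by linarith
      qed
    qed
    also have "\<dots> = n ^ (2 * k) * sample_sum V t (\<lambda>us. of_bool (\<not> good us)) + n ^ (2 * k) / 4 * n ^ t"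
      by (simp only: sample_sum_add sample_sum_mult sample_sum_const n_def)
    also have "\<dots> \<le> n ^ (2 * k) * (n ^ t / 4) + n ^ (2 * k) / 4 * n ^ t"
      using bad_total n by (intro add_right_mono mult_left_mono) auto
    also have "\<dots> = n ^ (t + 2 * k) / 2" by (simp add: power_add)
    finally have col: "sample_sum V (t + 2 * k) (\<lambda>xs. of_bool (two_colourable (set xs) H)) \<le> n ^ (t + 2 * k) / 2" .
    have "sample_sum V (t + 2 * k) (\<lambda>xs. of_bool (two_colourable (set xs) H))
        + sample_sum V (t + 2 * k) (\<lambda>xs. of_bool (\<not> two_colourable (set xs) H))
        = sample_sum V (t + 2 * k) (\<lambda>xs. 1)"
      unfolding sample_sum_add[symmetric] by (intro sample_sum_cong) auto
    also have "\<dots> = n ^ (t + 2 * k)" by (simp only: sample_sum_const n_def mult_1)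
    finally show ?thesis using col unfolding n_def by linarith
  qed
  then show ?thesis using \<open>t \<noteq> 0\<close> by (intro exI[of _ "t + 2 * k"]) auto
qed

text \<open>The blocks of a random list are independent samples for the tester, and in a list without repetitions
they are disjoint, so that the bad ones can serve as the pieces in \<open>cover_weight_lower_bound\<close>.\<close>

primrec bad_blocks :: "('a \<Rightarrow> 'a \<Rightarrow> bool) \<Rightarrow> nat \<Rightarrow> nat \<Rightarrow> 'a list \<Rightarrow> nat" where
  "bad_blocks H m 0 xs = 0"
| "bad_blocks H m (Suc L) xs = of_bool (\<not> two_colourable (set (take m xs)) H) + bad_blocks H m L (drop m xs)"

lemma bad_blocks_le: "bad_blocks H m L xs \<le> L"
  by (induction L arbitrary: xs) (auto simp: of_bool_def intro: le_SucI)

lemma bad_blocks_family: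
  assumes "distinct xs"
  shows "\<exists>\<B>. finite \<B> \<and> \<Union>\<B> \<subseteq> set xs \<and> pairwise (\<lambda>A B. A \<inter> B = {}) \<B> \<and>
           (\<forall>B\<in>\<B>. \<not> two_colourable B H) \<and> bad_blocks H m L xs = card \<B>"
  using assms
proof (induction L arbitrary: xs)
  case 0
  show ?case by (intro exI[of _ "{}"]) auto
next
  case (Suc L)
  have "distinct (drop m xs)" using Suc.prems by simp
  then obtain \<B> where \<B>: "finite \<B>" "\<Union>\<B> \<subseteq> set (drop m xs)" "pairwise (\<lambda>A B. A \<inter> B = {}) \<B>"
    "\<And>B. B \<in> \<B> \<Longrightarrow> \<not> two_colourable B H" "bad_blocks H m L (drop m xs) = card \<B>"
    using Suc.IH by metis
  define B0 where "B0 = set (take m xs)"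
  have disj: "B0 \<inter> set (drop m xs) = {}"
    using Suc.prems unfolding B0_def by (metis append_take_drop_id distinct_append)
  have sub: "B0 \<subseteq> set xs" "set (drop m xs) \<subseteq> set xs"
    by (auto simp: B0_def dest: in_set_takeD in_set_dropD)
  show ?case
  proof (cases "two_colourable B0 H")
    case True
    then show ?thesis using \<B> sub by (intro exI[of _ \<B>]) (auto simp: B0_def)
  next
    case False
    have "B0 \<noteq> {}" using False by (auto simp: two_colourable_def)
    then have "B0 \<notin> \<B>" using disj \<B>(2) by blast
    moreover have "pairwise (\<lambda>A B. A \<inter> B = {}) (insert B0 \<B>)"
      using \<B>(2,3) disj by (auto simp: pairwise_insert)
    ultimately show ?thesis
      using \<B> sub False by (intro exI[of _ "insert B0 \<B>"]) (auto simp: B0_def)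
  qed
qed

lemma sample_bad_blocks:
  assumes "real (card V) ^ m / 2 \<le> sample_sum V m (\<lambda>xs. of_bool (\<not> two_colourable (set xs) H))"
  shows "real L / 2 * real (card V) ^ (L * m) \<le> sample_sum V (L * m) (\<lambda>xs. real (bad_blocks H m L xs))"
proof (induction L)
  case (Suc L)
  define n where "n = real (card V)"
  define I where "I = sample_sum V (L * m) (\<lambda>xs. real (bad_blocks H m L xs))"
  have "sample_sum V (Suc L * m) (\<lambda>xs. real (bad_blocks H m (Suc L) xs))
      = sample_sum V m (\<lambda>us. sample_sum V (L * m) (\<lambda>ys. real (bad_blocks H m (Suc L) (us @ ys))))"
    unfolding mult_Suc by (rule sample_sum_append)
  also have "\<dots> = sample_sum V m (\<lambda>us. n ^ (L * m) * of_bool (\<not> two_colourable (set us) H) + I)"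
  proof (rule sample_sum_cong)
    fix us :: "'a list" assume "length us = m"
    then have "sample_sum V (L * m) (\<lambda>ys. real (bad_blocks H m (Suc L) (us @ ys)))
        = sample_sum V (L * m) (\<lambda>ys. of_bool (\<not> two_colourable (set us) H) + real (bad_blocks H m L ys))"
      by simp
    also have "\<dots> = n ^ (L * m) * of_bool (\<not> two_colourable (set us) H) + I"
      by (simp only: sample_sum_add sample_sum_const n_def I_def mult.commute)
    finally show "sample_sum V (L * m) (\<lambda>ys. real (bad_blocks H m (Suc L) (us @ ys)))
        = n ^ (L * m) * of_bool (\<not> two_colourable (set us) H) + I" .
  qed
  also have "\<dots> = n ^ (L * m) * sample_sum V m (\<lambda>us. of_bool (\<not> two_colourable (set us) H)) + I * n ^ m"
    by (simp only: sample_sum_add sample_sum_const sample_sum_mult n_def)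
  also have "\<dots> \<ge> n ^ (L * m) * (n ^ m / 2) + real L / 2 * n ^ (L * m) * n ^ m"
    using assms Suc.IH by (intro add_mono mult_left_mono mult_right_mono) (auto simp: n_def I_def)
  finally show ?case by (simp add: n_def power_add algebra_simps)
qed simp

section \<open>Random subsets of a finite set\<close>

text \<open>The expectation of \<open>f\<close> for a random subset of \<open>A\<close> that contains each \<open>x\<close> independently with probability
\<open>p x\<close>.\<close>

definition random_subset_mean :: "'b set \<Rightarrow> ('b \<Rightarrow> real) \<Rightarrow> ('b set \<Rightarrow> real) \<Rightarrow> real" where
  "random_subset_mean A p f = (\<Sum>S\<in>Pow A. (\<Prod>x\<in>S. p x) * (\<Prod>x\<in>A - S. 1 - p x) * f S)"

context
  fixes A :: "'b set" and p :: "'b \<Rightarrow> real"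
  assumes finA: "finite A" and p01: "\<And>x. x \<in> A \<Longrightarrow> 0 \<le> p x" "\<And>x. x \<in> A \<Longrightarrow> p x \<le> 1"
begin

abbreviation (input) "mean \<equiv> random_subset_mean A p"

lemma mean_mult: "mean (\<lambda>S. c * f S) = c * mean f"
  by (simp add: random_subset_mean_def sum_distrib_left mult_ac)

lemma mean_add: "mean (\<lambda>S. f S + g S) = mean f + mean g"
  by (simp add: random_subset_mean_def sum.distrib distrib_left)

lemma mean_diff: "mean (\<lambda>S. f S - g S) = mean f - mean g"
  by (simp add: random_subset_mean_def sum_subtractf right_diff_distrib)

lemma mean_sum: "mean (\<lambda>S. \<Sum>i\<in>I. f i S) = (\<Sum>i\<in>I. mean (f i))"
  unfolding random_subset_mean_def by (subst sum.swap) (simp add: sum_distrib_left)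

lemma mean_weight_nonneg: "S \<subseteq> A \<Longrightarrow> 0 \<le> (\<Prod>x\<in>S. p x) * (\<Prod>x\<in>A - S. 1 - p x)"
  using p01 by (intro mult_nonneg_nonneg prod_nonneg) auto

lemma mean_mono: "(\<And>S. S \<subseteq> A \<Longrightarrow> f S \<le> g S) \<Longrightarrow> mean f \<le> mean g"
  unfolding random_subset_mean_def
  by (intro sum_mono mult_left_mono mean_weight_nonneg) auto

text \<open>Only subsets of \<open>A - F\<close> contribute, and on these the weights factor; what remains is the expansion of
the product of the factors \<open>p x + (1 - p x)\<close>. All probabilities needed later reduce to this one.\<close>

lemma mean_avoid:
  assumes "F \<subseteq> A"
  shows "mean (\<lambda>S. of_bool (S \<inter> F = {})) = (\<Prod>x\<in>F. 1 - p x)"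
proof -
  have finF: "finite F" "finite (A - F)" using assms finA finite_subset by blast+
  have "mean (\<lambda>S. of_bool (S \<inter> F = {}))
      = (\<Sum>S\<in>Pow (A - F). (\<Prod>x\<in>S. p x) * (\<Prod>x\<in>A - S. 1 - p x) * of_bool (S \<inter> F = {}))"
    unfolding random_subset_mean_def
    by (rule sum.mono_neutral_right) (use finA in auto)
  also have "\<dots> = (\<Sum>S\<in>Pow (A - F). (\<Prod>x\<in>F. 1 - p x) * ((\<Prod>x\<in>S. p x) * (\<Prod>x\<in>(A - F) - S. 1 - p x)))"
  proof (rule sum.cong)
    fix S assume S: "S \<in> Pow (A - F)"
    then have "A - S = F \<union> ((A - F) - S)" "F \<inter> ((A - F) - S) = {}" using assms by auto
    then have "(\<Prod>x\<in>A - S. 1 - p x) = (\<Prod>x\<in>F. 1 - p x) * (\<Prod>x\<in>(A - F) - S. 1 - p x)"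
      using finF by (metis finite_Diff prod.union_disjoint)
    moreover have "S \<inter> F = {}" using S by auto
    ultimately show "(\<Prod>x\<in>S. p x) * (\<Prod>x\<in>A - S. 1 - p x) * of_bool (S \<inter> F = {})
        = (\<Prod>x\<in>F. 1 - p x) * ((\<Prod>x\<in>S. p x) * (\<Prod>x\<in>(A - F) - S. 1 - p x))"
      by simp
  qed simp
  also have "\<dots> = (\<Prod>x\<in>F. 1 - p x) * (\<Prod>x\<in>A - F. p x + (1 - p x))"
    using finF prod_add[of "A - F" p "\<lambda>x. 1 - p x"] by (simp add: sum_distrib_left[symmetric])
  finally show ?thesis by simp
qed

lemma mean_const: "mean (\<lambda>S. c) = c"
  using mean_avoid[of "{}"] mean_mult[of c "\<lambda>_. 1"] by simp

lemma mean_hit_avoid: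
  assumes "F \<subseteq> A" "t \<in> A" "t \<notin> F"
  shows "mean (\<lambda>S. of_bool (t \<in> S \<and> S \<inter> F = {})) = p t * (\<Prod>x\<in>F. 1 - p x)"
proof -
  have finF: "finite F" using assms finA finite_subset by blast
  have "(\<lambda>S. of_bool (t \<in> S \<and> S \<inter> F = {}) :: real)
      = (\<lambda>S. of_bool (S \<inter> F = {}) - of_bool (S \<inter> insert t F = {}))"
    by (auto simp: fun_eq_iff of_bool_def)
  then have "mean (\<lambda>S. of_bool (t \<in> S \<and> S \<inter> F = {}))
      = mean (\<lambda>S. of_bool (S \<inter> F = {})) - mean (\<lambda>S. of_bool (S \<inter> insert t F = {}))"
    by (simp only: mean_diff)
  also have "\<dots> = (\<Prod>x\<in>F. 1 - p x) - (\<Prod>x\<in>insert t F. 1 - p x)"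
    using assms by (subst (1 2) mean_avoid) auto
  finally show ?thesis using assms finF by (simp add: algebra_simps)
qed

lemma mean_attained: "\<exists>S\<subseteq>A. mean f \<le> f S"
proof -
  define M where "M = Max (f ` Pow A)"
  have "M \<in> f ` Pow A" unfolding M_def using finA by (intro Max_in) auto
  moreover have "mean f \<le> mean (\<lambda>S. M)"
    unfolding M_def using finA by (intro mean_mono Max_ge) auto
  ultimately show ?thesis by (auto simp: mean_const)
qed

end

section \<open>The nibble: rounding a spread fractional matching\<close>

lemma one_minus_sum_le_prod:
  assumes "finite A" "\<And>x. x \<in> A \<Longrightarrow> 0 \<le> p x" "\<And>x. x \<in> A \<Longrightarrow> p x \<le> (1::real)"
  shows "1 - (\<Sum>x\<in>A. p x) \<le> (\<Prod>x\<in>A. 1 - p x)"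
  using assms
proof (induction A rule: finite_induct)
  case (insert x A)
  have "(\<Prod>x\<in>A. 1 - p x) \<le> 1" using insert by (intro prod_le_1) auto
  then have "p x * (\<Prod>x\<in>A. 1 - p x) \<le> p x" using insert by (intro mult_left_le) auto
  then show ?case using insert by (simp add: left_diff_distrib)
qed simp

text \<open>A linear 3-uniform hypergraph. Linearity makes the fates of different vertices nearly independent in
the nibble below.\<close>

locale linear_triple_system =
  fixes X :: "'b set" and \<H> :: "'b set set"
  assumes finite_X: "finite X"
    and triple: "T \<in> \<H> \<Longrightarrow> T \<subseteq> X \<and> card T = 3"
    and linear: "T \<in> \<H> \<Longrightarrow> U \<in> \<H> \<Longrightarrow> x \<in> T \<Longrightarrow> y \<in> T \<Longrightarrow> x \<in> U \<Longrightarrow> y \<in> U \<Longrightarrow> x \<noteq> y \<Longrightarrow> T = U"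
begin

definition fractional_matching :: "real \<Rightarrow> ('b set \<Rightarrow> real) \<Rightarrow> bool" where
  "fractional_matching \<mu> w \<longleftrightarrow> (\<forall>T\<in>\<H>. 0 \<le> w T \<and> w T \<le> \<mu>) \<and> (\<forall>x\<in>X. (\<Sum>T\<in>{T\<in>\<H>. x \<in> T}. w T) \<le> 1)"

definition matching :: "'b set set \<Rightarrow> bool" where
  "matching M \<longleftrightarrow> M \<subseteq> \<H> \<and> pairwise (\<lambda>T U. T \<inter> U = {}) M"

lemma finite_\<H>: "finite \<H>"
  by (rule finite_subset[of _ "Pow X"]) (use triple finite_X in auto)

lemma sum_triples:
  "(\<Sum>x\<in>X. \<Sum>T\<in>{T\<in>\<H>. x \<in> T}. f x T) = (\<Sum>T\<in>\<H>. \<Sum>x\<in>T. f x T)"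
proof -
  have "(\<Sum>x\<in>X. \<Sum>T\<in>{T\<in>\<H>. x \<in> T}. f x T) = (\<Sum>T\<in>\<H>. \<Sum>x\<in>{x\<in>X. x \<in> T}. f x T)"
    by (rule sum.swap_restrict[OF finite_X finite_\<H>])
  also have "\<dots> = (\<Sum>T\<in>\<H>. \<Sum>x\<in>T. f x T)"
    by (intro sum.cong refl) (use triple in auto)
  finally show ?thesis .
qed

lemma total_weight_le:
  assumes "fractional_matching \<mu> w"
  shows "(\<Sum>T\<in>\<H>. w T) \<le> real (card X)"
proof -
  have "3 * (\<Sum>T\<in>\<H>. w T) = (\<Sum>T\<in>\<H>. \<Sum>x\<in>T. w T)"
    using triple by (simp add: sum_distrib_left)
  also have "\<dots> = (\<Sum>x\<in>X. \<Sum>T\<in>{T\<in>\<H>. x \<in> T}. w T)" by (rule sum_triples[symmetric])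
  also have "\<dots> \<le> (\<Sum>x\<in>X. 1)" using assms by (intro sum_mono) (auto simp: fractional_matching_def)
  finally have "3 * (\<Sum>T\<in>\<H>. w T) \<le> real (card X)" by simp
  moreover have "0 \<le> (\<Sum>T\<in>\<H>. w T)" using assms by (intro sum_nonneg) (auto simp: fractional_matching_def)
  ultimately show ?thesis by linarith
qed

definition touch :: "'b set \<Rightarrow> 'b set set" where
  "touch F = {T\<in>\<H>. T \<inter> F \<noteq> {}}"

lemma touch_sub: "touch F \<subseteq> \<H>" by (auto simp: touch_def)

lemma touch_Un: "touch (F \<union> G) = touch F \<union> touch G" by (auto simp: touch_def)

lemma touch_mono: "F \<subseteq> G \<Longrightarrow> touch F \<subseteq> touch G" by (auto simp: touch_def)

lemma finite_touch: "finite (touch F)" using finite_subset[OF touch_sub finite_\<H>] .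

lemma card_touch_both_le:
  assumes "finite F" "finite G" "F \<inter> G = {}"
  shows "card (touch F \<inter> touch G) \<le> card F * card G"
proof -
  have "touch F \<inter> touch G \<subseteq> (\<Union>q\<in>F \<times> G. {T\<in>\<H>. fst q \<in> T \<and> snd q \<in> T})"
    by (fastforce simp: touch_def)
  then have "card (touch F \<inter> touch G) \<le> card (\<Union>q\<in>F \<times> G. {T\<in>\<H>. fst q \<in> T \<and> snd q \<in> T})"
    using assms finite_\<H> by (intro card_mono) auto
  also have "\<dots> \<le> (\<Sum>q\<in>F \<times> G. card {T\<in>\<H>. fst q \<in> T \<and> snd q \<in> T})"
    using assms by (intro card_UN_le) auto
  also have "\<dots> \<le> (\<Sum>q\<in>F \<times> G. 1)"
  proof (rule sum_mono)
    fix q assume "q \<in> F \<times> G"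
    then have "fst q \<noteq> snd q" using assms by auto
    then show "card {T\<in>\<H>. fst q \<in> T \<and> snd q \<in> T} \<le> 1"
      using linear finite_\<H> by (subst One_nat_def, subst card_le_Suc0_iff_eq) auto
  qed
  finally show ?thesis by (simp add: card_cartesian_product)
qed

end

text \<open>One round of the nibble: every triple is selected independently with probability \<open>\<theta> * w T\<close>. Selected
triples that meet no other selected triple go into the matching. A vertex survives if no
selected triple contains it, and triples whose vertices all survive keep a rescaled weight.\<close>

locale nibble = linear_triple_system X \<H> for X :: "'b set" and \<H> +
  fixes w :: "'b set \<Rightarrow> real" and \<mu> \<theta> \<xi> :: real
  assumes w: "fractional_matching \<mu> w"
    and \<theta>: "0 < \<theta>" "\<theta> \<le> 1/4" and \<mu>: "0 < \<mu>" "\<mu> \<le> 1/4" and \<xi>: "2 * \<mu> \<le> \<xi>"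
begin

definition p :: "'b set \<Rightarrow> real" where "p T = \<theta> * w T"

definition survival :: "'b set \<Rightarrow> real" where
  "survival F = (\<Prod>T\<in>touch F. 1 - p T)"

text \<open>The factor that balances one round: a triple survives with probability at least the
product of the survival probabilities of its vertices, so its expected new weight is at least
\<open>(1 - \<theta>) * w T\<close>. At the same time the expected new load of a vertex \<open>x\<close> is essentially
\<open>(1 - \<theta>) * load / survival {x}\<close>, which is at most \<open>1\<close> since
\<open>survival {x}\<close> is at least \<open>1 - \<theta> * load\<close>. Dividing by the survival probabilities thus takes the
place of a regularisation of the loads.\<close>

definition boost :: "'b set \<Rightarrow> real" where
  "boost T = (1 - \<theta>) / (\<Prod>x\<in>T. survival {x})"

definition \<beta> :: real where "\<beta> = 1 - \<theta> * \<mu>"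

text \<open>The new load of \<open>x\<close>, counted without asking whether \<open>x\<close> itself survives.\<close>

definition load' :: "'b \<Rightarrow> 'b set set \<Rightarrow> real" where
  "load' x S = (\<Sum>T\<in>{T\<in>\<H>. x \<in> T}. w T * boost T * of_bool (S \<inter> touch (T - {x}) = {}))"

abbreviation (input) "E \<equiv> random_subset_mean \<H> p"

lemma w_nonneg: "T \<in> \<H> \<Longrightarrow> 0 \<le> w T" and w_le: "T \<in> \<H> \<Longrightarrow> w T \<le> \<mu>"
  and load_le: "x \<in> X \<Longrightarrow> (\<Sum>T\<in>{T\<in>\<H>. x \<in> T}. w T) \<le> 1"
  using w by (auto simp: fractional_matching_def)

lemma \<beta>: "15/16 \<le> \<beta>" "\<beta> \<le> 1" "1 / \<beta> \<le> 1 + \<mu> / 2"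
proof -
  have "\<theta> * \<mu> \<le> 1/4 * \<mu>" using \<theta> \<mu> by (intro mult_right_mono) auto
  then have q: "1 - \<mu> / 4 \<le> \<beta>" by (simp add: \<beta>_def)
  then show "15/16 \<le> \<beta>" using \<mu> by linarith
  show "\<beta> \<le> 1" using \<theta> \<mu> by (simp add: \<beta>_def)
  have "1 \<le> (1 + \<mu> / 2) * (1 - \<mu> / 4)"
  proof -
    have "\<mu> * \<mu> \<le> 1/4 * \<mu>" using \<mu> by (intro mult_right_mono) auto
    then show ?thesis using \<mu> by (simp add: algebra_simps)
  qed
  also have "\<dots> \<le> (1 + \<mu> / 2) * \<beta>" using q \<mu> by (intro mult_left_mono) auto
  finally show "1 / \<beta> \<le> 1 + \<mu> / 2" using \<open>15/16 \<le> \<beta>\<close> by (simp add: field_simps)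
qed

lemma p_nonneg: "T \<in> \<H> \<Longrightarrow> 0 \<le> p T" using w_nonneg \<theta> by (simp add: p_def)

lemma p_le: "T \<in> \<H> \<Longrightarrow> p T \<le> \<theta> * \<mu>" using w_le \<theta> by (simp add: p_def)

lemma p_le_1: "T \<in> \<H> \<Longrightarrow> p T \<le> 1" using p_le \<beta>(1) by (fastforce simp: \<beta>_def)

lemma survival_pos: "0 < survival F"
  unfolding survival_def
proof (rule prod_pos)
  fix T assume "T \<in> touch F"
  then show "0 < 1 - p T" using p_le[of T] touch_sub \<beta>(1) by (fastforce simp: \<beta>_def)
qed

lemma mean_survives: "E (\<lambda>S. of_bool (S \<inter> touch F = {})) = survival F"
  unfolding survival_def
  by (rule mean_avoid[OF finite_\<H> p_nonneg p_le_1 touch_sub])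

lemma survival_single:
  assumes "x \<in> X"
  shows "1 - \<theta> * (\<Sum>T\<in>{T\<in>\<H>. x \<in> T}. w T) \<le> survival {x}" "1 - \<theta> \<le> survival {x}"
proof -
  have "touch {x} = {T\<in>\<H>. x \<in> T}" by (auto simp: touch_def)
  then show *: "1 - \<theta> * (\<Sum>T\<in>{T\<in>\<H>. x \<in> T}. w T) \<le> survival {x}"
    using one_minus_sum_le_prod[of "{T\<in>\<H>. x \<in> T}" p] p_nonneg p_le_1 finite_\<H>
    by (simp add: survival_def p_def sum_distrib_left)
  have "\<theta> * (\<Sum>T\<in>{T\<in>\<H>. x \<in> T}. w T) \<le> \<theta> * 1" using load_le[OF assms] \<theta> by (intro mult_left_mono) auto
  then show "1 - \<theta> \<le> survival {x}" using * by simp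
qed

lemma survival_Un: "survival (F \<union> G) * (\<Prod>T\<in>touch F \<inter> touch G. 1 - p T) = survival F * survival G"
  unfolding survival_def touch_Un by (rule prod.union_inter[OF finite_touch finite_touch])

lemma survival_Un_ge: "survival F * survival G \<le> survival (F \<union> G)"
proof -
  have "(\<Prod>T\<in>touch F \<inter> touch G. 1 - p T) \<le> 1"
    using p_nonneg p_le_1 touch_sub by (intro prod_le_1) force+
  then have "survival (F \<union> G) * (\<Prod>T\<in>touch F \<inter> touch G. 1 - p T) \<le> survival (F \<union> G)"
    using survival_pos[of "F \<union> G"] by (intro mult_left_le) auto
  then show ?thesis using survival_Un by simp
qed

text \<open>The events that \<open>F\<close> survives and that \<open>G\<close> survives are correlated only through triples that meet both sets, and
linearity allows at most \<open>card F * card G\<close> of these.\<close>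

lemma survival_Un_le:
  assumes "finite F" "finite G" "F \<inter> G = {}" "card F * card G \<le> k"
  shows "survival (F \<union> G) * \<beta> ^ k \<le> survival F * survival G"
proof -
  have "\<beta> ^ k \<le> \<beta> ^ card (touch F \<inter> touch G)"
    using card_touch_both_le[OF assms(1-3)] assms(4) \<beta> by (intro power_decreasing) auto
  also have "\<dots> = (\<Prod>T\<in>touch F \<inter> touch G. \<beta>)" by simp
  also have "\<dots> \<le> (\<Prod>T\<in>touch F \<inter> touch G. 1 - p T)"
  proof (rule prod_mono)
    fix T assume "T \<in> touch F \<inter> touch G"
    then show "0 \<le> \<beta> \<and> \<beta> \<le> 1 - p T" using p_le[of T] touch_sub \<beta>(1) by (fastforce simp: \<beta>_def)
  qed
  finally have "survival (F \<union> G) * \<beta> ^ k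
      \<le> survival (F \<union> G) * (\<Prod>T\<in>touch F \<inter> touch G. 1 - p T)"
    using survival_pos[of "F \<union> G"] by (intro mult_left_mono) auto
  then show ?thesis by (simp add: survival_Un)
qed

lemma triple_cases:
  assumes "T \<in> \<H>" "x \<in> T"
  obtains y z where "T = {x, y, z}" "x \<noteq> y" "y \<noteq> z" "x \<noteq> z" "T - {x} = {y, z}"
proof -
  have "card (T - {x}) = 2" using triple[OF assms(1)] assms(2) by simp
  then obtain y z where yz: "T - {x} = {y, z}" "y \<noteq> z" by (auto simp: card_2_iff)
  moreover from this have "T = {x, y, z}" "x \<noteq> y" "x \<noteq> z" using assms(2) by auto
  ultimately show thesis using that by blast
qed

lemma triple_nonempty: "T \<in> \<H> \<Longrightarrow> \<exists>x. x \<in> T"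
  using triple[of T] by (cases "T = {}") auto

lemma survival_triple_ge:
  assumes "T \<in> \<H>"
  shows "(\<Prod>x\<in>T. survival {x}) \<le> survival T"
proof -
  obtain x where "x \<in> T" using triple_nonempty[OF assms] by blast
  then obtain y z where T: "T = {x, y, z}" "x \<noteq> y" "y \<noteq> z" "x \<noteq> z"
    using triple_cases[OF assms] by metis
  have "survival {x} * (survival {y} * survival {z}) \<le> survival {x} * survival ({y} \<union> {z})"
    using survival_Un_ge[of "{y}" "{z}"] survival_pos[of "{x}"] by (intro mult_left_mono) auto
  also have "\<dots> \<le> survival ({x} \<union> ({y} \<union> {z}))" by (rule survival_Un_ge)
  finally show ?thesis using T by (simp add: insert_commute)
qed

lemma prod_survival:
  assumes "T \<in> \<H>"
  shows "(1 - \<theta>) ^ 3 \<le> (\<Prod>x\<in>T. survival {x})" "0 < (\<Prod>x\<in>T. survival {x})"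
proof -
  have "(\<Prod>x\<in>T. 1 - \<theta>) \<le> (\<Prod>x\<in>T. survival {x})"
    using survival_single(2) triple[OF assms] \<theta> by (intro prod_mono) auto
  then show "(1 - \<theta>) ^ 3 \<le> (\<Prod>x\<in>T. survival {x})" using triple[OF assms] by simp
  show "0 < (\<Prod>x\<in>T. survival {x})" using survival_pos by (intro prod_pos) auto
qed

lemma boost: assumes "T \<in> \<H>" shows "0 \<le> boost T" "boost T \<le> 2"
proof -
  show "0 \<le> boost T" unfolding boost_def using prod_survival(2)[OF assms] \<theta> by simp
  have t: "(3/4)\<^sup>2 \<le> (1 - \<theta>)\<^sup>2" using \<theta> by (intro power_mono) auto
  have "(1 - \<theta>) * 1 \<le> (1 - \<theta>) * (2 * (1 - \<theta>)\<^sup>2)"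
    using t \<theta> by (intro mult_left_mono) (auto simp: power2_eq_square)
  also have "\<dots> = 2 * (1 - \<theta>) ^ 3" by (simp add: power3_eq_cube power2_eq_square)
  also have "\<dots> \<le> 2 * (\<Prod>x\<in>T. survival {x})" using prod_survival(1)[OF assms] by simp
  finally show "boost T \<le> 2" unfolding boost_def using prod_survival(2)[OF assms]
    by (simp add: field_simps)
qed

lemma wb_nonneg: "T \<in> \<H> \<Longrightarrow> 0 \<le> w T * boost T"
  using w_nonneg boost by simp

lemma boosted_load_le_2: "x \<in> X \<Longrightarrow> (\<Sum>T\<in>{T\<in>\<H>. x \<in> T}. w T * boost T) \<le> 2"
proof -
  assume x: "x \<in> X"
  have "(\<Sum>T\<in>{T\<in>\<H>. x \<in> T}. w T * boost T) \<le> (\<Sum>T\<in>{T\<in>\<H>. x \<in> T}. w T * 2)"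
    using boost w_nonneg by (intro sum_mono mult_left_mono) auto
  also have "\<dots> \<le> 2" using load_le[OF x] by (simp add: sum_distrib_right[symmetric])
  finally show ?thesis .
qed

definition mean_load :: "'b \<Rightarrow> real" where
  "mean_load x = (\<Sum>T\<in>{T\<in>\<H>. x \<in> T}. w T * boost T * survival (T - {x}))"

lemma mean_load': "E (load' x) = mean_load x"
  unfolding load'_def mean_load_def
  by (simp add: mean_sum[OF finite_\<H> p_nonneg p_le_1] mean_mult[OF finite_\<H> p_nonneg p_le_1]
      mean_survives)

lemma mean_load_nonneg: "0 \<le> mean_load x"
  unfolding mean_load_def using survival_pos
  by (intro sum_nonneg mult_nonneg_nonneg[OF wb_nonneg]) (auto intro: less_imp_le)

lemma mean_load_le:
  assumes x: "x \<in> X"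
  shows "mean_load x \<le> 1 / \<beta>"
proof -
  define l where "l = (\<Sum>T\<in>{T\<in>\<H>. x \<in> T}. w T)"
  have sp: "0 < survival {x}" by (rule survival_pos)
  have "mean_load x \<le> (\<Sum>T\<in>{T\<in>\<H>. x \<in> T}. w T * ((1 - \<theta>) / (survival {x} * \<beta>)))"
    unfolding mean_load_def
  proof (rule sum_mono)
    fix T assume "T \<in> {T\<in>\<H>. x \<in> T}"
    then have T: "T \<in> \<H>" "x \<in> T" by auto
    then obtain y z where yz: "T = {x, y, z}" "x \<noteq> y" "y \<noteq> z" "x \<noteq> z" "T - {x} = {y, z}"
      using triple_cases by metis
    have "survival ({y} \<union> {z}) * \<beta> ^ 1 \<le> survival {y} * survival {z}"
      using yz by (intro survival_Un_le) auto
    then have le: "survival (T - {x}) * \<beta> \<le> survival {y} * survival {z}"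
      unfolding yz(5) by (simp add: insert_commute)
    have pr: "(\<Prod>x\<in>T. survival {x}) = survival {x} * (survival {y} * survival {z})"
      using yz by simp
    have "boost T * survival (T - {x}) \<le> (1 - \<theta>) / (survival {x} * \<beta>)"
    proof -
      have "(1 - \<theta>) * (survival (T - {x}) * \<beta>) \<le> (1 - \<theta>) * (survival {y} * survival {z})"
        using le \<theta> by (intro mult_left_mono) auto
      then show ?thesis
        unfolding boost_def pr using sp survival_pos[of "{y}"] survival_pos[of "{z}"] \<beta>
        by (simp add: divide_simps mult_ac)
    qed
    then show "w T * boost T * survival (T - {x}) \<le> w T * ((1 - \<theta>) / (survival {x} * \<beta>))"
      using mult_left_mono[OF _ w_nonneg[OF T(1)]] by (simp only: mult.assoc)
  qed
  also have "\<dots> = l * (1 - \<theta>) / (survival {x} * \<beta>)"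
    by (simp add: l_def sum_distrib_right sum_divide_distrib)
  also have "\<dots> \<le> 1 / \<beta>"
  proof -
    have "l * (1 - \<theta>) \<le> 1 - \<theta> * l" using load_le[OF x] by (simp add: l_def algebra_simps)
    also have "\<dots> \<le> survival {x}" using survival_single(1)[OF x] by (simp add: l_def)
    finally have "l * (1 - \<theta>) / (survival {x} * \<beta>) \<le> survival {x} / (survival {x} * \<beta>)"
      using sp \<beta> by (intro divide_right_mono) auto
    then show ?thesis using sp by simp
  qed
  finally show ?thesis .
qed

text \<open>Off the diagonal, two triples through \<open>x\<close> have disjoint remainders of two points each, and
\<open>survival_Un_le\<close> with exponent \<open>4\<close> applies. On the diagonal, one of the two factors is bounded by
\<open>2 * \<mu>\<close>.\<close>

lemma second_moment:
  assumes x: "x \<in> X"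
  shows "E (\<lambda>S. (load' x S)\<^sup>2) \<le> (mean_load x)\<^sup>2 / \<beta> ^ 4 + 2 * \<mu> * mean_load x"
proof -
  define I where "I = {T\<in>\<H>. x \<in> T}"
  define a where "a T = w T * boost T" for T
  have a0: "0 \<le> a T" if "T \<in> I" for T using that wb_nonneg by (auto simp: a_def I_def)
  have finI: "finite I" using finite_\<H> by (simp add: I_def)
  have "(load' x S)\<^sup>2 = (\<Sum>T\<in>I. \<Sum>U\<in>I. a T * a U * of_bool (S \<inter> touch ((T - {x}) \<union> (U - {x})) = {}))" for S
    unfolding load'_def power2_eq_square sum_product touch_Un Int_Un_distrib I_def a_def
    by (intro sum.cong refl) auto
  then have "E (\<lambda>S. (load' x S)\<^sup>2)
      = (\<Sum>T\<in>I. \<Sum>U\<in>I. a T * a U * survival ((T - {x}) \<union> (U - {x})))"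
    by (simp add: mean_sum[OF finite_\<H> p_nonneg p_le_1] mean_mult[OF finite_\<H> p_nonneg p_le_1]
      mean_survives)
  also have "\<dots> \<le> (\<Sum>T\<in>I. \<Sum>U\<in>I. a T * survival (T - {x}) * (a U * survival (U - {x})) / \<beta> ^ 4
                    + (if U = T then a T * survival (T - {x}) * (2 * \<mu>) else 0))"
  proof (intro sum_mono)
    fix T U assume T: "T \<in> I" and U: "U \<in> I"
    have s0: "0 \<le> survival F" for F using survival_pos[of F] by simp
    have b4: "0 < \<beta> ^ 4" using \<beta> by simp
    show "a T * a U * survival ((T - {x}) \<union> (U - {x}))
        \<le> a T * survival (T - {x}) * (a U * survival (U - {x})) / \<beta> ^ 4
          + (if U = T then a T * survival (T - {x}) * (2 * \<mu>) else 0)"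
    proof (cases "U = T")
      case True
      have "a T \<le> \<mu> * 2" unfolding a_def using T w_le w_nonneg boost \<mu>
        by (intro mult_mono) (auto simp: I_def)
      then have "a T * survival (T - {x}) * a T \<le> a T * survival (T - {x}) * (2 * \<mu>)"
        using a0[OF T] s0 by (intro mult_left_mono) auto
      moreover have "0 \<le> a T * survival (T - {x}) * (a T * survival (T - {x})) / \<beta> ^ 4"
        using a0[OF T] s0 b4 by simp
      ultimately show ?thesis using True by (simp add: mult_ac)
    next
      case False
      have fin: "finite T" "finite U" using T U triple by (auto simp: I_def intro: card_ge_0_finite)
      have "card (T - {x}) = 2" "card (U - {x}) = 2" using T U triple by (auto simp: I_def)
      moreover have "(T - {x}) \<inter> (U - {x}) = {}"
        using T U False linear by (auto simp: I_def)
      ultimately have "survival ((T - {x}) \<union> (U - {x})) * \<beta> ^ 4 \<le> survival (T - {x}) * survival (U - {x})"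
        using fin by (intro survival_Un_le) auto
      then have "survival ((T - {x}) \<union> (U - {x})) \<le> survival (T - {x}) * survival (U - {x}) / \<beta> ^ 4"
        using b4 by (simp add: field_simps)
      then have "a T * a U * survival ((T - {x}) \<union> (U - {x}))
          \<le> a T * a U * (survival (T - {x}) * survival (U - {x}) / \<beta> ^ 4)"
        using a0[OF T] a0[OF U] by (intro mult_left_mono) auto
      then show ?thesis using False by (simp add: mult_ac)
    qed
  qed
  also have "\<dots> = (mean_load x)\<^sup>2 / \<beta> ^ 4 + 2 * \<mu> * mean_load x"
    using finI
    by (simp add: mean_load_def I_def[symmetric] a_def[symmetric] sum.distrib power2_eq_square
        sum_product sum_divide_distrib sum_distrib_left mult_ac)
  finally show ?thesis .
qed

text \<open>Chebyshev's inequality: mean and second moment of the new load show that its variance is at most \<open>6 * \<mu>\<close>.\<close>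

lemma overload_probability:
  assumes x: "x \<in> X"
  shows "E (\<lambda>S. of_bool (1 + \<xi> < load' x S)) \<le> 24 * \<mu> / \<xi>\<^sup>2"
proof -
  define m where "m = mean_load x"
  define t where "t = \<mu> / 2"
  have t: "0 \<le> t" "t \<le> 1/8" using \<mu> by (auto simp: t_def)
  have m: "0 \<le> m" "m \<le> 1 / \<beta>" "1 / \<beta> \<le> 1 + t"
    using mean_load_le[OF x] mean_load_nonneg[of x] \<beta>(3) by (auto simp: m_def t_def)
  have \<xi>0: "0 < \<xi>" using \<xi> \<mu> by linarith
  have "\<xi>\<^sup>2 / 4 * E (\<lambda>S. of_bool (1 + \<xi> < load' x S))
      = E (\<lambda>S. \<xi>\<^sup>2 / 4 * of_bool (1 + \<xi> < load' x S))"
    by (rule mean_mult[OF finite_\<H> p_nonneg p_le_1, symmetric])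
  also have "\<dots> \<le> E (\<lambda>S. (load' x S - m)\<^sup>2)"
  proof (rule mean_mono[OF finite_\<H> p_nonneg p_le_1])
    fix S
    show "\<xi>\<^sup>2 / 4 * of_bool (1 + \<xi> < load' x S) \<le> (load' x S - m)\<^sup>2"
    proof (cases "1 + \<xi> < load' x S")
      case True
      then have "\<xi> / 2 \<le> load' x S - m" using m \<xi> \<mu> by (simp add: t_def)
      then have "(\<xi> / 2)\<^sup>2 \<le> (load' x S - m)\<^sup>2" using \<xi>0 by (intro power_mono) auto
      then show ?thesis using True by (simp add: power_divide)
    qed simp
  qed
  also have "\<dots> = E (\<lambda>S. (load' x S)\<^sup>2 - 2 * m * load' x S + m\<^sup>2)"
    by (simp add: power2_eq_square algebra_simps)
  also have "\<dots> = E (\<lambda>S. (load' x S)\<^sup>2) - 2 * m * E (load' x) + m\<^sup>2"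
    by (simp only: mean_add[OF finite_\<H> p_nonneg p_le_1] mean_diff[OF finite_\<H> p_nonneg p_le_1]
       mean_mult[OF finite_\<H> p_nonneg p_le_1] mean_const[OF finite_\<H> p_nonneg p_le_1])
  also have "\<dots> = E (\<lambda>S. (load' x S)\<^sup>2) - m\<^sup>2"
    by (simp add: mean_load' m_def power2_eq_square)
  also have "\<dots> \<le> m\<^sup>2 / \<beta> ^ 4 + 2 * \<mu> * m - m\<^sup>2"
    using second_moment[OF x] by (simp add: m_def)
  also have "\<dots> = m\<^sup>2 * ((1 / \<beta>) ^ 4 - 1) + 2 * \<mu> * m"
    by (simp add: algebra_simps power_divide)
  also have "\<dots> \<le> 6 * \<mu>"
  proof -
    have "(1 / \<beta>) ^ 4 \<le> (1 + t) ^ 4" using m \<beta> by (intro power_mono) auto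
    also have "\<dots> = 1 + 4 * t + t * (6 * t + 4 * t * t + t * t * t)"
      by (simp add: eval_nat_numeral algebra_simps)
    also have "\<dots> \<le> 1 + 4 * t + t * 1"
    proof -
      have "t * t \<le> 1/8 * (1/8)" using t by (intro mult_mono) auto
      moreover have "t * t * t \<le> 1/8 * (1/8) * (1/8)" using t by (intro mult_mono) auto
      ultimately have "6 * t + 4 * t * t + t * t * t \<le> 1" using t by simp
      then show ?thesis using t by (intro add_left_mono mult_left_mono) auto
    qed
    finally have 1: "(1 / \<beta>) ^ 4 - 1 \<le> 5 * t" by simp
    have "m \<le> 9/8" using m t by linarith
    then have "m\<^sup>2 \<le> (9/8)\<^sup>2" using m by (intro power_mono) auto
    also have "(9/8 :: real)\<^sup>2 \<le> 13/10" by (simp add: power2_eq_square)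
    finally have "m\<^sup>2 * ((1 / \<beta>) ^ 4 - 1) \<le> 13/10 * (5 * t)"
      using 1 \<beta> by (intro mult_mono) (auto simp: power_le_one)
    moreover have "2 * \<mu> * m \<le> 2 * \<mu> * (9/8)" using \<open>m \<le> 9/8\<close> \<mu> by (intro mult_left_mono) auto
    ultimately show ?thesis using \<mu> unfolding t_def by linarith
  qed
  finally show ?thesis using \<xi>0 by (simp add: field_simps)
qed

text \<open>Triples at an overloaded vertex lose their weight altogether, and dividing by \<open>1 + \<xi>\<close> absorbs the
remaining small excess of the loads.\<close>

definition new_weight :: "'b set set \<Rightarrow> 'b set \<Rightarrow> real" where
  "new_weight S T = (if S \<inter> touch T = {} \<and> (\<forall>x\<in>T. load' x S \<le> 1 + \<xi>)
                     then w T * boost T / (1 + \<xi>) else 0)"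

definition isolated :: "'b set set \<Rightarrow> 'b set set" where
  "isolated S = {T\<in>S. S \<inter> (touch T - {T}) = {}}"

lemma \<xi>_pos: "0 < \<xi>" using \<xi> \<mu> by linarith

lemma touch_self: "T \<in> \<H> \<Longrightarrow> T \<in> touch T"
  using triple by (fastforce simp: touch_def)

lemma matching_isolated: "S \<subseteq> \<H> \<Longrightarrow> matching (isolated S)"
  unfolding matching_def pairwise_def isolated_def by (auto simp: touch_def) 

lemma new_weight_fractional_matching:
  assumes "S \<subseteq> \<H>"
  shows "fractional_matching (2 * \<mu>) (new_weight S)"
  unfolding fractional_matching_def
proof (intro conjI ballI)
  fix T assume T: "T \<in> \<H>"
  show "0 \<le> new_weight S T" using wb_nonneg[OF T] \<xi>_pos by (simp add: new_weight_def)
  have "w T * boost T \<le> \<mu> * 2" using T w_le w_nonneg boost \<mu> by (intro mult_mono) auto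
  moreover have "w T * boost T / (1 + \<xi>) \<le> w T * boost T"
    using wb_nonneg[OF T] \<xi>_pos by (simp add: field_simps)
  ultimately show "new_weight S T \<le> 2 * \<mu>" using \<mu> by (simp add: new_weight_def)
next
  fix x assume x: "x \<in> X"
  show "(\<Sum>T\<in>{T\<in>\<H>. x \<in> T}. new_weight S T) \<le> 1"
  proof (cases "load' x S \<le> 1 + \<xi>")
    case True
    have "(\<Sum>T\<in>{T\<in>\<H>. x \<in> T}. new_weight S T)
        \<le> (\<Sum>T\<in>{T\<in>\<H>. x \<in> T}. w T * boost T * of_bool (S \<inter> touch (T - {x}) = {}) / (1 + \<xi>))"
    proof (rule sum_mono)
      fix T assume T: "T \<in> {T\<in>\<H>. x \<in> T}"
      have "S \<inter> touch (T - {x}) \<subseteq> S \<inter> touch T" using touch_mono[of "T - {x}" T] by auto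
      then show "new_weight S T \<le> w T * boost T * of_bool (S \<inter> touch (T - {x}) = {}) / (1 + \<xi>)"
        using wb_nonneg[of T] T \<xi>_pos by (auto simp: new_weight_def)
    qed
    also have "\<dots> = load' x S / (1 + \<xi>)" by (simp add: load'_def sum_divide_distrib)
    also have "\<dots> \<le> 1" using True \<xi>_pos by simp
    finally show ?thesis .
  next
    case False
    then have "(\<Sum>T\<in>{T\<in>\<H>. x \<in> T}. new_weight S T) = 0"
      by (intro sum.neutral) (auto simp: new_weight_def)
    then show ?thesis by simp
  qed
qed

lemma new_weight_disjoint:
  assumes "S \<subseteq> \<H>" "T \<in> \<H>" "T \<inter> \<Union>(isolated S) \<noteq> {}"
  shows "new_weight S T = 0"
proof -
  obtain U where "U \<in> S" "T \<inter> U \<noteq> {}" using assms(3) by (auto simp: isolated_def)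
  then have "S \<inter> touch T \<noteq> {}" using assms(1) by (auto simp: touch_def)
  then show ?thesis by (auto simp: new_weight_def)
qed

text \<open>A selected triple is isolated with probability at least \<open>(1 - \<theta>) ^ 3\<close>, as this is a lower bound for the
survival probability of its three vertices.\<close>

lemma mean_isolated:
  "\<theta> * (1 - 3 * \<theta>) * (\<Sum>T\<in>\<H>. w T) \<le> E (\<lambda>S. real (card (isolated S)))"
proof -
  have cube: "1 - 3 * \<theta> \<le> (1 - \<theta>) ^ 3"
  proof -
    have "\<theta> * \<theta> * \<theta> \<le> 3 * (\<theta> * \<theta>)" using \<theta> by (simp add: mult_right_mono)
    then show ?thesis by (simp add: power3_eq_cube algebra_simps)
  qed
  have "\<theta> * (1 - 3 * \<theta>) * (\<Sum>T\<in>\<H>. w T) = (\<Sum>T\<in>\<H>. p T * (1 - 3 * \<theta>))"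
    by (simp add: p_def sum_distrib_left sum_distrib_right mult_ac)
  also have "\<dots> \<le> (\<Sum>T\<in>\<H>. p T * (\<Prod>U\<in>touch T - {T}. 1 - p U))"
  proof (intro sum_mono mult_left_mono)
    fix T assume T: "T \<in> \<H>"
    have "1 - 3 * \<theta> \<le> survival T"
      using cube prod_survival(1)[OF T] survival_triple_ge[OF T] by linarith
    also have "survival T = (1 - p T) * (\<Prod>U\<in>touch T - {T}. 1 - p U)"
      unfolding survival_def by (rule prod.remove[OF finite_touch touch_self[OF T]])
    also have "\<dots> \<le> 1 * (\<Prod>U\<in>touch T - {T}. 1 - p U)"
      using p_nonneg p_le_1 touch_sub T by (intro mult_right_mono prod_nonneg) force+
    finally show "1 - 3 * \<theta> \<le> (\<Prod>U\<in>touch T - {T}. 1 - p U)" by simp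
  qed (rule p_nonneg)
  also have "\<dots> = (\<Sum>T\<in>\<H>. E (\<lambda>S. of_bool (T \<in> S \<and> S \<inter> (touch T - {T}) = {})))"
    using touch_sub
    by (intro sum.cong refl mean_hit_avoid[OF finite_\<H> p_nonneg p_le_1, symmetric]) auto
  also have "\<dots> = E (\<lambda>S. \<Sum>T\<in>\<H>. of_bool (T \<in> S \<and> S \<inter> (touch T - {T}) = {}))"
    by (rule mean_sum[OF finite_\<H> p_nonneg p_le_1, symmetric])
  also have "\<dots> \<le> E (\<lambda>S. real (card (isolated S)))"
  proof (rule mean_mono[OF finite_\<H> p_nonneg p_le_1])
    fix S assume "S \<subseteq> \<H>"
    then have "isolated S = {T\<in>\<H>. T \<in> S \<and> S \<inter> (touch T - {T}) = {}}" by (auto simp: isolated_def)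
    then show "(\<Sum>T\<in>\<H>. of_bool (T \<in> S \<and> S \<inter> (touch T - {T}) = {})) \<le> real (card (isolated S))"
      using finite_\<H> by (simp add: of_bool_def sum.inter_filter[symmetric])
  qed
  finally show ?thesis .
qed

text \<open>The weight lost to overloaded vertices is at most twice their number, whose expectation is bounded
by \<open>overload_probability\<close>.\<close>

lemma mean_new_weight:
  "(1 - \<theta>) * (\<Sum>T\<in>\<H>. w T) - (\<xi> + 48 * \<mu> / \<xi>\<^sup>2) * real (card X)
     \<le> E (\<lambda>S. \<Sum>T\<in>\<H>. new_weight S T)"
proof -
  define W where "W = (\<Sum>T\<in>\<H>. w T)"
  have W: "0 \<le> W" "W \<le> real (card X)"
    using w_nonneg total_weight_le[OF w] by (auto simp: W_def intro: sum_nonneg)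
  have "(1 - \<theta>) * W = (\<Sum>T\<in>\<H>. w T * (1 - \<theta>))" by (simp add: W_def sum_distrib_left mult_ac)
  also have "\<dots> \<le> (\<Sum>T\<in>\<H>. w T * (boost T * survival T))"
  proof (intro sum_mono mult_left_mono w_nonneg)
    fix T assume T: "T \<in> \<H>"
    have "(1 - \<theta>) * (\<Prod>x\<in>T. survival {x}) \<le> (1 - \<theta>) * survival T"
      using survival_triple_ge[OF T] \<theta> by (intro mult_left_mono) auto
    then show "1 - \<theta> \<le> boost T * survival T"
      unfolding boost_def using prod_survival(2)[OF T] by (simp add: field_simps)
  qed
  finally have s: "(1 - \<theta>) * W \<le> (\<Sum>T\<in>\<H>. w T * (boost T * survival T))" .
  have "1 - \<xi> \<le> 1 / (1 + \<xi>)"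
    using \<xi>_pos by (simp add: field_simps)
  then have "(1 - \<theta>) * W * (1 - \<xi>) \<le> (1 - \<theta>) * W * (1 / (1 + \<xi>))"
    using W \<theta> by (intro mult_left_mono) auto
  also have "\<dots> \<le> (\<Sum>T\<in>\<H>. w T * (boost T * survival T)) * (1 / (1 + \<xi>))"
    using s \<xi>_pos by (intro mult_right_mono) auto
  finally have s2: "(1 - \<theta>) * W * (1 - \<xi>) \<le> (\<Sum>T\<in>\<H>. w T * boost T / (1 + \<xi>) * survival T)"
    by (simp add: sum_distrib_right sum_divide_distrib mult_ac)
  have "(1 - \<theta>) * W * \<xi> \<le> 1 * real (card X) * \<xi>"
    using W \<theta> \<xi>_pos by (intro mult_mono) auto
  with s2 have s3: "(1 - \<theta>) * W - \<xi> * real (card X) \<le> (\<Sum>T\<in>\<H>. w T * boost T / (1 + \<xi>) * survival T)"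
    by (simp add: algebra_simps)
  have "(\<Sum>x\<in>X. E (\<lambda>S. of_bool (1 + \<xi> < load' x S))) \<le> (\<Sum>x\<in>X. 24 * \<mu> / \<xi>\<^sup>2)"
    by (intro sum_mono overload_probability)
  then have "2 * (\<Sum>x\<in>X. E (\<lambda>S. of_bool (1 + \<xi> < load' x S))) \<le> 2 * (\<Sum>x\<in>X. 24 * \<mu> / \<xi>\<^sup>2)"
    by linarith
  also have "\<dots> = 48 * \<mu> / \<xi>\<^sup>2 * real (card X)" by simp
  finally have s4: "2 * (\<Sum>x\<in>X. E (\<lambda>S. of_bool (1 + \<xi> < load' x S))) \<le> 48 * \<mu> / \<xi>\<^sup>2 * real (card X)" .
  have "(\<Sum>T\<in>\<H>. w T * boost T / (1 + \<xi>) * survival T) - 2 * (\<Sum>x\<in>X. E (\<lambda>S. of_bool (1 + \<xi> < load' x S)))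
      = E (\<lambda>S. (\<Sum>T\<in>\<H>. w T * boost T / (1 + \<xi>) * of_bool (S \<inter> touch T = {}))
               - 2 * (\<Sum>x\<in>X. of_bool (1 + \<xi> < load' x S)))"
    by (simp only: mean_diff[OF finite_\<H> p_nonneg p_le_1] mean_sum[OF finite_\<H> p_nonneg p_le_1]
       mean_mult[OF finite_\<H> p_nonneg p_le_1] mean_survives)
  also have "\<dots> \<le> E (\<lambda>S. \<Sum>T\<in>\<H>. new_weight S T)"
  proof (rule mean_mono[OF finite_\<H> p_nonneg p_le_1])
    fix S
    define c where "c T = w T * boost T / (1 + \<xi>)" for T
    have c: "0 \<le> c T" "c T \<le> w T * boost T" if "T \<in> \<H>" for T
      using wb_nonneg[OF that] \<xi>_pos by (auto simp: c_def field_simps)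
    have "(\<Sum>T\<in>\<H>. c T * of_bool (S \<inter> touch T = {})) - (\<Sum>T\<in>\<H>. new_weight S T)
        = (\<Sum>T\<in>\<H>. c T * of_bool (S \<inter> touch T = {}) - new_weight S T)"
      by (simp add: sum_subtractf)
    also have "\<dots> \<le> (\<Sum>T\<in>\<H>. \<Sum>x\<in>T. c T * of_bool (1 + \<xi> < load' x S))"
    proof (rule sum_mono)
      fix T assume T: "T \<in> \<H>"
      have fT: "finite T" using T triple by (auto intro: card_ge_0_finite)
      show "c T * of_bool (S \<inter> touch T = {}) - new_weight S T
          \<le> (\<Sum>x\<in>T. c T * of_bool (1 + \<xi> < load' x S))"
      proof (cases "S \<inter> touch T = {} \<and> (\<exists>x\<in>T. 1 + \<xi> < load' x S)")
        case True
        then obtain x where x: "x \<in> T" "1 + \<xi> < load' x S" by auto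
        have "c T * of_bool (1 + \<xi> < load' x S) \<le> (\<Sum>x\<in>T. c T * of_bool (1 + \<xi> < load' x S))"
          using x fT c[OF T] by (intro member_le_sum) auto
        moreover have "new_weight S T = 0" using x by (auto simp: new_weight_def not_le)
        ultimately show ?thesis using True x by simp
      next
        case False
        then have "c T * of_bool (S \<inter> touch T = {}) = new_weight S T"
          by (auto simp: new_weight_def c_def not_less)
        then show ?thesis using c[OF T] by (auto intro: sum_nonneg)
      qed
    qed
    also have "\<dots> = (\<Sum>x\<in>X. \<Sum>T\<in>{T\<in>\<H>. x \<in> T}. c T * of_bool (1 + \<xi> < load' x S))"
      by (rule sum_triples[symmetric])
    also have "\<dots> \<le> (\<Sum>x\<in>X. 2 * of_bool (1 + \<xi> < load' x S))"
    proof (rule sum_mono)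
      fix x assume x: "x \<in> X"
      have "(\<Sum>T\<in>{T\<in>\<H>. x \<in> T}. c T) \<le> (\<Sum>T\<in>{T\<in>\<H>. x \<in> T}. w T * boost T)"
        using c by (intro sum_mono) auto
      also note boosted_load_le_2[OF x]
      finally show "(\<Sum>T\<in>{T\<in>\<H>. x \<in> T}. c T * of_bool (1 + \<xi> < load' x S))
          \<le> 2 * of_bool (1 + \<xi> < load' x S)"
        by (simp add: of_bool_def)
    qed
    finally show "(\<Sum>T\<in>\<H>. w T * boost T / (1 + \<xi>) * of_bool (S \<inter> touch T = {}))
               - 2 * (\<Sum>x\<in>X. of_bool (1 + \<xi> < load' x S)) \<le> (\<Sum>T\<in>\<H>. new_weight S T)"
      by (simp add: c_def sum_distrib_left)
  qed
  finally show ?thesis using s3 s4 by (simp add: W_def algebra_simps)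
qed

lemma nibble_step:
  assumes c: "0 \<le> c" "c \<le> 1"
  shows "\<exists>S\<subseteq>\<H>. (\<theta> * (1 - 3 * \<theta>) + c * (1 - \<theta>)) * (\<Sum>T\<in>\<H>. w T)
                  - (\<xi> + 48 * \<mu> / \<xi>\<^sup>2) * real (card X)
                \<le> real (card (isolated S)) + c * (\<Sum>T\<in>\<H>. new_weight S T)"
proof -
  define e where "e = (\<xi> + 48 * \<mu> / \<xi>\<^sup>2) * real (card X)"
  define W where "W = (\<Sum>T\<in>\<H>. w T)"
  have "0 \<le> e" using \<xi>_pos \<mu> by (simp add: e_def)
  then have "c * e \<le> e" using c by (simp add: mult_left_le_one_le)
  moreover have "c * ((1 - \<theta>) * W - e) \<le> c * E (\<lambda>S. \<Sum>T\<in>\<H>. new_weight S T)"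
    using mean_new_weight c unfolding e_def W_def by (intro mult_left_mono)
  ultimately have "(\<theta> * (1 - 3 * \<theta>) + c * (1 - \<theta>)) * W - e
      \<le> E (\<lambda>S. real (card (isolated S))) + c * E (\<lambda>S. \<Sum>T\<in>\<H>. new_weight S T)"
    using mean_isolated by (simp add: W_def algebra_simps)
  also have "\<dots> = E (\<lambda>S. real (card (isolated S)) + c * (\<Sum>T\<in>\<H>. new_weight S T))"
    by (simp only: mean_add[OF finite_\<H> p_nonneg p_le_1] mean_mult[OF finite_\<H> p_nonneg p_le_1])
  finally have mean: "(\<theta> * (1 - 3 * \<theta>) + c * (1 - \<theta>)) * W - e
      \<le> E (\<lambda>S. real (card (isolated S)) + c * (\<Sum>T\<in>\<H>. new_weight S T))" .
  have "\<exists>S\<subseteq>\<H>. E (\<lambda>S. real (card (isolated S)) + c * (\<Sum>T\<in>\<H>. new_weight S T))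
      \<le> real (card (isolated S)) + c * (\<Sum>T\<in>\<H>. new_weight S T)"
    by (rule mean_attained) (auto intro: finite_\<H> p_nonneg p_le_1)
  then obtain S where "S \<subseteq> \<H>" and S: "E (\<lambda>S. real (card (isolated S)) + c * (\<Sum>T\<in>\<H>. new_weight S T))
      \<le> real (card (isolated S)) + c * (\<Sum>T\<in>\<H>. new_weight S T)"
    by (elim exE conjE)
  show ?thesis
    using order_trans[OF mean S] \<open>S \<subseteq> \<H>\<close> unfolding e_def W_def by (intro exI[of _ S] conjI)
qed

end

text \<open>If \<open>c\<close> is the fraction of the weight that \<open>r\<close> further rounds are guaranteed to convert into triples, then
one more round in front guarantees \<open>\<theta> * (1 - 3 * \<theta>) + c * (1 - \<theta>)\<close>, and the coefficients in the
statement solve this recursion. The bound for the weights at most doubles in each round.\<close>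

lemma iterated_nibble:
  assumes \<theta>: "0 < \<theta>" "\<theta> \<le> 1/4"
  shows "\<forall>\<eta>>0. \<exists>\<mu>0>0. \<forall>X (\<H> :: 'b set set) w. linear_triple_system X \<H> \<longrightarrow>
           linear_triple_system.fractional_matching X \<H> \<mu>0 w \<longrightarrow>
           (\<exists>M. linear_triple_system.matching \<H> M \<and>
                (1 - 3 * \<theta>) * (1 - (1 - \<theta>) ^ r) * (\<Sum>T\<in>\<H>. w T) - \<eta> * real (card X) \<le> real (card M))"
proof (induction r)
  case 0
  show ?case
  proof (intro allI impI exI[of _ 1] conjI)
    fix \<eta> :: real and X and \<H> :: "'b set set" and w
    assume "0 < \<eta>" "linear_triple_system X \<H>"
    then show "\<exists>M. linear_triple_system.matching \<H> M \<and>
        (1 - 3 * \<theta>) * (1 - (1 - \<theta>) ^ 0) * (\<Sum>T\<in>\<H>. w T) - \<eta> * real (card X) \<le> real (card M)"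
      by (intro exI[of _ "{}"]) (auto simp: linear_triple_system.matching_def)
  qed simp
next
  case (Suc r)
  show ?case
  proof (intro allI impI)
    fix \<eta> :: real assume \<eta>: "0 < \<eta>"
    obtain \<mu>1 where \<mu>1: "0 < \<mu>1" and IH: "\<And>X (\<H> :: 'b set set) w. linear_triple_system X \<H> \<Longrightarrow>
           linear_triple_system.fractional_matching X \<H> \<mu>1 w \<Longrightarrow>
           (\<exists>M. linear_triple_system.matching \<H> M \<and>
                (1 - 3 * \<theta>) * (1 - (1 - \<theta>) ^ r) * (\<Sum>T\<in>\<H>. w T) - \<eta> / 2 * real (card X) \<le> real (card M))"
      using Suc[THEN spec, THEN mp, OF half_gt_zero[OF \<eta>]] by blast
    define \<xi> where "\<xi> = \<eta> / 4"
    (* Small enough for the remaining rounds after doubling, and for the error of this round to be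
       at most \<eta> / 2. *)
    define \<mu> where "\<mu> = min (min (1/4) (\<mu>1 / 2)) (min (\<xi> / 2) (\<xi>\<^sup>2 * \<xi> / 48))"
    have \<xi>: "0 < \<xi>" using \<eta> by (simp add: \<xi>_def)
    have "0 < \<mu>" using \<mu>1 \<xi> by (simp add: \<mu>_def)
    moreover have "\<mu> \<le> 1/4" "\<mu> \<le> \<mu>1 / 2" "\<mu> \<le> \<xi> / 2" "\<mu> \<le> \<xi>\<^sup>2 * \<xi> / 48"
      unfolding \<mu>_def by (simp_all only: min.coboundedI1 min.coboundedI2 order_refl)
    ultimately have mu: "0 < \<mu>" "\<mu> \<le> 1/4" "2 * \<mu> \<le> \<mu>1" "2 * \<mu> \<le> \<xi>" "\<mu> \<le> \<xi>\<^sup>2 * \<xi> / 48"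
      by auto
    have err: "\<xi> + 48 * \<mu> / \<xi>\<^sup>2 \<le> \<eta> / 2"
    proof -
      have "48 * \<mu> / \<xi>\<^sup>2 \<le> \<xi>" using mu(5) \<xi> by (simp add: field_simps)
      then show ?thesis by (simp add: \<xi>_def)
    qed
    define c where "c = (1 - 3 * \<theta>) * (1 - (1 - \<theta>) ^ r)"
    have c: "0 \<le> c" "c \<le> 1"
      using \<theta> by (auto simp: c_def power_le_one intro!: mult_nonneg_nonneg mult_le_one)
    show "\<exists>\<mu>0>0. \<forall>X (\<H> :: 'b set set) w. linear_triple_system X \<H> \<longrightarrow>
           linear_triple_system.fractional_matching X \<H> \<mu>0 w \<longrightarrow>
           (\<exists>M. linear_triple_system.matching \<H> M \<and>
                (1 - 3 * \<theta>) * (1 - (1 - \<theta>) ^ Suc r) * (\<Sum>T\<in>\<H>. w T) - \<eta> * real (card X) \<le> real (card M))"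
    proof (intro exI[of _ \<mu>] conjI allI impI)
      fix X and \<H> :: "'b set set" and w
      assume lin: "linear_triple_system X \<H>" and fm: "linear_triple_system.fractional_matching X \<H> \<mu> w"
      interpret nibble X \<H> w \<mu> \<theta> \<xi>
        using lin fm \<theta> mu by (simp add: nibble_def nibble_axioms_def)
      obtain S where S: "S \<subseteq> \<H>" and gain: "(\<theta> * (1 - 3 * \<theta>) + c * (1 - \<theta>)) * (\<Sum>T\<in>\<H>. w T)
                  - (\<xi> + 48 * \<mu> / \<xi>\<^sup>2) * real (card X)
                \<le> real (card (isolated S)) + c * (\<Sum>T\<in>\<H>. new_weight S T)"
        using nibble_step[OF c] by blast
      define \<H>' where "\<H>' = {T\<in>\<H>. T \<inter> \<Union>(isolated S) = {}}"
      have sub: "\<H>' \<subseteq> \<H>" by (auto simp: \<H>'_def)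
      have lin': "linear_triple_system X \<H>'"
        using finite_X triple linear by unfold_locales (auto simp: \<H>'_def)
      have fm': "linear_triple_system.fractional_matching X \<H>' \<mu>1 (new_weight S)"
        unfolding linear_triple_system.fractional_matching_def[OF lin']
      proof (intro conjI ballI)
        note nw = new_weight_fractional_matching[OF S, unfolded fractional_matching_def]
        fix T assume "T \<in> \<H>'"
        then show "0 \<le> new_weight S T" "new_weight S T \<le> \<mu>1" using nw sub mu(3) by force+
      next
        note nw = new_weight_fractional_matching[OF S, unfolded fractional_matching_def]
        fix x assume "x \<in> X"
        have "(\<Sum>T\<in>{T\<in>\<H>'. x \<in> T}. new_weight S T) \<le> (\<Sum>T\<in>{T\<in>\<H>. x \<in> T}. new_weight S T)"
          using nw finite_\<H> by (intro sum_mono2) (auto simp: \<H>'_def)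
        also have "\<dots> \<le> 1" using nw \<open>x \<in> X\<close> by simp
        finally show "(\<Sum>T\<in>{T\<in>\<H>'. x \<in> T}. new_weight S T) \<le> 1" .
      qed
      obtain M where M: "linear_triple_system.matching \<H>' M"
        and Mc: "c * (\<Sum>T\<in>\<H>'. new_weight S T) - \<eta> / 2 * real (card X) \<le> real (card M)"
        using IH[OF lin' fm'] unfolding c_def by blast
      have M': "M \<subseteq> \<H>'" "pairwise (\<lambda>T U. T \<inter> U = {}) M"
        using M by (auto simp: linear_triple_system.matching_def[OF lin'])
      have I: "isolated S \<subseteq> \<H>" "pairwise (\<lambda>T U. T \<inter> U = {}) (isolated S)"
        using matching_isolated[OF S] by (auto simp: matching_def)
      have cross: "T \<inter> U = {}" if "T \<in> M" "U \<in> isolated S" for T U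
        using that M'(1) by (auto simp: \<H>'_def)
      have "matching (isolated S \<union> M)"
        unfolding matching_def
      proof
        show "isolated S \<union> M \<subseteq> \<H>" using I M' sub by auto
        show "pairwise (\<lambda>T U. T \<inter> U = {}) (isolated S \<union> M)"
          unfolding pairwise_def
        proof (intro ballI impI)
          fix T U assume "T \<in> isolated S \<union> M" "U \<in> isolated S \<union> M" "T \<noteq> U"
          then consider "T \<in> isolated S" "U \<in> isolated S" | "T \<in> M" "U \<in> M"
            | "T \<in> M" "U \<in> isolated S" | "U \<in> M" "T \<in> isolated S" by blast
          then show "T \<inter> U = {}"
            using cross I(2) M'(2) \<open>T \<noteq> U\<close> by cases (auto simp: pairwise_def)
        qed
      qed
      moreover have cardU: "card (isolated S \<union> M) = card (isolated S) + card M"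
      proof (rule card_Un_disjoint)
        show "finite (isolated S)" "finite M"
          using I(1) M'(1) sub finite_\<H> by (meson finite_subset)+
        show "isolated S \<inter> M = {}"
        proof (rule ccontr)
          assume "isolated S \<inter> M \<noteq> {}"
          then obtain T where "T \<in> isolated S" "T \<in> M" by blast
          then have "T = {}" "T \<in> \<H>" using cross[of T T] I by auto
          then show False using triple_nonempty by blast
        qed
      qed
      moreover have sum': "(\<Sum>T\<in>\<H>'. new_weight S T) = (\<Sum>T\<in>\<H>. new_weight S T)"
        by (rule sum.mono_neutral_left[OF finite_\<H> sub])
          (auto simp: \<H>'_def intro!: new_weight_disjoint[OF S])
      moreover have "(1 - 3 * \<theta>) * (1 - (1 - \<theta>) ^ Suc r) * (\<Sum>T\<in>\<H>. w T) - \<eta> * real (card X)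
          \<le> real (card (isolated S \<union> M))"
      proof -
        have coeff: "(1 - 3 * \<theta>) * (1 - (1 - \<theta>) ^ Suc r) = \<theta> * (1 - 3 * \<theta>) + c * (1 - \<theta>)"
          by (simp add: c_def algebra_simps)
        have "(\<xi> + 48 * \<mu> / \<xi>\<^sup>2) * real (card X) \<le> \<eta> / 2 * real (card X)"
          using err by (intro mult_right_mono) auto
        then show ?thesis using gain Mc[unfolded sum'] unfolding coeff cardU of_nat_add by linarith
      qed
      ultimately show "\<exists>M. matching M \<and>
          (1 - 3 * \<theta>) * (1 - (1 - \<theta>) ^ Suc r) * (\<Sum>T\<in>\<H>. w T) - \<eta> * real (card X) \<le> real (card M)"
        by blast
    qed (rule mu)
  qed
qed

theorem spread_fractional_matching_rounding:
  assumes "0 < \<eta>"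
  shows "\<exists>\<mu>0>0. \<forall>X (\<H> :: 'b set set) w. linear_triple_system X \<H> \<longrightarrow>
           linear_triple_system.fractional_matching X \<H> \<mu>0 w \<longrightarrow>
           (\<exists>M. linear_triple_system.matching \<H> M \<and>
                (\<Sum>T\<in>\<H>. w T) - \<eta> * real (card X) \<le> real (card M))"
proof -
  define \<theta> where "\<theta> = min (1/4) (\<eta> / 9)"
  have \<theta>: "0 < \<theta>" "\<theta> \<le> 1/4" "3 * \<theta> \<le> \<eta> / 3" using assms by (auto simp: \<theta>_def)
  obtain r where r: "(1 - \<theta>) ^ r < \<eta> / 3"
    using real_arch_pow_inv[of "\<eta> / 3" "1 - \<theta>"] \<theta> assms by auto
  have \<eta>3: "0 < \<eta> / 3" using assms by simp
  obtain \<mu>0 where "0 < \<mu>0" and \<mu>0: "\<And>X (\<H> :: 'b set set) w. linear_triple_system X \<H> \<Longrightarrow>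
           linear_triple_system.fractional_matching X \<H> \<mu>0 w \<Longrightarrow>
           (\<exists>M. linear_triple_system.matching \<H> M \<and>
                (1 - 3 * \<theta>) * (1 - (1 - \<theta>) ^ r) * (\<Sum>T\<in>\<H>. w T) - \<eta> / 3 * real (card X) \<le> real (card M))"
    using iterated_nibble[OF \<theta>(1,2), of r, THEN spec, THEN mp, OF \<eta>3] by blast
  have "\<exists>M. linear_triple_system.matching \<H> M \<and> (\<Sum>T\<in>\<H>. w T) - \<eta> * real (card X) \<le> real (card M)"
    if lin: "linear_triple_system X \<H>" and fm: "linear_triple_system.fractional_matching X \<H> \<mu>0 w"
    for X and \<H> :: "'b set set" and w
  proof -
    interpret linear_triple_system X \<H> by fact
    define W where "W = (\<Sum>T\<in>\<H>. w T)"
    have W: "0 \<le> W" "W \<le> real (card X)"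
      using total_weight_le[OF fm] fm by (auto simp: W_def fractional_matching_def intro: sum_nonneg)
    obtain M where "matching M"
      and M: "(1 - 3 * \<theta>) * (1 - (1 - \<theta>) ^ r) * W - \<eta> / 3 * real (card X) \<le> real (card M)"
      using \<mu>0[OF lin fm] unfolding W_def by blast
    have "0 \<le> 3 * \<theta> * (1 - \<theta>) ^ r" using \<theta> by simp
    then have "1 - 2 * (\<eta> / 3) \<le> (1 - 3 * \<theta>) * (1 - (1 - \<theta>) ^ r)"
      using r \<theta>(3) by (simp add: algebra_simps)
    then have "(1 - 2 * (\<eta> / 3)) * W \<le> (1 - 3 * \<theta>) * (1 - (1 - \<theta>) ^ r) * W"
      using W by (intro mult_right_mono)
    moreover have "2 * (\<eta> / 3) * W \<le> 2 * (\<eta> / 3) * real (card X)"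
      using W assms by (intro mult_left_mono) auto
    ultimately have "W - \<eta> * real (card X) \<le> real (card M)"
      using M by (simp add: algebra_simps)
    with \<open>matching M\<close> show ?thesis unfolding W_def by blast
  qed
  then show ?thesis using \<open>0 < \<mu>0\<close> by blast
qed

section \<open>Triangle packings from samples\<close>

definition nonadj :: "'a set \<Rightarrow> 'a set set \<Rightarrow> 'a \<Rightarrow> 'a \<Rightarrow> bool" where
  "nonadj V E x y \<longleftrightarrow> {x, y} \<in> compl_edges V E"

text \<open>The triangles inside \<open>U\<close>, each given as the set of its three edges: in this form edge-disjoint
triangles are disjoint triples.\<close>

definition edge_triples :: "'a set \<Rightarrow> 'a set set \<Rightarrow> 'a set \<Rightarrow> 'a set set set" where
  "edge_triples V E U = pairs_of ` {T. T \<subseteq> U \<and> triangle V E T}"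

lemma doubleton_in_pairs_of: "{x, y} \<in> pairs_of V \<longleftrightarrow> x \<in> V \<and> y \<in> V \<and> x \<noteq> y"
  by (auto simp: pairs_of_def card_insert_if)

lemma in_pairs_ofE:
  assumes "e \<in> pairs_of V"
  obtains x y where "e = {x, y}" "x \<in> V" "y \<in> V" "x \<noteq> y"
proof -
  from assms obtain x y where xy: "e = {x, y}" by (auto simp: pairs_of_def card_2_iff)
  with assms that[of x y] show thesis by (auto simp: doubleton_in_pairs_of)
qed

lemma pairs_of_triple:
  assumes "x \<noteq> y" "y \<noteq> z" "x \<noteq> z"
  shows "pairs_of {x, y, z} = {{x, y}, {y, z}, {x, z}}"
proof
  show "pairs_of {x, y, z} \<subseteq> {{x, y}, {y, z}, {x, z}}"
    by (auto elim!: in_pairs_ofE)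
qed (use assms in \<open>auto simp: doubleton_in_pairs_of\<close>)

lemma triangleE:
  assumes "triangle V E T"
  obtains x y z where "T = {x, y, z}" "x \<noteq> y" "y \<noteq> z" "x \<noteq> z" "x \<in> V" "y \<in> V" "z \<in> V"
    "pairs_of T = {{x, y}, {y, z}, {x, z}}" "{x, y} \<in> E" "{y, z} \<in> E" "{x, z} \<in> E"
proof -
  obtain x y z where T: "T = {x, y, z}" "x \<noteq> y" "y \<noteq> z" "x \<noteq> z"
    using assms unfolding triangle_def card_3_iff by blast
  then have "pairs_of T = {{x, y}, {y, z}, {x, z}}" using pairs_of_triple by simp
  then show thesis using T assms by (intro that[of x y z]) (auto simp: triangle_def)
qed

lemma Union_pairs_of_triangle: "triangle V E T \<Longrightarrow> \<Union>(pairs_of T) = T"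
  by (erule triangleE) auto

lemma card_pairs_of_triangle: "triangle V E T \<Longrightarrow> card (pairs_of T) = 3"
  by (erule triangleE) (auto simp: doubleton_eq_iff)

lemma inj_on_pairs_of_triangle: "inj_on pairs_of {T. triangle V E T}"
  by (rule inj_onI) (metis Union_pairs_of_triangle mem_Collect_eq)

lemma triangle_relation_nonadj:
  assumes "co_triangle_free V E"
  shows "triangle_free_relation (nonadj V E)"
proof
  show "nonadj V E y x" if "nonadj V E x y" for x y
    using that by (simp add: nonadj_def insert_commute)
  show "\<not> nonadj V E x x" for x
    by (simp add: nonadj_def compl_edges_def pairs_of_def)
  show "\<not> nonadj V E x z" if xy: "nonadj V E x y" and yz: "nonadj V E y z" for x y z
  proof
    assume xz: "nonadj V E x z"
    have ne: "x \<noteq> y" "y \<noteq> z" "x \<noteq> z" and inV: "x \<in> V" "y \<in> V" "z \<in> V"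
      using xy yz xz by (auto simp: nonadj_def compl_edges_def doubleton_in_pairs_of)
    have "triangle V (compl_edges V E) {x, y, z}"
      unfolding triangle_def pairs_of_triple[OF ne]
      using xy yz xz ne inV by (auto simp: nonadj_def)
    then show False using assms by (auto simp: co_triangle_free_def triangle_free_def)
  qed
qed

lemma not_nonadj: "x \<in> V \<Longrightarrow> y \<in> V \<Longrightarrow> x \<noteq> y \<Longrightarrow> \<not> nonadj V E x y \<Longrightarrow> {x, y} \<in> E"
  by (auto simp: nonadj_def compl_edges_def doubleton_in_pairs_of)

lemma edge_not_nonadj: "{x, y} \<in> E \<Longrightarrow> \<not> nonadj V E x y"
  by (auto simp: nonadj_def compl_edges_def)

lemma finite_edges: "simple_graph V E \<Longrightarrow> finite E"
  by (rule finite_subset[of _ "Pow V"]) (auto simp: simple_graph_def pairs_of_def)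

lemma finite_edge_triples: "finite U \<Longrightarrow> finite (edge_triples V E U)"
  unfolding edge_triples_def by (rule finite_imageI, rule finite_subset[of _ "Pow U"]) auto

lemma edge_triples_mono: "U \<subseteq> W \<Longrightarrow> edge_triples V E U \<subseteq> edge_triples V E W"
  by (auto simp: edge_triples_def)

lemma linear_triple_system_triangles:
  assumes "simple_graph V E"
  shows "linear_triple_system E (edge_triples V E V)"
proof
  show "finite E" using assms by (rule finite_edges)
  show "t \<subseteq> E \<and> card t = 3" if "t \<in> edge_triples V E V" for t
    using that card_pairs_of_triangle by (auto simp: edge_triples_def triangle_def)
  show "t = u" if tu: "t \<in> edge_triples V E V" "u \<in> edge_triples V E V"
    and ef: "e \<in> t" "f \<in> t" "e \<in> u" "f \<in> u" "e \<noteq> f" for t u e f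
  proof -
    obtain T where T: "triangle V E T" "t = pairs_of T" using tu(1) by (auto simp: edge_triples_def)
    obtain U where U: "triangle V E U" "u = pairs_of U" using tu(2) by (auto simp: edge_triples_def)
    have eq: "W = e \<union> f" if W: "triangle V E W" "e \<in> pairs_of W" "f \<in> pairs_of W" for W
      using W(1)
    proof (rule triangleE)
      fix x y z assume "W = {x, y, z}" "pairs_of W = {{x, y}, {y, z}, {x, z}}"
      then show "W = e \<union> f" using W(2,3) \<open>e \<noteq> f\<close> by auto
    qed
    have "T = U" using eq[OF T(1)] eq[OF U(1)] ef T(2) U(2) by simp
    then show ?thesis using T U by simp
  qed
qed

lemma sum_ordered_pairs_le:
  fixes g :: "'a set \<Rightarrow> real"
  assumes "finite U" "\<And>e. 0 \<le> g e"
  shows "(\<Sum>x\<in>U. \<Sum>y\<in>U. if x \<noteq> y \<and> {x, y} \<in> E then g {x, y} else 0) \<le> 2 * (\<Sum>e\<in>E \<inter> pairs_of U. g e)"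
proof -
  define Q where "Q = {q\<in>U \<times> U. fst q \<noteq> snd q \<and> {fst q, snd q} \<in> E}"
  define j where "j q = {fst q, snd q}" for q :: "'a \<times> 'a"
  have finQ: "finite Q" using assms(1) by (simp add: Q_def)
  have finX: "finite (E \<inter> pairs_of U)"
    by (rule finite_subset[of _ "Pow U"]) (use assms(1) in \<open>auto simp: pairs_of_def\<close>)
  have "(\<Sum>x\<in>U. \<Sum>y\<in>U. if x \<noteq> y \<and> {x, y} \<in> E then g {x, y} else 0)
      = (\<Sum>q\<in>U \<times> U. if fst q \<noteq> snd q \<and> {fst q, snd q} \<in> E then g (j q) else 0)"
    unfolding sum.cartesian_product j_def by (simp add: case_prod_beta)
  also have "\<dots> = (\<Sum>q\<in>Q. g (j q))"
    unfolding Q_def using assms(1) by (intro sum.inter_filter[symmetric]) auto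
  also have "\<dots> = (\<Sum>e\<in>E \<inter> pairs_of U. \<Sum>q\<in>{q\<in>Q. j q = e}. g (j q))"
    using finQ finX by (intro sum.group[symmetric]) (auto simp: Q_def j_def doubleton_in_pairs_of)
  also have "\<dots> \<le> (\<Sum>e\<in>E \<inter> pairs_of U. 2 * g e)"
  proof (rule sum_mono)
    fix e assume "e \<in> E \<inter> pairs_of U"
    then obtain a b where e: "e = {a, b}" by (auto elim: in_pairs_ofE)
    have "{q\<in>Q. j q = e} \<subseteq> {(a, b), (b, a)}"
      by (auto simp: e j_def Q_def doubleton_eq_iff)
    then have "card {q\<in>Q. j q = e} \<le> card {(a, b), (b, a)}" by (intro card_mono) auto
    also have "\<dots> \<le> 2" using card_length[of "[(a, b), (b, a)]"] by (simp del: Pair_inject)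
    finally have c: "card {q\<in>Q. j q = e} \<le> 2" .
    have "(\<Sum>q\<in>{q\<in>Q. j q = e}. g (j q)) = (\<Sum>q\<in>{q\<in>Q. j q = e}. g e)"
      by (intro sum.cong) auto
    also have "\<dots> = real (card {q\<in>Q. j q = e}) * g e" by simp
    also have "\<dots> \<le> 2 * g e" using c assms(2) by (intro mult_right_mono) auto
    finally show "(\<Sum>q\<in>{q\<in>Q. j q = e}. g (j q)) \<le> 2 * g e" .
  qed
  finally show ?thesis by (simp add: sum_distrib_left)
qed

text \<open>Duality applied to the edges inside \<open>U\<close>. A cover of the triangles by edges extends to a
\<open>triangle_cover\<close> with value \<open>1\<close> on the diagonal, which satisfies the conditions for
degenerate triples at the cost of a linear term. The \<open>1\<close> that is subtracted is the loss in
\<open>approximate_packing_cover_duality\<close>.\<close>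

lemma fractional_packing_on_sample:
  assumes G: "co_triangle_free V E" and U: "finite U" "U \<subseteq> V"
    and \<B>: "finite \<B>" "\<Union>\<B> \<subseteq> U" "pairwise (\<lambda>A B. A \<inter> B = {}) \<B>"
      "\<And>B. B \<in> \<B> \<Longrightarrow> \<not> two_colourable B (nonadj V E)"
    and r: "card \<B> \<le> card U"
  shows "\<exists>w. (\<forall>t. 0 \<le> w t) \<and>
             (\<forall>e\<in>E \<inter> pairs_of U. (\<Sum>t\<in>{t\<in>edge_triples V E U. e \<in> t}. w t) \<le> 1) \<and>
             (real (card U))\<^sup>2 / 12 - real (card U) - 1 + (real (card \<B>))\<^sup>2 / 2000
               \<le> (\<Sum>t\<in>edge_triples V E U. w t)"
proof (rule approximate_packing_cover_duality[where \<tau> =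
      "(real (card U))\<^sup>2 / 12 - real (card U) + (real (card \<B>))\<^sup>2 / 2000"])
  let ?H = "nonadj V E"
  show "finite (E \<inter> pairs_of U)"
    by (rule finite_subset[of _ "Pow U"]) (use U in \<open>auto simp: pairs_of_def\<close>)
  show "finite (edge_triples V E U)" by (rule finite_edge_triples) fact
  show "t \<subseteq> E \<inter> pairs_of U" if "t \<in> edge_triples V E U" for t
    using that by (auto simp: edge_triples_def triangle_def pairs_of_def)
  show "{} \<notin> edge_triples V E U"
    using card_pairs_of_triangle by (fastforce simp: edge_triples_def)
  show "(real (card U))\<^sup>2 / 12 - real (card U) + (real (card \<B>))\<^sup>2 / 2000 \<le> (\<Sum>e\<in>E \<inter> pairs_of U. g e)"
    if g0: "\<And>e. 0 \<le> g e" and g1: "\<And>t. t \<in> edge_triples V E U \<Longrightarrow> 1 \<le> (\<Sum>e\<in>t. g e)" for g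
  proof -
    interpret triangle_free_relation ?H using G by (rule triangle_relation_nonadj)
    define gg where "gg x y = (if ?H x y then 0 else if x = y then 1 else g {x, y})" for x y
    have gg0: "0 \<le> gg x y" for x y using g0 by (simp add: gg_def)
    have diag: "gg x x = 1" for x using H_irrefl by (simp add: gg_def)
    have "triangle_cover ?H U gg"
    proof
      show "gg x y = gg y x" for x y using H_sym by (auto simp: gg_def insert_commute)
      show "1 \<le> gg x y + gg y z + gg x z"
        if inU: "x \<in> U" "y \<in> U" "z \<in> U" and non: "\<not> ?H x y" "\<not> ?H y z" "\<not> ?H x z" for x y z
      proof (cases "x = y \<or> y = z \<or> x = z")
        case True
        then show ?thesis using diag gg0[of x y] gg0[of y z] gg0[of x z]
          by (elim disjE) (auto intro: add_increasing add_increasing2)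
      next
        case False
        then have ne: "x \<noteq> y" "y \<noteq> z" "x \<noteq> z" by auto
        have "triangle V E {x, y, z}"
          unfolding triangle_def pairs_of_triple[OF ne]
          using ne inU U(2) not_nonadj[OF _ _ _ non(1)] not_nonadj[OF _ _ _ non(2)]
            not_nonadj[OF _ _ _ non(3)] by auto
        then have "pairs_of {x, y, z} \<in> edge_triples V E U"
          using inU unfolding edge_triples_def by auto
        then have "1 \<le> (\<Sum>e\<in>{{x, y}, {y, z}, {x, z}}. g e)"
          using g1 pairs_of_triple[OF ne] by metis
        also have "\<dots> = g {x, y} + g {y, z} + g {x, z}"
          using ne by (auto simp: doubleton_eq_iff)
        finally show ?thesis using ne non by (simp add: gg_def)
      qed
    qed (use U(1) gg0 in \<open>auto simp: gg_def\<close>)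
    then have "(real (card U))\<^sup>2 / 6 - real (card U) + (real (card \<B>))\<^sup>2 / 1000
        \<le> (\<Sum>x\<in>U. \<Sum>y\<in>U. gg x y)"
      by (rule cover_weight_lower_bound) (use \<B> r diag in auto)
    also have "\<dots> = (\<Sum>x\<in>U. \<Sum>y\<in>U. of_bool (x = y) + (if x \<noteq> y \<and> {x, y} \<in> E then g {x, y} else 0))"
    proof (intro sum.cong refl)
      fix x y assume "x \<in> U" "y \<in> U"
      then show "gg x y = of_bool (x = y) + (if x \<noteq> y \<and> {x, y} \<in> E then g {x, y} else 0)"
        using not_nonadj[of x V y E] edge_not_nonadj[of x y E V] U(2) H_irrefl by (auto simp: gg_def)
    qed
    also have "\<dots> = real (card U) + (\<Sum>x\<in>U. \<Sum>y\<in>U. if x \<noteq> y \<and> {x, y} \<in> E then g {x, y} else 0)"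
      using U(1) by (simp add: sum.distrib of_bool_def)
    also have "\<dots> \<le> real (card U) + 2 * (\<Sum>e\<in>E \<inter> pairs_of U. g e)"
      using sum_ordered_pairs_le[OF U(1) g0] by (rule add_left_mono)
    finally show ?thesis by simp
  qed
qed simp

text \<open>Every sample of \<open>m\<close> distinct vertices contributes its own fractional packing, and \<open>W\<close> is the average of
these, scaled such that an edge, which lies in about a fraction \<open>(m / n)\<^sup>2\<close> of the samples, gets load at most \<open>1\<close>. A
triangle lies in a fraction of at most \<open>(m / n) ^ 3\<close> of the samples, which makes its weight at most \<open>m / n\<close>.\<close>

lemma spread_fractional_packing:
  assumes G: "simple_graph V E" "co_triangle_free V E" and "V \<noteq> {}" and pos: "0 < m\<^sub>0" "0 < L"
    and test: "real (card V) ^ m\<^sub>0 / 2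
        \<le> sample_sum V m\<^sub>0 (\<lambda>xs. of_bool (\<not> two_colourable (set xs) (nonadj V E)))"
    and m: "m = L * m\<^sub>0"
  shows "\<exists>W. linear_triple_system.fractional_matching E (edge_triples V E V) (real m / real (card V)) W \<and>
     (real (card V))\<^sup>2 / (real m)\<^sup>2 *
       ((real m)\<^sup>2 / 12 - real m - 1 + (real L)\<^sup>2 / 8000 - (real m)\<^sup>2 * ((real m)\<^sup>2 / real (card V)))
     \<le> (\<Sum>t\<in>edge_triples V E V. W t)"
proof -
  let ?H = "nonadj V E"
  define n where "n = real (card V)"
  have finV: "finite V" using G by (simp add: simple_graph_def)
  have n: "0 < n" using \<open>V \<noteq> {}\<close> finV by (simp add: n_def card_gt_0_iff)
  have mpos: "0 < real m" using pos m by simp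
  define ok where "ok xs \<longleftrightarrow> distinct xs \<and> set xs \<subseteq> V \<and> length xs = m" for xs
  define bb where "bb xs = bad_blocks ?H m\<^sub>0 L xs" for xs
  define fits where "fits xs w \<longleftrightarrow> (\<forall>t. 0 \<le> w t) \<and>
      (\<forall>e\<in>E \<inter> pairs_of (set xs). (\<Sum>t\<in>{t\<in>edge_triples V E (set xs). e \<in> t}. w t) \<le> 1) \<and>
      (real m)\<^sup>2 / 12 - real m - 1 + (real (bb xs))\<^sup>2 / 2000 \<le> (\<Sum>t\<in>edge_triples V E (set xs). w t)"
    for xs w
  define w where "w xs = (SOME w. fits xs w)" for xs
  have "fits xs (w xs)" if "ok xs" for xs
  proof -
    have xs: "distinct xs" "set xs \<subseteq> V" "card (set xs) = m"
      using that distinct_card[of xs] by (auto simp: ok_def)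
    obtain \<B> where \<B>: "finite \<B>" "\<Union>\<B> \<subseteq> set xs" "pairwise (\<lambda>A B. A \<inter> B = {}) \<B>"
      "\<And>B. B \<in> \<B> \<Longrightarrow> \<not> two_colourable B ?H" "bad_blocks ?H m\<^sub>0 L xs = card \<B>"
      using bad_blocks_family[OF xs(1), of ?H m\<^sub>0 L] by metis
    have "L \<le> m" using pos m by simp
    then have "card \<B> \<le> card (set xs)"
      using bad_blocks_le[of ?H m\<^sub>0 L xs] xs(3) \<B>(5) by simp
    then have "\<exists>w. fits xs w"
      unfolding fits_def bb_def \<B>(5) xs(3)[symmetric]
      by (intro fractional_packing_on_sample[OF G(2) finite_set xs(2) \<B>(1-4)])
    then show ?thesis unfolding w_def by (rule someI_ex)
  qed
  note w = this[unfolded fits_def]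
  define w' where "w' xs t = (if ok xs \<and> t \<in> edge_triples V E (set xs) then w xs t else 0)" for xs t
  have w'0: "0 \<le> w' xs t" for xs t using w by (simp add: w'_def)
  have fin\<H>: "finite (edge_triples V E V)" by (rule finite_edge_triples) fact
  have fin\<T>: "finite (edge_triples V E (set xs))" for xs by (rule finite_edge_triples) simp
  have restrict: "(\<Sum>t\<in>{t\<in>edge_triples V E V. P t}. w' xs t) = (\<Sum>t\<in>{t\<in>edge_triples V E (set xs). P t}. w xs t)"
    if "ok xs" for xs P
  proof -
    have "edge_triples V E (set xs) \<subseteq> edge_triples V E V"
      using that by (intro edge_triples_mono) (simp add: ok_def)
    then have "(\<Sum>t\<in>{t\<in>edge_triples V E V. P t}. w' xs t) = (\<Sum>t\<in>{t\<in>edge_triples V E (set xs). P t}. w' xs t)"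
      using fin\<H> by (intro sum.mono_neutral_right) (auto simp: w'_def)
    also have "\<dots> = (\<Sum>t\<in>{t\<in>edge_triples V E (set xs). P t}. w xs t)"
      using that by (intro sum.cong) (auto simp: w'_def)
    finally show ?thesis .
  qed
  have load1: "(\<Sum>t\<in>{t\<in>edge_triples V E V. {x, y} \<in> t}. w' xs t) \<le> of_bool (x \<in> set xs \<and> y \<in> set xs)"
    if e: "{x, y} \<in> E" for x y xs
  proof (cases "ok xs")
    case True
    show ?thesis
    proof (cases "x \<in> set xs \<and> y \<in> set xs")
      case in_xs: True
      have "{x, y} \<in> pairs_of V" using e G by (auto simp: simple_graph_def)
      then have "{x, y} \<in> E \<inter> pairs_of (set xs)" using e in_xs by (simp add: doubleton_in_pairs_of)
      then show ?thesis using w[OF True] in_xs unfolding restrict[OF True] by simp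
    next
      case False
      then have "{t\<in>edge_triples V E (set xs). {x, y} \<in> t} = {}"
        by (auto simp: edge_triples_def doubleton_in_pairs_of)
      then show ?thesis unfolding restrict[OF True] by (simp only:) simp
    qed
  next
    case False
    then show ?thesis by (simp add: w'_def)
  qed
  have weight1: "w' xs t \<le> of_bool (x \<in> set xs \<and> y \<in> set xs \<and> z \<in> set xs)"
    if T: "triangle V E {x, y, z}" and t: "t = pairs_of {x, y, z}" and e: "{x, y} \<in> t" "{x, y} \<in> E" for xs t x y z
  proof (cases "ok xs \<and> t \<in> edge_triples V E (set xs)")
    case True
    then obtain T' where T': "T' \<subseteq> set xs" "triangle V E T'" "pairs_of T' = t"
      by (auto simp: edge_triples_def)
    have "T' = \<Union>(pairs_of T')" by (rule Union_pairs_of_triangle[OF T'(2), symmetric])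
    also have "\<dots> = {x, y, z}" unfolding T'(3) t by (rule Union_pairs_of_triangle[OF T])
    finally have inx: "x \<in> set xs" "y \<in> set xs" "z \<in> set xs" using T'(1) by auto
    have "t \<in> edge_triples V E V" using T t by (auto simp: edge_triples_def triangle_def)
    then have "w' xs t \<le> (\<Sum>t\<in>{t\<in>edge_triples V E V. {x, y} \<in> t}. w' xs t)"
      using e w'0 fin\<H> by (intro member_le_sum) auto
    also have "\<dots> \<le> of_bool (x \<in> set xs \<and> y \<in> set xs)" by (rule load1) fact
    finally show ?thesis using inx by simp
  qed (auto simp: w'_def)
  define \<beta>\<^sub>0 where "\<beta>\<^sub>0 = (real m)\<^sup>2 / 12 - real m - 1"
  (* The square of the number of bad blocks is replaced by its tangent at L / 2, since only
     the mean of that number is known. Lists with repetitions contribute nothing. *)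
  have total1: "\<beta>\<^sub>0 + (real L * real (bb xs) - (real L)\<^sup>2 / 4) / 2000 - (real m)\<^sup>2 * of_bool (\<not> distinct xs)
      \<le> (\<Sum>t\<in>edge_triples V E V. w' xs t)" if xs: "set xs \<subseteq> V" "length xs = m" for xs
  proof (cases "distinct xs")
    case True
    then have ok: "ok xs" using xs by (simp add: ok_def)
    have "0 \<le> (real (bb xs) - real L / 2)\<^sup>2" by simp
    then have "real L * real (bb xs) - (real L)\<^sup>2 / 4 \<le> (real (bb xs))\<^sup>2"
      by (simp add: power2_eq_square field_simps)
    then have "(real L * real (bb xs) - (real L)\<^sup>2 / 4) / 2000 \<le> (real (bb xs))\<^sup>2 / 2000"
      by (rule divide_right_mono) simp
    moreover have "(real m)\<^sup>2 / 12 - real m - 1 + (real (bb xs))\<^sup>2 / 2000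
        \<le> (\<Sum>t\<in>edge_triples V E (set xs). w xs t)" using w[OF ok] by blast
    moreover have "(\<Sum>t\<in>edge_triples V E V. w' xs t) = (\<Sum>t\<in>edge_triples V E (set xs). w xs t)"
      using restrict[OF ok, of "\<lambda>_. True"] by simp
    moreover have "(real m)\<^sup>2 * of_bool (\<not> distinct xs) = 0" using True by simp
    ultimately show ?thesis unfolding \<beta>\<^sub>0_def by linarith
  next
    case False
    have "bb xs \<le> L" unfolding bb_def by (rule bad_blocks_le)
    moreover have "L \<le> m" using pos m by simp
    ultimately have "real L * real (bb xs) \<le> real m * real m" by (intro mult_mono) auto
    then have "real L * real (bb xs) - (real L)\<^sup>2 / 4 \<le> (real m)\<^sup>2"
      using zero_le_power2[of "real L"] unfolding power2_eq_square by linarith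
    then have "(real L * real (bb xs) - (real L)\<^sup>2 / 4) / 2000 \<le> (real m)\<^sup>2 / 2000"
      by (rule divide_right_mono) simp
    moreover have "0 \<le> (real m)\<^sup>2" by simp
    moreover have "\<beta>\<^sub>0 \<le> (real m)\<^sup>2 / 12" by (simp add: \<beta>\<^sub>0_def)
    moreover have "0 \<le> (\<Sum>t\<in>edge_triples V E V. w' xs t)" by (intro sum_nonneg w'0)
    moreover have weight: "(real m)\<^sup>2 * of_bool (\<not> distinct xs) = (real m)\<^sup>2" using False by simp
    ultimately show ?thesis unfolding weight by linarith
  qed
  define c where "c = n\<^sup>2 / ((real m)\<^sup>2 * n ^ m)"
  have c: "0 < c" using n mpos by (simp add: c_def)
  define W where "W t = c * sample_sum V m (\<lambda>xs. w' xs t)" for t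
  have Wsum: "(\<Sum>t\<in>A. W t) = c * sample_sum V m (\<lambda>xs. \<Sum>t\<in>A. w' xs t)" for A
    by (simp add: W_def sample_sum_sum sum_distrib_left)
  interpret linear_triple_system E "edge_triples V E V"
    using G(1) by (rule linear_triple_system_triangles)
  have "fractional_matching (real m / n) W"
    unfolding fractional_matching_def
  proof (intro conjI ballI)
    fix t assume "t \<in> edge_triples V E V"
    then obtain T where T: "triangle V E T" "t = pairs_of T" by (auto simp: edge_triples_def)
    from T(1) obtain x y z where T3: "T = {x, y, z}" "pairs_of T = {{x, y}, {y, z}, {x, z}}" "{x, y} \<in> E"
      and xyz: "x \<noteq> y" "y \<noteq> z" "x \<noteq> z" by (metis triangleE)
    have "{x, y} \<in> t" using T(2) T3(2) by simp
    then have weight: "w' xs t \<le> of_bool (x \<in> set xs \<and> y \<in> set xs \<and> z \<in> set xs)" for xs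
      using T T3(1) T3(3) by (intro weight1) (simp_all only:)
    show "0 \<le> W t" unfolding W_def using c w'0 by (simp add: sample_sum_nonneg)
    have "n ^ 3 * sample_sum V m (\<lambda>xs. w' xs t)
        \<le> n ^ 3 * sample_sum V m (\<lambda>xs. of_bool (x \<in> set xs \<and> y \<in> set xs \<and> z \<in> set xs))"
      using n by (intro mult_left_mono sample_sum_mono weight) auto
    also have "\<dots> \<le> real m ^ 3 * n ^ m"
      unfolding n_def by (rule sample_hits_three[OF finV xyz])
    finally have "n ^ 3 * sample_sum V m (\<lambda>xs. w' xs t) \<le> real m ^ 3 * n ^ m" .
    then show "W t \<le> real m / n"
      unfolding W_def c_def using n mpos by (simp add: field_simps power2_eq_square power3_eq_cube)
  next
    fix e assume e: "e \<in> E"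
    then have "e \<in> pairs_of V" using G by (auto simp: simple_graph_def)
    then obtain x y where xy: "e = {x, y}" "x \<noteq> y" by (elim in_pairs_ofE)
    have "n\<^sup>2 * sample_sum V m (\<lambda>xs. \<Sum>t\<in>{t\<in>edge_triples V E V. e \<in> t}. w' xs t)
        \<le> n\<^sup>2 * sample_sum V m (\<lambda>xs. of_bool (x \<in> set xs \<and> y \<in> set xs))"
      unfolding xy(1) using e xy by (intro mult_left_mono sample_sum_mono load1) auto
    also have "\<dots> \<le> (real m)\<^sup>2 * n ^ m"
      unfolding n_def by (rule sample_hits_two[OF finV xy(2)])
    finally show "(\<Sum>t\<in>{t\<in>edge_triples V E V. e \<in> t}. W t) \<le> 1"
      unfolding Wsum c_def using n mpos by (simp add: field_simps)
  qed
  moreover have "n\<^sup>2 / (real m)\<^sup>2 * ((real m)\<^sup>2 / 12 - real m - 1 + (real L)\<^sup>2 / 8000 - (real m)\<^sup>2 * ((real m)\<^sup>2 / n))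
      \<le> (\<Sum>t\<in>edge_triples V E V. W t)"
  proof -
    define R where "R = sample_sum V m (\<lambda>xs. real (bb xs))"
    define B where "B = sample_sum V m (\<lambda>xs. of_bool (\<not> distinct xs))"
    have R: "real L / 2 * n ^ m \<le> R"
      unfolding R_def n_def bb_def m using test by (rule sample_bad_blocks)
    have B: "B \<le> (real m)\<^sup>2 / n * n ^ m"
      using sample_not_distinct[OF finV, of m] n by (simp add: B_def n_def field_simps)
    have "n ^ m * (\<beta>\<^sub>0 + (real L)\<^sup>2 / 8000 - (real m)\<^sup>2 * ((real m)\<^sup>2 / n))
        = (\<beta>\<^sub>0 - (real L)\<^sup>2 / 8000) * n ^ m + real L / 2000 * (real L / 2 * n ^ m)
          - (real m)\<^sup>2 * ((real m)\<^sup>2 / n * n ^ m)"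
      by (simp add: algebra_simps power2_eq_square)
    also have "\<dots> \<le> (\<beta>\<^sub>0 - (real L)\<^sup>2 / 8000) * n ^ m + real L / 2000 * R - (real m)\<^sup>2 * B"
      using mult_left_mono[OF R, of "real L / 2000"] mult_left_mono[OF B, of "(real m)\<^sup>2"]
      by (intro add_mono diff_mono order_refl) auto
    also have "\<dots> = sample_sum V m (\<lambda>xs. (\<beta>\<^sub>0 - (real L)\<^sup>2 / 8000) + (real L / 2000 * real (bb xs)
          + (- (real m)\<^sup>2) * of_bool (\<not> distinct xs)))"
      by (simp only: sample_sum_add sample_sum_mult sample_sum_const R_def B_def n_def)
    also have "\<dots> \<le> sample_sum V m (\<lambda>xs. \<Sum>t\<in>edge_triples V E V. w' xs t)"
    proof (rule sample_sum_mono)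
      fix xs assume xs: "set xs \<subseteq> V" "length xs = m"
      show "(\<beta>\<^sub>0 - (real L)\<^sup>2 / 8000) + (real L / 2000 * real (bb xs)
          + (- (real m)\<^sup>2) * of_bool (\<not> distinct xs)) \<le> (\<Sum>t\<in>edge_triples V E V. w' xs t)"
        using total1[OF xs] by (simp add: diff_divide_distrib)
    qed
    finally have "c * (n ^ m * (\<beta>\<^sub>0 + (real L)\<^sup>2 / 8000 - (real m)\<^sup>2 * ((real m)\<^sup>2 / n)))
        \<le> (\<Sum>t\<in>edge_triples V E V. W t)"
      unfolding Wsum using c by (intro mult_left_mono) auto
    moreover have "c * (n ^ m * v) = n\<^sup>2 / (real m)\<^sup>2 * v" for v
      using n mpos by (simp add: c_def)
    ultimately show ?thesis by (simp only: \<beta>\<^sub>0_def)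
  qed
  ultimately show ?thesis unfolding n_def by blast
qed

text \<open>Deleting the edges inside the two sides of a partition leaves a bipartite graph.\<close>

lemma many_mono_pairs:
  assumes G: "simple_graph V E" and far: "far_from_bipartite \<epsilon> V (compl_edges V E)"
  shows "\<epsilon> * (real (card V))\<^sup>2 \<le> real (card (mono_pairs V (nonadj V E) P))"
proof -
  define M where "M = mono_pairs V (nonadj V E) P"
  define F where "F = (\<lambda>q. {fst q, snd q}) ` M"
  have finM: "finite M" using G by (simp add: M_def mono_pairs_def simple_graph_def)
  have F: "F \<subseteq> compl_edges V E" by (auto simp: F_def M_def mono_pairs_def nonadj_def)
  have "bipartite V (compl_edges V E - F)"
    unfolding bipartite_def
  proof (rule exI[of _ "V \<inter> P"], rule exI[of _ "V - P"], intro conjI ballI)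
    fix e assume e: "e \<in> compl_edges V E - F"
    then have "e \<in> pairs_of V" by (simp add: compl_edges_def)
    then obtain x y where xy: "e = {x, y}" "x \<in> V" "y \<in> V" by (elim in_pairs_ofE)
    have "(x, y) \<notin> M"
    proof
      assume "(x, y) \<in> M"
      then have "{x, y} \<in> F" unfolding F_def by force
      then show False using e xy by simp
    qed
    then have "(x \<in> P) \<noteq> (y \<in> P)" using e xy by (auto simp: M_def mono_pairs_def nonadj_def)
    then show "\<exists>a\<in>V \<inter> P. \<exists>b\<in>V - P. e = {a, b}"
      using xy by (cases "x \<in> P") (auto simp: insert_commute)
  qed auto
  then have "\<epsilon> * (real (card V))\<^sup>2 \<le> real (card F)"
    using far F unfolding far_from_bipartite_def by blast
  also have "\<dots> \<le> real (card M)" using finM by (simp add: F_def card_image_le)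
  finally show ?thesis by (simp add: M_def)
qed

lemma triangle_packing_of_matching:
  assumes G: "simple_graph V E" and M: "linear_triple_system.matching (edge_triples V E V) M"
  shows "\<exists>P. triangle_packing V E P \<and> packing_size P = 3 * card M"
proof -
  interpret linear_triple_system E "edge_triples V E V"
    using G by (rule linear_triple_system_triangles)
  define P where "P = {T. triangle V E T \<and> pairs_of T \<in> M}"
  have inj: "inj_on pairs_of P"
    by (rule inj_on_subset[OF inj_on_pairs_of_triangle]) (auto simp: P_def)
  have "M \<subseteq> edge_triples V E V" using M by (simp add: matching_def)
  then have "\<exists>T. triangle V E T \<and> t = pairs_of T" if "t \<in> M" for t
    using that by (auto simp: edge_triples_def)
  then have "pairs_of ` P = M" by (fastforce simp: P_def)
  then have "card M = card P" using card_image[OF inj] by simp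
  moreover have pack: "triangle_packing V E P"
    unfolding triangle_packing_def pairwise_def
  proof (intro conjI ballI impI)
    fix S T assume ST: "S \<in> P" "T \<in> P" "S \<noteq> T"
    then have "pairs_of S \<noteq> pairs_of T" using inj by (auto simp: inj_on_def)
    then show "pairs_of S \<inter> pairs_of T = {}"
      using M ST by (auto simp: P_def matching_def pairwise_def)
  qed (simp add: P_def)
  ultimately show ?thesis using packing_size_eq[OF G pack] by auto
qed

text \<open>The number \<open>L\<close> of blocks in a sample is large enough for the quadratic gain from bad blocks to dominate
the linear losses, and the graph is large compared with the length \<open>m\<close> of the samples.\<close>

lemma large_packing_if_far_from_bipartite:
  fixes \<epsilon> :: real
  assumes "0 < \<epsilon>"
  shows "\<exists>\<delta>>0. \<exists>n\<^sub>0. \<forall>(V :: 'a set) E. simple_graph V E \<and> n\<^sub>0 \<le> card V \<and> co_triangle_free V E \<and>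
           far_from_bipartite \<epsilon> V (compl_edges V E) \<longrightarrow>
           (\<exists>P. triangle_packing V E P \<and> (1 / 4 + \<delta>) * (real (card V))\<^sup>2 \<le> real (packing_size P))"
proof -
  define \<epsilon>' where "\<epsilon>' = min \<epsilon> 1 / 2"
  have \<epsilon>': "0 < \<epsilon>'" "\<epsilon>' \<le> 1" "2 * \<epsilon>' \<le> \<epsilon>" using assms by (auto simp: \<epsilon>'_def)
  obtain m\<^sub>0 where m\<^sub>0: "0 < m\<^sub>0" and tester: "\<And>(V :: 'a set) H. finite V \<Longrightarrow> V \<noteq> {} \<Longrightarrow>
      (\<forall>x y. H x y \<longrightarrow> H y x) \<Longrightarrow>
      (\<forall>P. 2 * \<epsilon>' * (real (card V))\<^sup>2 \<le> real (card (mono_pairs V H P))) \<Longrightarrow>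
      real (card V) ^ m\<^sub>0 / 2 \<le> sample_sum V m\<^sub>0 (\<lambda>xs. of_bool (\<not> two_colourable (set xs) H))"
    using bipartiteness_tester[OF \<epsilon>'(1,2)] by metis
  (* The gain (real L)\<^sup>2 / 8000 of a sample, relative to (real m)\<^sup>2, is 4 * \<delta>. *)
  define \<delta> where "\<delta> = 1 / (32000 * (real m\<^sub>0)\<^sup>2)"
  have \<delta>: "0 < \<delta>" using m\<^sub>0 by (simp add: \<delta>_def)
  define L where "L = nat \<lceil>2 / \<delta>\<rceil>"
  have L: "2 / \<delta> \<le> real L" unfolding L_def by (rule real_nat_ceiling_ge)
  then have L0: "0 < L" using \<delta> by (cases "L = 0") auto
  define m where "m = L * m\<^sub>0"
  have m1: "1 \<le> real m" "2 / \<delta> \<le> real m"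
  proof -
    have "L \<le> m" "1 \<le> m" using m\<^sub>0 L0 by (auto simp: m_def)
    then show "1 \<le> real m" "2 / \<delta> \<le> real m" using L by linarith+
  qed
  obtain \<mu>\<^sub>0 where \<mu>\<^sub>0: "0 < \<mu>\<^sub>0" and rounding: "\<And>X (\<H> :: 'a set set set) w. linear_triple_system X \<H> \<Longrightarrow>
      linear_triple_system.fractional_matching X \<H> \<mu>\<^sub>0 w \<Longrightarrow>
      (\<exists>M. linear_triple_system.matching \<H> M \<and> (\<Sum>T\<in>\<H>. w T) - \<delta> * real (card X) \<le> real (card M))"
    using spread_fractional_matching_rounding[OF \<delta>] by metis
  define n\<^sub>0 where "n\<^sub>0 = Suc (nat \<lceil>real m / \<mu>\<^sub>0\<rceil> + nat \<lceil>(real m)\<^sup>2 / \<delta>\<rceil>)"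
  have "\<exists>P. triangle_packing V E P \<and> (1 / 4 + \<delta>) * (real (card V))\<^sup>2 \<le> real (packing_size P)"
    if G: "simple_graph V E" "co_triangle_free V E" and N: "n\<^sub>0 \<le> card V"
      and far: "far_from_bipartite \<epsilon> V (compl_edges V E)" for V :: "'a set" and E
  proof -
    define n where "n = real (card V)"
    have finV: "finite V" using G by (simp add: simple_graph_def)
    have "V \<noteq> {}" using N by (auto simp: n\<^sub>0_def)
    have n: "0 < n" "real m / \<mu>\<^sub>0 \<le> n" "(real m)\<^sup>2 / \<delta> \<le> n"
    proof -
      have "nat \<lceil>real m / \<mu>\<^sub>0\<rceil> \<le> card V" "nat \<lceil>(real m)\<^sup>2 / \<delta>\<rceil> \<le> card V" "0 < card V"
        using N unfolding n\<^sub>0_def by linarith+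
      then show "0 < n" "real m / \<mu>\<^sub>0 \<le> n" "(real m)\<^sup>2 / \<delta> \<le> n"
        using real_nat_ceiling_ge[of "real m / \<mu>\<^sub>0"] real_nat_ceiling_ge[of "(real m)\<^sup>2 / \<delta>"]
        unfolding n_def by linarith+
    qed
    interpret triangle_free_relation "nonadj V E" using G(2) by (rule triangle_relation_nonadj)
    interpret linear_triple_system E "edge_triples V E V"
      using G(1) by (rule linear_triple_system_triangles)
    have mono: "2 * \<epsilon>' * (real (card V))\<^sup>2 \<le> real (card (mono_pairs V (nonadj V E) P))" for P
    proof -
      have "2 * \<epsilon>' * (real (card V))\<^sup>2 \<le> \<epsilon> * (real (card V))\<^sup>2" using \<epsilon>' by (intro mult_right_mono) auto
      then show ?thesis using many_mono_pairs[OF G(1) far, of P] by linarith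
    qed
    have test: "real (card V) ^ m\<^sub>0 / 2
        \<le> sample_sum V m\<^sub>0 (\<lambda>xs. of_bool (\<not> two_colourable (set xs) (nonadj V E)))"
      using tester[OF finV \<open>V \<noteq> {}\<close>, of "nonadj V E"] H_sym mono by blast
    obtain W where W: "fractional_matching (real m / n) W"
      and tot: "n\<^sup>2 / (real m)\<^sup>2 * ((real m)\<^sup>2 / 12 - real m - 1 + (real L)\<^sup>2 / 8000
          - (real m)\<^sup>2 * ((real m)\<^sup>2 / n)) \<le> (\<Sum>t\<in>edge_triples V E V. W t)"
      using spread_fractional_packing[OF G \<open>V \<noteq> {}\<close> m\<^sub>0 L0 test m_def] unfolding n_def by blast
    have "real m / n \<le> \<mu>\<^sub>0" using n \<mu>\<^sub>0 by (simp add: field_simps)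
    then have "fractional_matching \<mu>\<^sub>0 W"
      using W unfolding fractional_matching_def by (meson order_trans)
    then obtain M where M: "matching M"
      and Mc: "(\<Sum>t\<in>edge_triples V E V. W t) - \<delta> * real (card E) \<le> real (card M)"
      using rounding[OF linear_triple_system_axioms] by blast
    have cE: "real (card E) \<le> n\<^sup>2"
    proof -
      have "E \<subseteq> (\<lambda>q. {fst q, snd q}) ` (V \<times> V)"
      proof
        fix e assume "e \<in> E"
        then have "e \<in> pairs_of V" using G(1) by (auto simp: simple_graph_def)
        then obtain x y where "e = {x, y}" "x \<in> V" "y \<in> V" by (elim in_pairs_ofE)
        then show "e \<in> (\<lambda>q. {fst q, snd q}) ` (V \<times> V)" by (intro image_eqI[of _ _ "(x, y)"]) auto
      qed
      then have "card E \<le> card ((\<lambda>q. {fst q, snd q}) ` (V \<times> V))"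
        using finV by (intro card_mono) auto
      also have "\<dots> \<le> card (V \<times> V)" using finV by (intro card_image_le) auto
      finally have "card E \<le> card (V \<times> V)" .
      then have "real (card E) \<le> real (card V * card V)"
        by (simp only: card_cartesian_product of_nat_le_iff)
      then show ?thesis by (simp add: n_def power2_eq_square)
    qed
    have "n\<^sup>2 * (1 / 12 + 2 * \<delta>) \<le> n\<^sup>2 * (1 / 12 - (real m + 1) / (real m)\<^sup>2 + 4 * \<delta> - (real m)\<^sup>2 / n)"
    proof (rule mult_left_mono)
      have "(real m)\<^sup>2 / n \<le> \<delta>" using n \<delta> by (simp add: field_simps)
      moreover have "(real m + 1) / (real m)\<^sup>2 \<le> 2 * real m / (real m)\<^sup>2"
        using m1 by (intro divide_right_mono) auto
      moreover have "2 * real m / (real m)\<^sup>2 = 2 / real m" using m1 by (simp add: power2_eq_square)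
      moreover have "2 / real m \<le> \<delta>" using m1 \<delta> by (simp add: field_simps)
      ultimately show "1 / 12 + 2 * \<delta> \<le> 1 / 12 - (real m + 1) / (real m)\<^sup>2 + 4 * \<delta> - (real m)\<^sup>2 / n"
        by linarith
    qed simp
    also have "\<dots> = n\<^sup>2 / (real m)\<^sup>2 * ((real m)\<^sup>2 / 12 - real m - 1 + (real L)\<^sup>2 / 8000
          - (real m)\<^sup>2 * ((real m)\<^sup>2 / n))"
    proof -
      have "(real L)\<^sup>2 / 8000 = 4 * \<delta> * (real m)\<^sup>2"
        using m\<^sub>0 by (simp add: \<delta>_def m_def power_mult_distrib field_simps)
      then show ?thesis using m1 n by (simp add: field_simps)
    qed
    also note tot
    finally have "n\<^sup>2 * (1 / 12 + 2 * \<delta>) \<le> (\<Sum>t\<in>edge_triples V E V. W t)" .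
    moreover have "\<delta> * real (card E) \<le> \<delta> * n\<^sup>2" using cE \<delta> by (intro mult_left_mono) auto
    ultimately have "n\<^sup>2 * (1 / 12 + \<delta>) \<le> real (card M)" using Mc by (simp add: algebra_simps)
    moreover have "0 \<le> n\<^sup>2 * \<delta>" using \<delta> by simp
    ultimately have "(1 / 4 + \<delta>) * n\<^sup>2 \<le> 3 * real (card M)" by (simp add: algebra_simps)
    moreover obtain P where "triangle_packing V E P" "packing_size P = 3 * card M"
      using triangle_packing_of_matching[OF G(1) M] by blast
    ultimately show ?thesis by (intro exI[of _ P]) (simp add: n_def)
  qed
  then show ?thesis using \<delta> by (intro exI[of _ \<delta>] conjI exI[of _ n\<^sub>0]) blast+
qed

section \<open>Co-triangle-free graphs whose complement is far from bipartite\<close>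

theorem theorem1p4:
  "\<forall>\<epsilon>>0. \<exists>\<delta>>0. \<exists>h :: nat \<Rightarrow> real. h \<in> o(\<lambda>n. (real n)\<^sup>2) \<and>
     (\<forall>n. \<forall>(V :: 'a set) E. simple_graph V E \<and> card V = n \<and> co_triangle_free V E \<and>
        far_from_bipartite \<epsilon> V (compl_edges V E) \<longrightarrow>
        (\<exists>P. triangle_packing V E P \<and>
             real (packing_size P) \<ge> (1 / 4 + \<delta>) * (real n)\<^sup>2 + h n))"
proof (intro allI impI)
  fix \<epsilon> :: real assume "0 < \<epsilon>"
  then obtain \<delta> n\<^sub>0 where \<delta>: "0 < \<delta>" and large: "\<And>(V :: 'a set) E. simple_graph V E \<Longrightarrow>
      n\<^sub>0 \<le> card V \<Longrightarrow> co_triangle_free V E \<Longrightarrow> far_from_bipartite \<epsilon> V (compl_edges V E) \<Longrightarrow>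
      \<exists>P. triangle_packing V E P \<and> (1 / 4 + \<delta>) * (real (card V))\<^sup>2 \<le> real (packing_size P)"
    using large_packing_if_far_from_bipartite[of \<epsilon>, where ?'a = 'a] by metis
  (* For small n the error term makes the bound trivial. *)
  define h where "h n = (if n < n\<^sub>0 then - ((1 / 4 + \<delta>) * (real n)\<^sup>2) else 0)" for n
  have "eventually (\<lambda>n. h n = 0) sequentially"
    unfolding h_def by (rule eventually_mono[OF eventually_ge_at_top[of n\<^sub>0]]) auto
  then have "h \<in> o(\<lambda>n. (real n)\<^sup>2)"
    by (subst landau_o.small.in_cong[of h "\<lambda>_. 0"]) auto
  moreover have "\<exists>P. triangle_packing V E P \<and> (1 / 4 + \<delta>) * (real n)\<^sup>2 + h n \<le> real (packing_size P)"
    if "simple_graph V E \<and> card V = n \<and> co_triangle_free V E \<and>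
        far_from_bipartite \<epsilon> V (compl_edges V E)" for n and V :: "'a set" and E
  proof (cases "n < n\<^sub>0")
    case True
    then show ?thesis
      by (intro exI[of _ "{}"]) (simp add: h_def triangle_packing_def packing_size_def)
  next
    case False
    then show ?thesis using large[of V E] that by (auto simp: h_def)
  qed
  ultimately show "\<exists>\<delta>>0. \<exists>h :: nat \<Rightarrow> real. h \<in> o(\<lambda>n. (real n)\<^sup>2) \<and>
     (\<forall>n. \<forall>(V :: 'a set) E. simple_graph V E \<and> card V = n \<and> co_triangle_free V E \<and>
        far_from_bipartite \<epsilon> V (compl_edges V E) \<longrightarrow>
        (\<exists>P. triangle_packing V E P \<and>
             real (packing_size P) \<ge> (1 / 4 + \<delta>) * (real n)\<^sup>2 + h n))"
    using \<delta> by blast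
qed

end
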